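(* Let $\Bbbk$ be an algebraically closed field of characteristic $p>0$. Let $L\in\Bbbk[[x]][\partial]$ be a differential operator with initial form $L_0$ and shift $\tau=0$, acting on $\mathcal{R}=\bigoplus_{\rho\in\Bbbk}t^\rho\Bbbk(z)((x))$. Let $\rho$ be a local exponent of $L$ at $0$ and let $\mathcal{F}=t^\rho\sum_{k=0}^\infty\bigoplus_{\alpha\in\mathcal{A}_k}\Bbbk z^\alpha x^k\subset\mathcal{R}$ be the associated $\rho$-function space. Let $\mathcal{H}\subseteq\mathcal{F}$ be the subspace topologically spanned by the monomials $t^\rho x^kz^\alpha$ with $k\ge 0$, $\alpha\in\mathcal{A}_k$ and $e(\alpha)\ge m_{\rho+k}$. (i) The map $L_0|_{\mathcal{H}}:\mathcal{H}\to\mathcal{F}x$ is bijective, and the composition of its inverse $(L_0|_{\mathcal{H}})^{-1}:\mathcal{F}x\to\mathcal{H}$ with the inclusion $\mathcal{H}\subseteq\mathcal{F}$ defines a $\mathcal{C}$-linear right inverse $S:\mathcal{F}x\to\mathcal{F}$ of $L_0$. (ii) Let $T=L_0-L:\mathcal{F}\to\mathcal{F}x$. Then the map $u=\mathrm{Id}_{\mathcal{F}}-S\circ T:\mathcal{F}\to\mathcal{F}$ is a continuous $\mathcal{C}$-linear automorphism of $\mathcal{F}$ with inverse $v=\sum_{k=0}^\infty(S\circ T)^k:\mathcal{F}\to\mathcal{F}$. (iii) The automorphism $v$ of $\mathcal{F}$ transforms $L$ into $L_0$, i.e. $L\circ v=L_0$.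
   Context: $\mathbb{N}=\{0,1,2,\ldots\}$; $\mathbb{N}^{(\mathbb{N})}$ is the set of sequences $\alpha=(\alpha_1,\alpha_2,\ldots)$ of natural numbers with finite support. $z=(z_1,z_2,\ldots)$ are countably many variables, $z^\alpha=\prod_iz_i^{\alpha_i}$, $\Bbbk(z)=\Bbbk(z_1,z_2,\ldots)$, $\Bbbk(z^p)=\Bbbk(z_1^p,z_2^p,\ldots)$, and $\mathbb{F}_p$ is the prime field of $\Bbbk$. The ring $\mathcal{R}=\bigoplus_{\rho\in\Bbbk}t^\rho\,\Bbbk(z)((x))$ is the group algebra of the additive group of $\Bbbk$ over $\Bbbk(z)((x))$, i.e. $(t^\rho f)(t^\sigma g)=t^{\rho+\sigma}fg$, $t^0=1$. Its derivation $\partial$ (extended termwise to Laurent series in $x$) is $\Bbbk$-linear with $\partial x=1$, $\partial t^\rho=\rho\,t^\rho\frac1x$, $\partial z_1=\frac1x$, $\partial z_k=\frac{1}{x\,z_1\cdots z_{k-1}}$ for $k\ge2$. Its field of constants is $\mathcal{C}=\bigoplus_{\sigma\in\mathbb{F}_p}t^\sigma x^{p-\sigma}\Bbbk(z^p)((x^p))$ (in exponents of $x$, $\sigma$ is represented in $\{0,\ldots,p-1\}$). Write $L=\sum_{j=0}^n\sum_{i\ge0}c_{ij}x^i\partial^j$. The shift of $L$ is the minimal $i-j$ with $c_{ij}\ne0$; for shift $0$ the initial form is $L_0=\sum_{i=0}^nc_{ii}x^i\partial^i$. The indicial polynomial is $\chi_L(s)=\sum_ic_{ii}s(s-1)\cdots(s-i+1)\in\Bbbk[s]$;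 its roots are the local exponents, and $m_\sigma$ is the multiplicity of $\sigma\in\Bbbk$ as a root of $\chi_L$ ($m_\sigma=0$ if $\sigma$ is not a root). For $\rho\in \Bbbk$ and $k\in\mathbb{Z}$, $\rho+k$ means $\rho$ plus the image of $k$ in $\mathbb{F}_p\subseteq\Bbbk$. For the local exponent $\rho$ put $n_\rho(k)=m_\rho+m_{\rho+1}+\cdots+m_{\rho+k}$ for $k\in\mathbb{N}$, and $$\mathcal{A}_k=\{\alpha\in\mathbb{N}^{(\mathbb{N})}\mid\alpha_1<n_\rho(k),\ \alpha_{j+1}\le\alpha_j/p\ \text{for all } j\ge 1\},$$ a finite set. The $\rho$-function space $\mathcal{F}$ consists of all (possibly infinite) formal sums $t^\rho\sum_{k\ge0}f_kx^k$ with $f_k\in\bigoplus_{\alpha\in\mathcal{A}_k}\Bbbk z^\alpha$, and $\mathcal{F}x=\{fx\mid f\in\mathcal{F}\}$. $\mathcal{F}$ carries the $x$-adic topology (elements viewed as power series in $x$); "topologically spanned" means that infinite sums convergent in this topology are allowed. For $\alpha$, $e(\alpha)=\overline{\alpha}_1+p\overline{\alpha}_2+p^2\overline{\alpha}_3+\cdots$ where $\overline{\alpha}_i\in\{0,\ldots,p-1\}$, $\overline{\alpha}_i\equiv\alpha_i \bmod p$. A map between such subspaces of $\mathcal{R}$ is called $\mathcal{C}$-linear if it is $\Bbbk$-linear and commutes with multiplication by $c\in\mathcal{C}$ whenever both an element $f$ and $cf$ lie in its domain. *)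

theory Defs
  imports
    "HOL-Analysis.Abstract_Limits"
    "HOL-Analysis.Abstract_Topology"
    "HOL-Computational_Algebra.Polynomial"
    "HOL-Computational_Algebra.Fraction_Field"
    "HOL-Computational_Algebra.Formal_Laurent_Series"
    "HOL-Library.Poly_Mapping"
begin

unbundle fps_syntax

text \<open>
  The variables are numbered from 0: the variable \<open>z\<^sub>i\<^sub>+\<^sub>1\<close> and the entry \<open>\<alpha>\<^sub>i\<^sub>+\<^sub>1\<close> of an exponent
  sequence have index \<open>i\<close> here.  The ring \<open>\<Oplus>\<^sub>\<rho> t\<^sup>\<rho> k(z)((x))\<close> is the type of finitely
  supported functions from the additive group of \<open>k\<close> to \<open>k(z)((x))\<close>, whose library
  multiplication is convolution.
\<close>

type_synonym expo = "nat \<Rightarrow>\<^sub>0 nat"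
type_synonym 'k zpoly = "expo \<Rightarrow>\<^sub>0 'k"
type_synonym 'k zrat = "'k zpoly fract"
type_synonym 'k tring = "'k \<Rightarrow>\<^sub>0 'k zrat fls"


subsection \<open>The field \<open>k(z)\<close> and its derivation\<close>

definition zconst :: "'k::idom \<Rightarrow> 'k zrat" where
  "zconst c = Fract (Poly_Mapping.single 0 c) 1"

definition zmonom :: "expo \<Rightarrow> 'k::idom zrat" where
  "zmonom \<alpha> = Fract (Poly_Mapping.single \<alpha> 1) 1"

definition zvar :: "nat \<Rightarrow> 'k::idom zrat" where
  "zvar i = zmonom (Poly_Mapping.single i 1)"

definition zpoly_pderiv :: "nat \<Rightarrow> 'k::idom zpoly \<Rightarrow> 'k zpoly" where
  "zpoly_pderiv i P =
     (\<Sum>\<alpha>\<in>Poly_Mapping.keys P.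
        Poly_Mapping.single (\<alpha> - Poly_Mapping.single i 1)
          (of_nat (Poly_Mapping.lookup \<alpha> i) * Poly_Mapping.lookup P \<alpha>))"

definition zpoly_vars :: "'k::idom zpoly \<Rightarrow> nat set" where
  "zpoly_vars P = (\<Union>\<alpha>\<in>Poly_Mapping.keys P. Poly_Mapping.keys \<alpha>)"

text \<open>
  The derivation \<open>\<delta> = x \<partial>\<close> of \<open>k(z)\<close>, that is \<open>\<delta> z\<^sub>k = 1 / (z\<^sub>1 \<cdots> z\<^sub>k\<^sub>-\<^sub>1)\<close>, first on polynomials
  and then on fractions by the quotient rule.
\<close>

definition zpoly_deriv :: "'k::idom zpoly \<Rightarrow> 'k zrat" where
  "zpoly_deriv P = (\<Sum>i\<in>zpoly_vars P. Fract (zpoly_pderiv i P) 1 / (\<Prod>j<i. zvar j))"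

definition zrat_deriv :: "'k::idom zrat \<Rightarrow> 'k zrat" where
  "zrat_deriv q =
     (THE d. \<exists>P Q. Q \<noteq> 0 \<and> q = Fract P Q \<and>
        d = (zpoly_deriv P * Fract Q 1 - Fract P 1 * zpoly_deriv Q) / (Fract Q 1)\<^sup>2)"


subsection \<open>The ring and its derivation\<close>

definition fls_map :: "('a::zero \<Rightarrow> 'b::zero) \<Rightarrow> 'a fls \<Rightarrow> 'b fls" where
  "fls_map h f = Abs_fls (\<lambda>n. h (f $$ n))"

text \<open>\<open>\<partial>(t\<^sup>\<sigma> g) = t\<^sup>\<sigma> (dg/dx + x\<^sup>-\<^sup>1 (\<delta> g + \<sigma> g))\<close> with \<open>\<delta>\<close> acting on the coefficients of \<open>g\<close>.\<close>

definition tderiv :: "'k::field tring \<Rightarrow> 'k tring" where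
  "tderiv = Poly_Mapping.mapp (\<lambda>\<sigma> g.
     fls_deriv g + fls_X_inv * (fls_map zrat_deriv g + fls_const (zconst \<sigma>) * g))"

definition tconst :: "'k::field \<Rightarrow> 'k tring" where
  "tconst c = Poly_Mapping.single 0 (fls_const (zconst c))"

definition tX :: "'k::field tring" where
  "tX = Poly_Mapping.single 0 fls_X"

definition tmonom :: "'k::field \<Rightarrow> nat \<Rightarrow> expo \<Rightarrow> 'k tring" where
  "tmonom \<rho> k \<alpha> = Poly_Mapping.single \<rho> (fls_X ^ k * fls_const (zmonom \<alpha>))"

definition tser :: "'k::field fps \<Rightarrow> 'k tring" where
  "tser a = Poly_Mapping.single 0 (fps_to_fls (Abs_fps (\<lambda>i. zconst (a $ i))))"


subsection \<open>The constants\<close>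

text \<open>\<open>k(z\<^sup>p)\<close>: quotients of polynomials all of whose exponents are divisible by \<open>p\<close>.\<close>

definition zrat_pth :: "'k::field zrat set" where
  "zrat_pth = {Fract P Q | P Q. Q \<noteq> 0 \<and>
     (\<forall>\<alpha>\<in>Poly_Mapping.keys P \<union> Poly_Mapping.keys Q. \<forall>i. CHAR('k) dvd Poly_Mapping.lookup \<alpha> i)}"

definition fls_pth :: "'k::field zrat fls set" where
  "fls_pth = {g. \<forall>n. g $$ n \<in> zrat_pth \<and> (g $$ n \<noteq> 0 \<longrightarrow> int CHAR('k) dvd n)}"

definition tconstants :: "'k::field tring set" where
  "tconstants =
     {\<Sum>s<CHAR('k). Poly_Mapping.single (of_nat s) (fls_X ^ (CHAR('k) - s) * g s) | g.
        \<forall>s<CHAR('k). g s \<in> fls_pth}"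

definition C_linear_on :: "'k::field tring set \<Rightarrow> ('k tring \<Rightarrow> 'k tring) \<Rightarrow> bool" where
  "C_linear_on A \<phi> \<longleftrightarrow>
     (\<forall>f\<in>A. \<forall>g\<in>A. \<phi> (f + g) = \<phi> f + \<phi> g) \<and>
     (\<forall>a. \<forall>f\<in>A. \<phi> (tconst a * f) = tconst a * \<phi> f) \<and>
     (\<forall>c\<in>tconstants. \<forall>f\<in>A. c * f \<in> A \<longrightarrow> \<phi> (c * f) = c * \<phi> f)"


subsection \<open>Differential operators\<close>

text \<open>
  An operator \<open>\<Sum>\<^sub>j a\<^sub>j \<partial>\<^sup>j\<close> with \<open>a\<^sub>j\<close> in \<open>k[[x]]\<close> is encoded by the polynomial with coefficients
  \<open>a\<^sub>j\<close>; only the additive structure of this polynomial type is meaningful, its product is not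
  the composition of operators.  In the notation \<open>\<Sum> c\<^sub>i\<^sub>j x\<^sup>i \<partial>\<^sup>j\<close> we have \<open>c\<^sub>i\<^sub>j = coeff L j $ i\<close>.
\<close>

definition op_act :: "'k::field fps poly \<Rightarrow> 'k tring \<Rightarrow> 'k tring" where
  "op_act L f = (\<Sum>j\<le>degree L. tser (coeff L j) * (tderiv ^^ j) f)"

definition is_shift :: "'k::field fps poly \<Rightarrow> int \<Rightarrow> bool" where
  "is_shift L \<tau> \<longleftrightarrow>
     (\<exists>i j. coeff L j $ i \<noteq> 0 \<and> int i - int j = \<tau>) \<and>
     (\<forall>i j. coeff L j $ i \<noteq> 0 \<longrightarrow> \<tau> \<le> int i - int j)"

text \<open>The next two definitions are the ones for operators of shift 0.\<close>

definition initial_form :: "'k::field fps poly \<Rightarrow> 'k fps poly" where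
  "initial_form L = (\<Sum>i\<le>degree L. monom (fps_const (coeff L i $ i) * fps_X ^ i) i)"

definition indicial_poly :: "'k::field fps poly \<Rightarrow> 'k poly" where
  "indicial_poly L = (\<Sum>i\<le>degree L. smult (coeff L i $ i) (\<Prod>j<i. [:- of_nat j, 1:]))"

definition expo_mult :: "'k::field fps poly \<Rightarrow> 'k \<Rightarrow> nat" where
  "expo_mult L \<sigma> = order \<sigma> (indicial_poly L)"


subsection \<open>The function space of a local exponent\<close>

definition mult_sum :: "'k::field fps poly \<Rightarrow> 'k \<Rightarrow> nat \<Rightarrow> nat" where
  "mult_sum L \<rho> k = (\<Sum>i\<le>k. expo_mult L (\<rho> + of_nat i))"

definition admissible :: "'k::field fps poly \<Rightarrow> 'k \<Rightarrow> nat \<Rightarrow> expo set" where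
  "admissible L \<rho> k =
     {\<alpha>. Poly_Mapping.lookup \<alpha> 0 < mult_sum L \<rho> k \<and>
         (\<forall>j. CHAR('k) * Poly_Mapping.lookup \<alpha> (Suc j) \<le> Poly_Mapping.lookup \<alpha> j)}"

definition fun_space :: "'k::field fps poly \<Rightarrow> 'k \<Rightarrow> 'k tring set" where
  "fun_space L \<rho> =
     {Poly_Mapping.single \<rho> (fps_to_fls (Abs_fps (\<lambda>k. Fract (P k) 1))) | P.
        \<forall>k. Poly_Mapping.keys (P k) \<subseteq> admissible L \<rho> k}"

text \<open>The \<open>x\<close>-adic topology is the one of the library's metric on Laurent series.\<close>

definition xadic_topology :: "'k::field fps poly \<Rightarrow> 'k \<Rightarrow> 'k tring topology" where
  "xadic_topology L \<rho> =
     pullback_topology (fun_space L \<rho>) (\<lambda>f. Poly_Mapping.lookup f \<rho>) euclidean"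

definition expo_weight :: "nat \<Rightarrow> expo \<Rightarrow> nat" where
  "expo_weight p \<alpha> = (\<Sum>i\<in>Poly_Mapping.keys \<alpha>. p ^ i * (Poly_Mapping.lookup \<alpha> i mod p))"

definition H_index :: "'k::field fps poly \<Rightarrow> 'k \<Rightarrow> (nat \<times> expo) set" where
  "H_index L \<rho> =
     {(k, \<alpha>). \<alpha> \<in> admissible L \<rho> k \<and> expo_weight CHAR('k) \<alpha> \<ge> expo_mult L (\<rho> + of_nat k)}"

text \<open>All (possibly infinite) linear combinations of the monomials that converge in the space.\<close>

definition H_space :: "'k::field fps poly \<Rightarrow> 'k \<Rightarrow> 'k tring set" where
  "H_space L \<rho> =
     {f. \<exists>c. limitin (xadic_topology L \<rho>)
               (\<lambda>I. \<Sum>(k, \<alpha>)\<in>I. tconst (c k \<alpha>) * tmonom \<rho> k \<alpha>) f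
               (finite_subsets_at_top (H_index L \<rho>))}"

definition topological_sum :: "'a::comm_monoid_add topology \<Rightarrow> (nat \<Rightarrow> 'a) \<Rightarrow> 'a" where
  "topological_sum X a = (THE s. limitin X (\<lambda>n. \<Sum>k<n. a k) s sequentially)"

definition cont_C_automorphism ::
  "'k::field tring topology \<Rightarrow> ('k tring \<Rightarrow> 'k tring) \<Rightarrow> bool" where
  "cont_C_automorphism X \<phi> \<longleftrightarrow>
     bij_betw \<phi> (topspace X) (topspace X) \<and> C_linear_on (topspace X) \<phi> \<and> continuous_map X X \<phi>"


subsection \<open>The map \<open>tderiv\<close> is the derivation prescribed by its values on generators\<close>

text \<open>
  In particular the fraction quotient rule is independent of the representation
  (\<open>zrat_deriv_Fract\<close>), so the definite description above is well defined.
\<close>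

lemma zpoly_pderiv_superset:
  assumes "finite A" "Poly_Mapping.keys P \<subseteq> A"
  shows "zpoly_pderiv i P = (\<Sum>\<alpha>\<in>A. Poly_Mapping.single (\<alpha> - Poly_Mapping.single i 1)
          (of_nat (Poly_Mapping.lookup \<alpha> i) * Poly_Mapping.lookup P \<alpha>))"
  unfolding zpoly_pderiv_def
  by (rule sum.mono_neutral_left) (use assms in \<open>auto simp: in_keys_iff\<close>)

lemma zpoly_pderiv_add: "zpoly_pderiv i (P + Q) = zpoly_pderiv i P + zpoly_pderiv i Q"
proof -
  let ?A = "Poly_Mapping.keys P \<union> Poly_Mapping.keys Q"
  have "Poly_Mapping.keys (P + Q) \<subseteq> ?A" by (rule keys_add)
  thus ?thesis
    by (simp add: zpoly_pderiv_superset[of ?A] lookup_add distrib_left single_add sum.distrib)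
qed

lemma zpoly_pderiv_single:
  "zpoly_pderiv i (Poly_Mapping.single \<alpha> c) =
     Poly_Mapping.single (\<alpha> - Poly_Mapping.single i 1) (of_nat (Poly_Mapping.lookup \<alpha> i) * c)"
  by (subst zpoly_pderiv_superset[of "{\<alpha>}"]) auto

lemma expo_minus_single:
  assumes "Poly_Mapping.lookup \<alpha> i > 0"
  shows "\<alpha> - Poly_Mapping.single i 1 + \<beta> = \<alpha> + \<beta> - Poly_Mapping.single i (1::nat)"
  by (rule poly_mapping_eqI)
     (use assms in \<open>auto simp: lookup_add lookup_minus lookup_single when_def\<close>)

lemma zpoly_pderiv_mult_single:
  "zpoly_pderiv i (Poly_Mapping.single \<alpha> c * Poly_Mapping.single \<beta> d) =
   zpoly_pderiv i (Poly_Mapping.single \<alpha> c) * Poly_Mapping.single \<beta> d +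
   Poly_Mapping.single \<alpha> c * zpoly_pderiv i (Poly_Mapping.single \<beta> d)"
proof -
  have 1: "Poly_Mapping.single (\<alpha> - Poly_Mapping.single i 1 + \<beta>)
      (of_nat (Poly_Mapping.lookup \<alpha> i) * c * d) =
     Poly_Mapping.single (\<alpha> + \<beta> - Poly_Mapping.single i 1)
      (of_nat (Poly_Mapping.lookup \<alpha> i) * c * d)"
    using expo_minus_single[of \<alpha> i \<beta>]
    by (cases "Poly_Mapping.lookup \<alpha> i = 0") (simp_all)
  have 2: "Poly_Mapping.single (\<alpha> + (\<beta> - Poly_Mapping.single i 1))
      (c * (of_nat (Poly_Mapping.lookup \<beta> i) * d)) =
     Poly_Mapping.single (\<alpha> + \<beta> - Poly_Mapping.single i 1)
      (c * (of_nat (Poly_Mapping.lookup \<beta> i) * d))"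
    using expo_minus_single[of \<beta> i \<alpha>]
    by (cases "Poly_Mapping.lookup \<beta> i = 0") (simp_all add: add.commute)
  show ?thesis
    unfolding mult_single zpoly_pderiv_single 1 2 single_add[symmetric]
    by (simp add: lookup_add algebra_simps)
qed

lemma zpoly_induct [case_names single add]:
  assumes "\<And>\<alpha> c. R (Poly_Mapping.single \<alpha> c)" "\<And>P Q. R P \<Longrightarrow> R Q \<Longrightarrow> R (P + Q)"
  shows "R (P :: 'k::idom zpoly)"
proof (induction P rule: update_induct)
  case const
  then show ?case using assms(1)[of 0 0] by simp
next
  case (update f a b)
  have "Poly_Mapping.update a b f = f + Poly_Mapping.single a b"
    by (rule poly_mapping_eqI)
       (use update in \<open>auto simp: lookup_update lookup_add lookup_single when_def in_keys_iff\<close>)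
  then show ?case using assms update by simp
qed

lemma zpoly_pderiv_mult:
  "zpoly_pderiv i (P * Q) = zpoly_pderiv i P * Q + P * zpoly_pderiv i Q"
proof (induction P rule: zpoly_induct)
  case (single \<alpha> c)
  show ?case
    by (induction Q rule: zpoly_induct)
       (simp_all add: zpoly_pderiv_mult_single zpoly_pderiv_add algebra_simps)
qed (simp_all add: zpoly_pderiv_add algebra_simps)

lemma zpoly_pderiv_eq_0: "i \<notin> zpoly_vars P \<Longrightarrow> zpoly_pderiv i P = 0"
  unfolding zpoly_pderiv_def zpoly_vars_def by (rule sum.neutral) (auto simp: in_keys_iff)

lemma finite_zpoly_vars [simp]: "finite (zpoly_vars P)"
  by (simp add: zpoly_vars_def)

lemma zpoly_deriv_superset:
  assumes "finite A" "zpoly_vars P \<subseteq> A"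
  shows "zpoly_deriv P = (\<Sum>i\<in>A. Fract (zpoly_pderiv i P) 1 / (\<Prod>j<i. zvar j))"
  unfolding zpoly_deriv_def
  by (rule sum.mono_neutral_left)
     (use assms in \<open>auto simp: zpoly_pderiv_eq_0 Zero_fract_def[symmetric]\<close>)

lemma zpoly_deriv_mult:
  "zpoly_deriv (P * Q) = zpoly_deriv P * Fract Q 1 + Fract P 1 * zpoly_deriv Q"
proof -
  define A where "A = zpoly_vars P \<union> zpoly_vars Q \<union> zpoly_vars (P * Q)"
  have fin: "finite A" by (simp add: A_def)
  have z: "zpoly_deriv R = (\<Sum>i\<in>A. Fract (zpoly_pderiv i R) 1 / (\<Prod>j<i. zvar j))"
    if "R \<in> {P, Q, P * Q}" for R
    by (rule zpoly_deriv_superset) (use that in \<open>auto simp: A_def\<close>)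
  have "Fract (zpoly_pderiv i (P * Q)) 1 =
      Fract (zpoly_pderiv i P) 1 * Fract Q 1 + Fract P 1 * Fract (zpoly_pderiv i Q) 1" for i
    by (simp add: zpoly_pderiv_mult)
  thus ?thesis
    using fin by (simp add: z add_divide_distrib sum.distrib
                  sum_distrib_left sum_distrib_right del: mult_fract)
qed

lemma zpoly_deriv_add: "zpoly_deriv (P + Q) = zpoly_deriv P + zpoly_deriv Q"
proof -
  define A where "A = zpoly_vars P \<union> zpoly_vars Q \<union> zpoly_vars (P + Q)"
  have fin: "finite A" by (simp add: A_def)
  have z: "zpoly_deriv R = (\<Sum>i\<in>A. Fract (zpoly_pderiv i R) 1 / (\<Prod>j<i. zvar j))"
    if "R \<in> {P, Q, P + Q}" for R
    by (rule zpoly_deriv_superset) (use that in \<open>auto simp: A_def\<close>)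
  have "Fract (zpoly_pderiv i (P + Q)) 1 =
      Fract (zpoly_pderiv i P) 1 + Fract (zpoly_pderiv i Q) 1" for i
    by (simp add: zpoly_pderiv_add)
  thus ?thesis
    using fin by (simp add: z add_divide_distrib sum.distrib del: add_fract)
qed

lemma zrat_deriv_Fract:
  assumes "Q \<noteq> 0"
  shows "zrat_deriv (Fract P Q) =
    (zpoly_deriv P * Fract Q 1 - Fract P 1 * zpoly_deriv Q) / (Fract Q 1)\<^sup>2"
proof -
  have *: "(zpoly_deriv P * Fract Q 1 - Fract P 1 * zpoly_deriv Q) / (Fract Q 1)\<^sup>2 =
        (zpoly_deriv P' * Fract Q' 1 - Fract P' 1 * zpoly_deriv Q') / (Fract Q' 1)\<^sup>2"
    if Q': "Q' \<noteq> 0" and eq: "Fract P Q = Fract P' Q'" for P' Q'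
  proof -
    define p q p' q' where d: "p = Fract P 1" "q = Fract Q 1" "p' = Fract P' 1" "q' = Fract Q' 1"
    define a b a' b' where e: "a = zpoly_deriv P" "b = zpoly_deriv Q"
      "a' = zpoly_deriv P'" "b' = zpoly_deriv Q'"
    have "P * Q' = P' * Q" using eq assms Q' by (simp add: eq_fract)
    hence "p * q' = p' * q" "a * q' + p * b' = a' * q + p' * b"
      using zpoly_deriv_mult[of P Q'] zpoly_deriv_mult[of P' Q] by (simp_all add: d e)
    moreover have "q \<noteq> 0" "q' \<noteq> 0" using assms Q' by (auto simp: d Zero_fract_def eq_fract)
    ultimately have "(a * q - p * b) / q\<^sup>2 = (a' * q' - p' * b') / q'\<^sup>2"
    proof -
      assume h: "p * q' = p' * q" "a * q' + p * b' = a' * q + p' * b" "q \<noteq> 0" "q' \<noteq> 0"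
      have "(a * q - p * b) * q'\<^sup>2 - (a' * q' - p' * b') * q\<^sup>2 =
            q * q' * ((a * q' + p * b') - (a' * q + p' * b))
            - (p * q' - p' * q) * (q' * b + q * b')"
        by (simp add: power2_eq_square algebra_simps)
      also have "\<dots> = 0" using h(1,2) by simp
      finally show ?thesis using h(3,4) by (simp add: frac_eq_eq)
    qed
    thus ?thesis by (simp add: d e)
  qed
  show ?thesis
    unfolding zrat_deriv_def
  proof (rule the_equality)
    fix d
    assume "\<exists>P' Q'. Q' \<noteq> 0 \<and> Fract P Q = Fract P' Q' \<and>
      d = (zpoly_deriv P' * Fract Q' 1 - Fract P' 1 * zpoly_deriv Q') / (Fract Q' 1)\<^sup>2"
    then obtain P' Q' where Q': "Q' \<noteq> 0" "Fract P Q = Fract P' Q'"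
      and d: "d = (zpoly_deriv P' * Fract Q' 1 - Fract P' 1 * zpoly_deriv Q') / (Fract Q' 1)\<^sup>2"
      by (elim exE conjE)
    show "d = (zpoly_deriv P * Fract Q 1 - Fract P 1 * zpoly_deriv Q) / (Fract Q 1)\<^sup>2"
      unfolding d by (rule *[OF Q', symmetric])
  qed (rule exI[of _ P], rule exI[of _ Q], intro conjI refl assms)
qed

lemma zpoly_deriv_single_0 [simp]: "zpoly_deriv (Poly_Mapping.single 0 c) = 0"
  by (simp add: zpoly_deriv_def zpoly_vars_def)

lemma zpoly_deriv_1 [simp]: "zpoly_deriv 1 = 0"
  using zpoly_deriv_single_0[of 1] by (simp del: zpoly_deriv_single_0)

lemma zrat_deriv_poly: "zrat_deriv (Fract P 1) = zpoly_deriv P"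
  by (simp add: zrat_deriv_Fract One_fract_def[symmetric])

lemma zrat_deriv_const: "zrat_deriv (zconst c) = 0"
  by (simp add: zconst_def zrat_deriv_poly)

lemma quot_mult:
  fixes q q' :: "'a::field" assumes "q \<noteq> 0" "q' \<noteq> 0"
  shows "((a*p'+p*a')*(q*q') - (p*p')*(b*q'+q*b'))/(q*q')\<^sup>2 =
    (a*q-p*b)/q\<^sup>2 * (p'/q') + p/q * ((a'*q'-p'*b')/q'\<^sup>2)"
  using assms by (simp add: divide_simps power2_eq_square) (simp add: algebra_simps)

lemma quot_add:
  fixes q q' :: "'a::field" assumes "q \<noteq> 0" "q' \<noteq> 0"
  shows "((a*q'+p*b' + (a'*q+p'*b))*(q*q') - (p*q'+p'*q)*(b*q'+q*b'))/(q*q')\<^sup>2 =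
    (a*q-p*b)/q\<^sup>2 + ((a'*q'-p'*b')/q'\<^sup>2)"
  using assms by (simp add: divide_simps power2_eq_square) (simp add: algebra_simps)

lemma zrat_deriv_mult: "zrat_deriv (f * g) = zrat_deriv f * g + f * zrat_deriv g"
proof (cases f, cases g)
  fix P Q P' Q' assume h: "f = Fract P Q" "Q \<noteq> 0" "g = Fract P' Q'" "Q' \<noteq> 0"
  define p q p' q' where d: "p = Fract P 1" "q = Fract Q 1" "p' = Fract P' 1" "q' = Fract Q' 1"
  have n: "q \<noteq> 0" "q' \<noteq> 0" using h by (auto simp: d Zero_fract_def eq_fract)
  have e: "Fract (P * P') 1 = p * p'" "Fract (Q * Q') 1 = q * q'" by (simp_all add: d)
  have f: "Fract P Q = p / q" "Fract P' Q' = p' / q'" using h by (simp_all add: d)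
  have "zrat_deriv (f * g) = zrat_deriv (Fract (P * P') (Q * Q'))" by (simp add: h)
  also have "\<dots> = ((zpoly_deriv P*p'+p*zpoly_deriv P')*(q*q') - (p*p')*(zpoly_deriv Q*q'+q*zpoly_deriv Q'))/(q*q')\<^sup>2"
    using h by (subst zrat_deriv_Fract) (simp_all only: zpoly_deriv_mult e d mult_eq_0_iff simp_thms)
  also have "\<dots> = zrat_deriv f * g + f * zrat_deriv g"
  proof -
    have "zrat_deriv f = (zpoly_deriv P*q-p*zpoly_deriv Q)/q\<^sup>2"
      "zrat_deriv g = (zpoly_deriv P'*q'-p'*zpoly_deriv Q')/q'\<^sup>2"
      unfolding h(1,3) zrat_deriv_Fract[OF h(2)] zrat_deriv_Fract[OF h(4)] d by (rule refl)+
    moreover have "f = p / q" "g = p' / q'" using f h(1,3) by simp_all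
    ultimately show ?thesis unfolding quot_mult[OF n] by metis
  qed
  finally show ?thesis .
qed

lemma zrat_deriv_add: "zrat_deriv (f + g) = zrat_deriv f + zrat_deriv g"
proof (cases f, cases g)
  fix P Q P' Q' assume h: "f = Fract P Q" "Q \<noteq> 0" "g = Fract P' Q'" "Q' \<noteq> 0"
  define p q p' q' where d: "p = Fract P 1" "q = Fract Q 1" "p' = Fract P' 1" "q' = Fract Q' 1"
  have n: "q \<noteq> 0" "q' \<noteq> 0" using h by (auto simp: d Zero_fract_def eq_fract)
  have e: "Fract (P * Q' + P' * Q) 1 = p * q' + p' * q" "Fract (Q * Q') 1 = q * q'" by (simp_all add: d)
  have "zrat_deriv (f + g) = zrat_deriv (Fract (P * Q' + P' * Q) (Q * Q'))" using h by simp
  also have "\<dots> = ((zpoly_deriv P*q'+p*zpoly_deriv Q' + (zpoly_deriv P'*q+p'*zpoly_deriv Q))*(q*q') - (p*q'+p'*q)*(zpoly_deriv Q*q'+q*zpoly_deriv Q'))/(q*q')\<^sup>2"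
    using h by (subst zrat_deriv_Fract) (simp_all only: zpoly_deriv_mult zpoly_deriv_add e d mult_eq_0_iff simp_thms)
  also have "\<dots> = zrat_deriv f + zrat_deriv g"
    unfolding quot_add[OF n] h(1,3) zrat_deriv_Fract[OF h(2)] zrat_deriv_Fract[OF h(4)] d[symmetric] ..
  finally show ?thesis .
qed

lemma zrat_deriv_var: "zrat_deriv (zvar i) = 1 / (\<Prod>j<i. zvar j)"
proof -
  have "zpoly_vars (Poly_Mapping.single (Poly_Mapping.single i 1) (1::'a)) = {i}"
    by (simp add: zpoly_vars_def)
  thus ?thesis
    by (simp add: zvar_def zmonom_def zrat_deriv_poly zpoly_deriv_def zpoly_pderiv_single
                  One_fract_def)
qed

lemma zrat_deriv_0 [simp]: "zrat_deriv 0 = 0"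
  using zrat_deriv_const[of 0] by (simp add: zconst_def Zero_fract_def)

lemma fls_map_nth: "h 0 = 0 \<Longrightarrow> fls_map h f $$ n = h (f $$ n)"
  unfolding fls_map_def
  by (rule nth_Abs_fls_ex_lower_bound) (metis fls_nth_vanishes_belowE)

lemma fls_times_nth_bounds:
  fixes f g :: "'a::comm_ring_1 fls"
  assumes "\<And>i. i < d \<Longrightarrow> f $$ i = 0" "\<And>i. i < e \<Longrightarrow> g $$ i = 0"
  shows "(f * g) $$ n = (\<Sum>i=d..n - e. f $$ i * g $$ (n - i))"
proof -
  let ?U = "{min d (fls_subdegree f)..max (n - e) (n - fls_subdegree g)}"
  have "(f * g) $$ n = (\<Sum>i=fls_subdegree f..n - fls_subdegree g. f $$ i * g $$ (n - i))"
    by (rule fls_times_nth(2))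
  also have "\<dots> = (\<Sum>i\<in>?U. f $$ i * g $$ (n - i))"
    by (rule sum.mono_neutral_left) auto
  also have "\<dots> = (\<Sum>i=d..n - e. f $$ i * g $$ (n - i))"
    by (rule sum.mono_neutral_right) (use assms in auto)
  finally show ?thesis .
qed

lemma zrat_deriv_sum: "zrat_deriv (sum f A) = (\<Sum>i\<in>A. zrat_deriv (f i))"
  by (induction A rule: infinite_finite_induct) (simp_all add: zrat_deriv_add)

lemma fls_map_zrat_deriv_mult:
  "fls_map zrat_deriv (f * g) = fls_map zrat_deriv f * g + f * fls_map zrat_deriv g"
proof (rule fls_eqI)
  fix n
  show "fls_map zrat_deriv (f * g) $$ n = (fls_map zrat_deriv f * g + f * fls_map zrat_deriv g) $$ n"
    by (simp add: fls_map_nth fls_times_nth_bounds[of "fls_subdegree f" _ "fls_subdegree g"]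
                  zrat_deriv_sum zrat_deriv_mult sum.distrib)
qed

lemma fls_map_zrat_deriv_add:
  "fls_map zrat_deriv (f + g) = fls_map zrat_deriv f + fls_map zrat_deriv g"
  by (rule fls_eqI) (simp add: fls_map_nth zrat_deriv_add)

lemma fls_map_0 [simp]: "h 0 = 0 \<Longrightarrow> fls_map h 0 = 0"
  by (rule fls_eqI) (simp add: fls_map_nth)

lemma zconst_add: "zconst (a + b) = zconst a + zconst b"
  by (simp add: zconst_def single_add)

lemma tderiv_lookup:
  "Poly_Mapping.lookup (tderiv f) \<sigma> =
     (let g = Poly_Mapping.lookup f \<sigma> in
       fls_deriv g + fls_X_inv * (fls_map zrat_deriv g + fls_const (zconst \<sigma>) * g))"
  by (simp add: tderiv_def lookup_mapp when_def in_keys_iff Let_def)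

lemma tderiv_add: "tderiv (f + g) = tderiv f + tderiv g"
  by (rule poly_mapping_eqI)
     (simp add: tderiv_lookup lookup_add Let_def fls_map_zrat_deriv_add distrib_left)

lemma tderiv_single:
  "tderiv (Poly_Mapping.single \<sigma> g) = Poly_Mapping.single \<sigma>
     (fls_deriv g + fls_X_inv * (fls_map zrat_deriv g + fls_const (zconst \<sigma>) * g))"
  by (rule poly_mapping_eqI) (auto simp: tderiv_lookup lookup_single when_def)

lemma tderiv_mult_single:
  "tderiv (Poly_Mapping.single \<sigma> f * Poly_Mapping.single \<tau> g) =
   tderiv (Poly_Mapping.single \<sigma> f) * Poly_Mapping.single \<tau> g +
   Poly_Mapping.single \<sigma> f * tderiv (Poly_Mapping.single \<tau> g)"
proof -
  define a b where "a = fls_const (zconst \<sigma>)" "b = fls_const (zconst \<tau>)"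
  have "fls_const (zconst (\<sigma> + \<tau>)) = a + b" by (simp add: a_b_def zconst_add fls_plus_const)
  thus ?thesis
    unfolding mult_single tderiv_single single_add[symmetric] fls_map_zrat_deriv_mult
      fls_deriv_mult a_b_def[symmetric]
    by (simp add: algebra_simps)
qed

lemma tring_induct [case_names single add]:
  assumes "\<And>\<alpha> c. R (Poly_Mapping.single \<alpha> c)" "\<And>P Q. R P \<Longrightarrow> R Q \<Longrightarrow> R (P + Q)"
  shows "R (P :: 'k::field tring)"
proof (induction P rule: update_induct)
  case const
  then show ?case using assms(1)[of 0 0] by simp
next
  case (update f a b)
  have "Poly_Mapping.update a b f = f + Poly_Mapping.single a b"
    by (rule poly_mapping_eqI)
       (use update in \<open>auto simp: lookup_update lookup_add lookup_single when_def in_keys_iff\<close>)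
  then show ?case using assms update by simp
qed

lemma tderiv_mult: "tderiv (f * g) = tderiv f * g + f * tderiv g"
proof (induction f rule: tring_induct)
  case (single \<sigma> c)
  show ?case
    by (induction g rule: tring_induct)
       (simp_all add: tderiv_mult_single tderiv_add distrib_left distrib_right add_ac)
qed (simp_all add: tderiv_add algebra_simps)

lemma fls_map_const: "h 0 = 0 \<Longrightarrow> fls_map h (fls_const c) = fls_const (h c)"
  by (rule fls_eqI) (simp add: fls_map_nth)

lemma zconst_0: "zconst 0 = 0" by (simp add: zconst_def Zero_fract_def)

lemma tderiv_tconst: "tderiv (tconst c) = 0"
  by (simp add: tconst_def tderiv_single fls_map_const zrat_deriv_const zconst_0)
lemma zrat_deriv_1: "zrat_deriv 1 = 0" using zrat_deriv_const[of 1] by (simp add: zconst_def One_fract_def)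

lemma tderiv_X: "tderiv (tX :: 'k::field tring) = 1"
proof -
  have "fls_map zrat_deriv (fls_X :: 'k zrat fls) = 0"
    by (rule fls_eqI) (simp add: fls_map_nth zrat_deriv_1)
  thus ?thesis by (simp add: tX_def tderiv_single zconst_0)
qed

lemma tderiv_t: "tderiv (Poly_Mapping.single \<sigma> 1 :: 'k::field tring) =
   tconst \<sigma> * Poly_Mapping.single \<sigma> 1 * Poly_Mapping.single 0 fls_X_inv"
proof -
  have "fls_map zrat_deriv (1 :: 'k zrat fls) = 0"
    by (rule fls_eqI) (simp add: fls_map_nth zrat_deriv_1)
  thus ?thesis by (simp add: tconst_def tderiv_single mult_single mult.commute)
qed

lemma tderiv_z: "tderiv (Poly_Mapping.single 0 (fls_const (zvar i)) :: 'k::field tring) =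
   Poly_Mapping.single 0 (inverse (fls_X * (\<Prod>j<i. fls_const (zvar j))))"
proof -
  have "(\<Prod>j<i. fls_const (zvar j :: 'k zrat)) = fls_const (\<Prod>j<i. zvar j)"
    by (induction i) (simp_all add: fls_const_mult_const)
  thus ?thesis
    by (simp add: tderiv_single fls_map_const zrat_deriv_var zconst_0 fls_inverse_const
        fls_inverse_X inverse_eq_divide[symmetric])
qed

unbundle no fps_syntax

end

theory Submission
  imports Defs
begin

text \<open>
  On the coefficient of \<open>t\<^sup>\<rho> x\<^sup>k\<close> the operator \<open>L\<^sub>0\<close> acts as \<open>\<chi>(\<rho> + k + \<delta>)\<close> with \<open>\<delta> = x \<partial>\<close>, which is
  \<open>\<delta>\<^sup>m\<close>, \<open>m = m\<^bsub>\<rho>+k\<^esub>\<close>, times an operator that is a nonzero scalar plus a multiple of \<open>\<delta>\<close>.  On monomials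
  \<open>z\<^sup>\<alpha>\<close> with \<open>p \<alpha>\<^sub>j\<^sub>+\<^sub>1 \<le> \<alpha>\<^sub>j\<close> the derivation \<open>\<delta>\<close> is triangular with respect to \<open>e\<close>: it lowers \<open>\<alpha>\<^sub>1\<close> by
  one and \<open>e(\<alpha>)\<close> by at least one, and the part lowering \<open>e\<close> by exactly one is the decrement of the
  number with base \<open>p\<close> digits \<open>\<alpha>\<^sub>i mod p\<close>, a bijection from the exponents of positive weight.  Hence
  \<open>\<chi>(\<rho> + k + \<delta>)\<close> maps the span of the monomials of weight at least \<open>m\<close> bijectively onto the target.

  Since \<open>e\<close> only sees exponents modulo \<open>p\<close>, the injectivity persists on the \<open>k(z\<^sup>p)\<close>-span of these
  monomials, and this span is stable under constants; that makes \<open>S\<close> linear over the constants.  Finally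
  \<open>S \<circ> T\<close> raises the order in \<open>x\<close>, so the geometric series converges and inverts \<open>1 - S \<circ> T\<close>.
\<close>

unbundle fps_syntax

subsection \<open>Exponents and their weight\<close>

text \<open>The bound on \<alpha>_1 in A_k is made for the factor \<delta>^m: each \<delta> lowers
  \<alpha>_1 by one, so m = m_{\<rho>+k} applications take the bound n_\<rho>(k) to n_\<rho>(k-1),
  the bound at x^k in F x. The cone condition p \<alpha>_{j+1} \<le> \<alpha>_j keeps \<delta>
  within polynomials: a term of \<delta> z^\<alpha> whose coefficient survives in characteristic p
  is divisible by the variables in its denominator, and its exponent satisfies the condition again.

  Linearity over the constants is not formal. For a constant c the product c (S f) need not visibly
  lie in H, since c may have denominators in z and a pole in x; so injectivity on H alone cannot
  compare it with S (c f). What helps is that f and c f lie in the same summand t^\<rho>: if f is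
  nonzero, only the t^0 component of c is left, an element of k(z^p)((x^p)). Its exponents in x are
  multiples of p and thus leave every m_{\<rho>+n} unchanged. The same obstacle returns for v, where
  c (v f) is not known to lie in F.\<close>

abbreviation lookup where "lookup \<equiv> Poly_Mapping.lookup"
abbreviation keys where "keys \<equiv> Poly_Mapping.keys"
abbreviation single where "single \<equiv> Poly_Mapping.single"

text \<open>The exponent of the product of the first i variables. Counting from 0, the i-th term of
  \<delta> z^\<alpha> is \<alpha>_i z^\<gamma> with \<gamma> = \<alpha> -
  \<open>ones (Suc i)\<close>: one factor z_i is lost to differentiation, the variables before it to
  the denominator of \<delta> z_i.\<close>

definition ones :: "nat \<Rightarrow> expo" where
  "ones i = (\<Sum>j<i. single j 1)"

definition steep :: "nat \<Rightarrow> expo set" where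
  "steep p = {\<alpha>. \<forall>j. p * lookup \<alpha> (Suc j) \<le> lookup \<alpha> j}"

text \<open>The derivation \<open>\<delta>\<close> lowers the weight \<open>expo_weight\<close> by exactly one only in the term that it
  sends from \<open>expo_inc p \<beta>\<close> to \<open>\<beta>\<close>: adding one with carry to the digits \<open>\<beta>\<^sub>i mod p\<close>.\<close>

definition expo_inc :: "nat \<Rightarrow> expo \<Rightarrow> expo" where
  "expo_inc p \<beta> = \<beta> + ones (Suc (LEAST i. lookup \<beta> i mod p \<noteq> p - 1))"

lemma lookup_ones [simp]: "lookup (ones i) j = (if j < i then 1 else 0)"
  by (simp add: ones_def lookup_sum lookup_single when_def)

lemma ones_inject [simp]: "ones i = ones j \<longleftrightarrow> i = j"
proof
  assume "ones i = ones j"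
  hence "lookup (ones i) k = lookup (ones j) k" for k by simp
  from this[of i] this[of j] show "i = j" by (auto split: if_splits)
qed simp

lemma steep_lookup_mono:
  assumes "\<alpha> \<in> steep p" "p > 0" "i \<le> j"
  shows "lookup \<alpha> j \<le> lookup \<alpha> i"
  using assms(3)
proof (induction rule: dec_induct)
  case (step n)
  have "lookup \<alpha> (Suc n) \<le> p * lookup \<alpha> (Suc n)" using assms(2) by simp
  also have "\<dots> \<le> lookup \<alpha> n" using assms(1) by (simp add: steep_def)
  finally show ?case using step by simp
qed simp

text \<open>An entry not divisible by p is positive, and then so are all earlier ones; hence the
  subtraction is not truncated. Moreover p \<alpha>_{i+1} \<le> \<alpha>_i is strict, which leaves
  room for lowering \<alpha>_i while \<alpha>_{i+1} stays.\<close>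

lemma steep_ones:
  assumes "\<alpha> \<in> steep p" "lookup \<alpha> i mod p \<noteq> 0" "p > 0"
  shows "\<alpha> - ones (Suc i) + ones (Suc i) = \<alpha>" "\<alpha> - ones (Suc i) \<in> steep p"
    "lookup (\<alpha> - ones (Suc i)) 0 + 1 = lookup \<alpha> 0"
proof -
  have "lookup \<alpha> i > 0" using assms(2) by (metis mod_0 neq0_conv)
  hence pos: "lookup \<alpha> j > 0" if "j \<le> i" for j
    using steep_lookup_mono[OF assms(1,3) that] by simp
  show eq: "\<alpha> - ones (Suc i) + ones (Suc i) = \<alpha>"
    by (rule poly_mapping_eqI) (use pos in \<open>auto simp: lookup_add lookup_minus Suc_le_eq less_Suc_eq_le\<close>)
  show "lookup (\<alpha> - ones (Suc i)) 0 + 1 = lookup \<alpha> 0"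
    using pos[of 0] by (simp add: lookup_minus)
  have st: "p * lookup \<alpha> (Suc j) \<le> lookup \<alpha> j" for j
    using assms(1) by (simp add: steep_def)
  have "p * lookup (\<alpha> - ones (Suc i)) (Suc j) \<le> lookup (\<alpha> - ones (Suc i)) j" for j
  proof -
    consider "j < i" | "j = i" | "j > i" by linarith
    thus ?thesis
    proof cases
      case 1
      thus ?thesis using st[of j] pos[of "Suc j"] pos[of j] assms(3)
        by (simp add: lookup_minus diff_mult_distrib2)
    next
      case 2
      have "p * lookup \<alpha> (Suc i) \<noteq> lookup \<alpha> i" using assms(2) by (metis mod_mult_self1_is_0)
      thus ?thesis using 2 st[of i] by (simp add: lookup_minus)
    qed (use st[of j] in \<open>simp add: lookup_minus\<close>)
  qed
  thus "\<alpha> - ones (Suc i) \<in> steep p" by (simp add: steep_def)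
qed

lemma expo_weight_superset:
  assumes "keys \<alpha> \<subseteq> {..<N}"
  shows "expo_weight p \<alpha> = (\<Sum>i<N. p ^ i * (lookup \<alpha> i mod p))"
  unfolding expo_weight_def
  by (rule sum.mono_neutral_left) (use assms in \<open>auto simp: in_keys_iff\<close>)

text \<open>Position i takes its increment without overflow and gains p^i, the positions below it
  may overflow, and beyond i nothing changes. The lower digit sums stand on opposite sides to avoid
  subtraction of naturals.\<close>

lemma expo_weight_add_ones:
  assumes p: "p > 1" and i: "lookup \<beta> i mod p \<noteq> p - 1"
  shows "expo_weight p (\<beta> + ones (Suc i)) + (\<Sum>j<i. p ^ j * (lookup \<beta> j mod p)) =
    expo_weight p \<beta> + p ^ i + (\<Sum>j<i. p ^ j * (Suc (lookup \<beta> j) mod p))"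
proof -
  define N where "N = Suc (max i (Max (insert 0 (keys \<beta>))))"
  have iN: "i < N" by (simp add: N_def)
  have le: "j < N" if "j \<in> keys \<beta>" for j
    using that by (auto simp: N_def less_Suc_eq_le intro!: max.coboundedI2)
  have k1: "keys \<beta> \<subseteq> {..<N}" using le by auto
  have "keys (ones (Suc i)) \<subseteq> {..<N}" using iN by (auto simp: in_keys_iff split: if_splits)
  hence k2: "keys (\<beta> + ones (Suc i)) \<subseteq> {..<N}"
    using keys_add[of \<beta> "ones (Suc i)"] k1 by blast
  have split: "sum f {..<N} = sum f {..<i} + f i + sum f {i<..<N}" for f :: "nat \<Rightarrow> nat"
  proof -
    have "{..<N} = insert i ({..<i} \<union> {i<..<N})" using iN by auto
    moreover have "sum f ({..<i} \<union> {i<..<N}) = sum f {..<i} + sum f {i<..<N}"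
      by (rule sum.union_disjoint) auto
    ultimately show ?thesis by simp
  qed
  have "Suc (lookup \<beta> i) mod p = Suc (lookup \<beta> i mod p)"
    using i p by (simp add: mod_Suc)
  thus ?thesis
    unfolding expo_weight_superset[OF k1] expo_weight_superset[OF k2] split
    by (simp add: lookup_add)
qed

lemma digit_sum_less:
  assumes "p > (0::nat)"
  shows "(\<Sum>j<i. p ^ j * (a j mod p)) < p ^ i"
proof (induction i)
  case (Suc i)
  have "Suc (a i mod p) \<le> p" using assms by (simp add: Suc_le_eq)
  hence "p ^ i * Suc (a i mod p) \<le> p ^ i * p" by (rule mult_le_mono2)
  thus ?case using Suc by (simp add: mult.commute)
qed simp

lemma digit_sum_max: "p > (0::nat) \<Longrightarrow> (\<Sum>j<i. p ^ j * (p - 1)) + 1 = p ^ i"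
  by (cases p; induction i) (simp_all add: algebra_simps)

lemma Suc_mod_eq_0: "p > 1 \<Longrightarrow> Suc n mod p = 0 \<longleftrightarrow> n mod p = p - 1"
  by (simp add: mod_Suc) linarith

lemma expo_incI:
  assumes "lookup \<beta> i mod p \<noteq> p - 1" "\<And>j. j < i \<Longrightarrow> lookup \<beta> j mod p = p - 1"
  shows "expo_inc p \<beta> = \<beta> + ones (Suc i)"
proof -
  have "(LEAST i. lookup \<beta> i mod p \<noteq> p - 1) = i"
    by (rule Least_equality) (use assms in \<open>auto simp: not_less[symmetric]\<close>)
  thus ?thesis by (simp add: expo_inc_def)
qed

lemma expo_inc_cases:
  assumes "p > 1"
  obtains i where "lookup \<beta> i mod p \<noteq> p - 1" "\<And>j. j < i \<Longrightarrow> lookup \<beta> j mod p = p - 1"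
    "expo_inc p \<beta> = \<beta> + ones (Suc i)"
proof -
  obtain N where N: "N \<notin> keys \<beta>" using ex_new_if_finite[OF _ finite_keys] by blast
  hence "lookup \<beta> N mod p \<noteq> p - 1" using assms by (simp add: in_keys_iff)
  from LeastI[of "\<lambda>i. lookup \<beta> i mod p \<noteq> p - 1", OF this]
    not_less_Least[of _ "\<lambda>i. lookup \<beta> i mod p \<noteq> p - 1"] that
  show ?thesis unfolding expo_inc_def by blast
qed

text \<open>With i the end of the carry, the digits below i are all p - 1, together worth p^i - 1,
  and become 0, while digit i gains p^i. For the cone the critical positions are j < i: there
  \<beta>_j + 1 is divisible by p, so p \<beta>_{j+1} < \<beta>_j + 1 improves to p (\<beta>_{j+1} +
  1) \<le> \<beta>_j + 1.\<close>

lemma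
  assumes "p > 1"
  shows expo_weight_inc: "expo_weight p (expo_inc p \<beta>) = Suc (expo_weight p \<beta>)"
    and lookup_inc_0: "lookup (expo_inc p \<beta>) 0 = Suc (lookup \<beta> 0)"
    and steep_inc: "\<beta> \<in> steep p \<Longrightarrow> expo_inc p \<beta> \<in> steep p"
proof -
  obtain i where i: "lookup \<beta> i mod p \<noteq> p - 1" "\<And>j. j < i \<Longrightarrow> lookup \<beta> j mod p = p - 1"
    "expo_inc p \<beta> = \<beta> + ones (Suc i)"
    using expo_inc_cases[OF assms] by blast
  have "(\<Sum>j<i. p ^ j * (Suc (lookup \<beta> j) mod p)) = 0" using i(2) assms by (simp add: Suc_mod_eq_0)
  moreover have "(\<Sum>j<i. p ^ j * (lookup \<beta> j mod p)) + 1 = p ^ i"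
    using i(2) digit_sum_max[of p i] assms by simp
  ultimately show "expo_weight p (expo_inc p \<beta>) = Suc (expo_weight p \<beta>)"
    using expo_weight_add_ones[OF assms i(1)] unfolding i(3) by linarith
  show "lookup (expo_inc p \<beta>) 0 = Suc (lookup \<beta> 0)" using i(3) by (simp add: lookup_add)
  assume "\<beta> \<in> steep p"
  hence st: "p * lookup \<beta> (Suc j) \<le> lookup \<beta> j" for j by (simp add: steep_def)
  have "p * lookup (\<beta> + ones (Suc i)) (Suc j) \<le> lookup (\<beta> + ones (Suc i)) j" for j
  proof (cases "j < i")
    case True
    hence "p dvd Suc (lookup \<beta> j)" using i(2) assms by (simp add: Suc_mod_eq_0 dvd_eq_mod_eq_0)
    then obtain c where c: "Suc (lookup \<beta> j) = p * c" by blast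
    hence "p * lookup \<beta> (Suc j) < p * c" using st[of j] by linarith
    hence "lookup \<beta> (Suc j) < c" by simp
    hence "p * Suc (lookup \<beta> (Suc j)) \<le> p * c" by (intro mult_le_mono2) simp
    thus ?thesis using True c by (simp add: lookup_add)
  qed (use st[of j] in \<open>simp add: lookup_add\<close>)
  thus "expo_inc p \<beta> \<in> steep p" using i(3) by (simp add: steep_def)
qed

text \<open>Let \<beta> be the lowered exponent. The loss is p^i plus the lower digit sum of
  \<alpha> minus that of \<beta>, and the latter is below p^i, so the loss exceeds the lower digit
  sum of \<alpha>. A loss of one forces the digits of \<alpha> below i to be 0 and those of \<beta>
  to be p - 1, the carry pattern of \<open>expo_inc\<close>.\<close>

lemma steep_weight_ones:
  assumes "\<alpha> \<in> steep p" "lookup \<alpha> i mod p \<noteq> 0" "p > 1"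
  shows "expo_weight p (\<alpha> - ones (Suc i)) < expo_weight p \<alpha>"
    and "Suc (expo_weight p (\<alpha> - ones (Suc i))) = expo_weight p \<alpha> \<Longrightarrow>
      \<alpha> = expo_inc p (\<alpha> - ones (Suc i))"
proof -
  define \<beta> where "\<beta> = \<alpha> - ones (Suc i)"
  have \<alpha>: "\<alpha> = \<beta> + ones (Suc i)" using steep_ones(1)[OF assms(1,2)] assms(3) by (simp add: \<beta>_def)
  have i: "lookup \<beta> i mod p \<noteq> p - 1"
    using assms(2,3) by (simp add: \<alpha> lookup_add Suc_mod_eq_0)
  define s where "s = (\<Sum>j<i. p ^ j * (Suc (lookup \<beta> j) mod p))"
  have "(\<Sum>j<i. p ^ j * (lookup \<beta> j mod p)) < p ^ i" using assms(3) by (intro digit_sum_less) simp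
  with expo_weight_add_ones[OF assms(3) i, folded \<alpha> s_def]
  have le: "expo_weight p \<beta> + s < expo_weight p \<alpha>" by linarith
  thus "expo_weight p (\<alpha> - ones (Suc i)) < expo_weight p \<alpha>" by (simp add: \<beta>_def)
  assume "Suc (expo_weight p (\<alpha> - ones (Suc i))) = expo_weight p \<alpha>"
  hence "s = 0" using le by (simp add: \<beta>_def)
  hence "lookup \<beta> j mod p = p - 1" if "j < i" for j
    using that assms(3) by (auto simp: s_def Suc_mod_eq_0)
  from expo_incI[OF i this] \<alpha> have "\<alpha> = expo_inc p \<beta>" by (rule trans[OF _ sym, rotated])
  thus "\<alpha> = expo_inc p (\<alpha> - ones (Suc i))" unfolding \<beta>_def .
qed

text \<open>Decrement with borrow at the first nonzero digit, which exists because the weight is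
  positive.\<close>

lemma steep_eq_inc:
  assumes "\<alpha> \<in> steep p" "expo_weight p \<alpha> > 0" "p > 1"
  obtains \<beta> where "\<beta> \<in> steep p" "\<alpha> = expo_inc p \<beta>"
proof -
  have "\<exists>i. lookup \<alpha> i mod p \<noteq> 0"
  proof (rule ccontr)
    assume "\<not> ?thesis"
    hence "expo_weight p \<alpha> = 0" by (simp add: expo_weight_def)
    thus False using assms(2) by simp
  qed
  then obtain i where i: "lookup \<alpha> i mod p \<noteq> 0" "\<And>j. j < i \<Longrightarrow> lookup \<alpha> j mod p = 0"
    using exists_least_iff[of "\<lambda>i. lookup \<alpha> i mod p \<noteq> 0"] by blast
  define \<beta> where "\<beta> = \<alpha> - ones (Suc i)"
  have \<alpha>: "\<alpha> = \<beta> + ones (Suc i)" using steep_ones(1)[OF assms(1) i(1)] assms(3) by (simp add: \<beta>_def)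
  have "lookup \<beta> i mod p \<noteq> p - 1" "\<And>j. j < i \<Longrightarrow> lookup \<beta> j mod p = p - 1"
    using i assms(3) by (simp_all add: \<alpha> lookup_add Suc_mod_eq_0)
  from expo_incI[OF this] \<alpha> have "\<alpha> = expo_inc p \<beta>" by (rule trans[OF _ sym, rotated])
  moreover have "\<beta> \<in> steep p" using steep_ones(2)[OF assms(1) i(1)] assms(3) by (simp add: \<beta>_def)
  ultimately show ?thesis using that by blast
qed

subsection \<open>The derivation on polynomials with steep exponents\<close>

text \<open>The incremented digits are 0 below the end of the carry and nonzero there, so the result
  determines where the carry stopped.\<close>

lemma expo_inc_inject:
  assumes p: "p > 1" and eq: "expo_inc p \<beta> = expo_inc p \<gamma>"
  shows "\<beta> = \<gamma>"
proof -
  obtain i where i: "lookup \<beta> i mod p \<noteq> p - 1" "\<And>j. j < i \<Longrightarrow> lookup \<beta> j mod p = p - 1"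
    "expo_inc p \<beta> = \<beta> + ones (Suc i)"
    using expo_inc_cases[OF p] by blast
  obtain i' where i': "lookup \<gamma> i' mod p \<noteq> p - 1" "\<And>j. j < i' \<Longrightarrow> lookup \<gamma> j mod p = p - 1"
    "expo_inc p \<gamma> = \<gamma> + ones (Suc i')"
    using expo_inc_cases[OF p] by blast
  have l: "lookup \<beta> j + (if j \<le> i then 1 else 0) = lookup \<gamma> j + (if j \<le> i' then 1 else 0)" for j
  proof -
    have "lookup (\<beta> + ones (Suc i)) j = lookup (\<gamma> + ones (Suc i')) j" using eq i(3) i'(3) by simp
    thus ?thesis by (simp add: lookup_add less_Suc_eq_le split: if_splits)
  qed
  have "\<not> i < i'" using l[of i] i(1) i'(2)[of i] p by (auto simp: Suc_mod_eq_0[symmetric])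
  moreover have "\<not> i' < i" using l[of i'] i'(1) i(2)[of i'] p by (auto simp: Suc_mod_eq_0[symmetric])
  ultimately have "i = i'" by simp
  thus ?thesis using eq i(3) i'(3) by simp
qed

lemma
  assumes "p > 1"
  shows expo_weight_inc_pow: "expo_weight p ((expo_inc p ^^ m) \<beta>) = expo_weight p \<beta> + m"
    and lookup_inc_pow_0: "lookup ((expo_inc p ^^ m) \<beta>) 0 = lookup \<beta> 0 + m"
    and steep_inc_pow: "\<beta> \<in> steep p \<Longrightarrow> (expo_inc p ^^ m) \<beta> \<in> steep p"
    and expo_inc_pow_inject: "(expo_inc p ^^ m) \<beta> = (expo_inc p ^^ m) \<gamma> \<longleftrightarrow> \<beta> = \<gamma>"
proof -
  have [simp]: "expo_inc p a = expo_inc p b \<longleftrightarrow> a = b" for a b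
    using expo_inc_inject[OF assms] by blast
  show "expo_weight p ((expo_inc p ^^ m) \<beta>) = expo_weight p \<beta> + m"
    "lookup ((expo_inc p ^^ m) \<beta>) 0 = lookup \<beta> 0 + m"
    "(expo_inc p ^^ m) \<beta> = (expo_inc p ^^ m) \<gamma> \<longleftrightarrow> \<beta> = \<gamma>"
    by (induction m) (use assms in \<open>simp_all add: expo_weight_inc lookup_inc_0\<close>)
  show "(expo_inc p ^^ m) \<beta> \<in> steep p" if "\<beta> \<in> steep p"
    by (induction m) (use assms that in \<open>simp_all add: steep_inc\<close>)
qed

lemma steep_eq_inc_pow:
  assumes "\<alpha> \<in> steep p" "expo_weight p \<alpha> \<ge> m" "p > 1"
  shows "\<exists>\<beta>\<in>steep p. \<alpha> = (expo_inc p ^^ m) \<beta>"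
  using assms(1,2)
proof (induction m arbitrary: \<alpha>)
  case (Suc m)
  obtain \<gamma> where \<gamma>: "\<gamma> \<in> steep p" "\<alpha> = expo_inc p \<gamma>"
    using steep_eq_inc[OF Suc.prems(1) _ assms(3)] Suc.prems(2) by auto
  have "expo_weight p \<gamma> \<ge> m" using Suc.prems(2) \<gamma>(2) assms(3) by (simp add: expo_weight_inc)
  from Suc.IH[OF \<gamma>(1) this] \<gamma>(2) show ?case by auto
qed simp

text \<open>The derivation \<delta>, made total on polynomials by truncated subtraction of
  exponents. It agrees with \<delta> on steep exponents, where a term that suffers truncation has a
  coefficient divisible by p.\<close>

definition zD :: "'k::field zpoly \<Rightarrow> 'k zpoly" where
  "zD P = (\<Sum>\<alpha>\<in>keys P. \<Sum>i\<in>keys \<alpha>. single (\<alpha> - ones (Suc i)) (of_nat (lookup \<alpha> i) * lookup P \<alpha>))"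

lemma zD_superset:
  assumes "finite A" "keys P \<subseteq> A"
  shows "zD P = (\<Sum>\<alpha>\<in>A. \<Sum>i\<in>keys \<alpha>. single (\<alpha> - ones (Suc i)) (of_nat (lookup \<alpha> i) * lookup P \<alpha>))"
  unfolding zD_def
  by (rule sum.mono_neutral_left) (use assms in \<open>auto simp: in_keys_iff\<close>)

lemma zD_add: "zD (P + Q) = zD P + zD Q"
proof -
  have "keys (P + Q) \<subseteq> keys P \<union> keys Q" by (rule keys_add)
  thus ?thesis
    by (simp add: zD_superset[of "keys P \<union> keys Q"] lookup_add distrib_left single_add sum.distrib)
qed

lemma zD_single:
  "zD (single \<alpha> c) = (\<Sum>i\<in>keys \<alpha>. single (\<alpha> - ones (Suc i)) (of_nat (lookup \<alpha> i) * c))"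
  by (subst zD_superset[of "{\<alpha>}"]) auto

lemma zD_0 [simp]: "zD 0 = 0"
  by (simp add: zD_def)

lemma zD_sum: "zD (sum f A) = (\<Sum>i\<in>A. zD (f i))"
  by (induction A rule: infinite_finite_induct) (simp_all add: zD_add)

lemma lookup_scale [simp]: "lookup (single 0 c * P) \<alpha> = (c::'a::idom) * lookup P \<alpha>"
  by (simp add: mult_map_scale_conv_mult[symmetric] map.rep_eq when_def)

lemma keys_scale: "keys (single 0 (c::'a::idom) * P) \<subseteq> keys P"
  by (auto simp: in_keys_iff)

lemma zD_scale: "zD (single 0 c * P) = single 0 c * zD P"
proof (induction P rule: zpoly_induct)
  case (single \<alpha> d)
  show ?case by (simp add: zD_single mult_single sum_distrib_left mult_ac)
qed (simp_all add: zD_add distrib_left)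

lemma zpoly_eq_sum: "P = (\<Sum>\<alpha>\<in>keys P. single \<alpha> (lookup P \<alpha>))"
  by (rule poly_mapping_eqI) (simp add: lookup_sum lookup_single when_def in_keys_iff)

lemma zD_eq_sum: "zD P = (\<Sum>\<alpha>\<in>keys P. single 0 (lookup P \<alpha>) * zD (single \<alpha> 1))"
  by (subst zpoly_eq_sum) (simp add: zD_sum zD_scale[symmetric] mult_single)

lemma of_nat_neq_0_mod_CHAR: "of_nat n \<noteq> (0::'k::field) \<longleftrightarrow> n mod CHAR('k) \<noteq> 0"
  by (simp add: of_nat_eq_0_iff_char_dvd dvd_eq_mod_eq_0)

lemma CHAR_gt_1: "CHAR('k::field) > 0 \<Longrightarrow> CHAR('k) > 1"
  using CHAR_not_1[where 'a='k] by linarith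

lemma zD_single_keys:
  assumes "\<alpha> \<in> steep CHAR('k::field)" "\<beta> \<in> keys (zD (single \<alpha> (c::'k)))"
    and p: "CHAR('k) > 0"
  shows "\<beta> \<in> steep CHAR('k)" "Suc (lookup \<beta> 0) = lookup \<alpha> 0"
    "expo_weight CHAR('k) \<beta> < expo_weight CHAR('k) \<alpha>"
    "Suc (expo_weight CHAR('k) \<beta>) = expo_weight CHAR('k) \<alpha> \<Longrightarrow> \<alpha> = expo_inc CHAR('k) \<beta>"
proof -
  from assms(2) keys_sum obtain i where
    "\<beta> \<in> keys (single (\<alpha> - ones (Suc i)) (of_nat (lookup \<alpha> i) * c))"
    unfolding zD_single by fastforce
  hence i: "\<beta> = \<alpha> - ones (Suc i)" "of_nat (lookup \<alpha> i) \<noteq> (0::'k)"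
    by (auto split: if_splits)
  note i2 = i(2)[unfolded of_nat_neq_0_mod_CHAR]
  show "\<beta> \<in> steep CHAR('k)" "Suc (lookup \<beta> 0) = lookup \<alpha> 0"
    using steep_ones[OF assms(1) i2 p] i(1) by auto
  show "expo_weight CHAR('k) \<beta> < expo_weight CHAR('k) \<alpha>"
    "Suc (expo_weight CHAR('k) \<beta>) = expo_weight CHAR('k) \<alpha> \<Longrightarrow> \<alpha> = expo_inc CHAR('k) \<beta>"
    using steep_weight_ones[OF assms(1) i2 CHAR_gt_1[OF p]] i(1) by auto
qed

text \<open>No cancellation can occur at \<beta>: among the terms with nonzero coefficient only the
  one at the end i of the carry has exponent \<beta>, and its coefficient is the entry at i, which
  is nonzero modulo p.\<close>

lemma zD_single_inc_nonzero:
  assumes "\<beta> \<in> steep CHAR('k::field)" and p: "CHAR('k) > 0"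
  shows "lookup (zD (single (expo_inc CHAR('k) \<beta>) (1::'k))) \<beta> \<noteq> 0"
proof -
  have p1: "CHAR('k) > 1" by (rule CHAR_gt_1[OF p])
  obtain i where i: "lookup \<beta> i mod CHAR('k) \<noteq> CHAR('k) - 1"
    "expo_inc CHAR('k) \<beta> = \<beta> + ones (Suc i)"
    using expo_inc_cases[OF p1] by blast
  define \<alpha> where "\<alpha> = expo_inc CHAR('k) \<beta>"
  have st: "\<alpha> \<in> steep CHAR('k)" using assms p1 by (simp add: \<alpha>_def steep_inc)
  have ai: "lookup \<alpha> i mod CHAR('k) \<noteq> 0"
    using i p1 by (simp add: \<alpha>_def lookup_add Suc_mod_eq_0)
  have "i \<in> keys \<alpha>" using ai by (metis in_keys_iff mod_0)
  have *: "lookup (single (\<alpha> - ones (Suc j)) (of_nat (lookup \<alpha> j) * (1::'k))) \<beta> =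
      (if i = j then of_nat (lookup \<alpha> i) else 0)" for j
  proof (cases "lookup \<alpha> j mod CHAR('k) = 0")
    case True
    hence "of_nat (lookup \<alpha> j) = (0::'k)"
      using of_nat_neq_0_mod_CHAR[where 'k='k, of "lookup \<alpha> j"] by metis
    thus ?thesis by (simp add: lookup_single)
  next
    case False
    have "\<alpha> - ones (Suc j) = \<beta> \<longleftrightarrow> i = j"
    proof
      assume "\<alpha> - ones (Suc j) = \<beta>"
      hence "\<beta> + ones (Suc j) = \<beta> + ones (Suc i)"
        using steep_ones(1)[OF st False p] i(2) unfolding \<alpha>_def by simp
      thus "i = j" by simp
    qed (use i(2) in \<open>simp add: \<alpha>_def\<close>)
    thus ?thesis by (auto simp: lookup_single when_def)
  qed
  have "lookup (zD (single \<alpha> (1::'k))) \<beta> = (\<Sum>j\<in>keys \<alpha>. if i = j then of_nat (lookup \<alpha> i) else 0)"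
    unfolding zD_single lookup_sum by (intro sum.cong refl *)
  also have "\<dots> = of_nat (lookup \<alpha> i)" using \<open>i \<in> keys \<alpha>\<close> by simp
  finally show ?thesis using ai by (simp add: \<alpha>_def of_nat_neq_0_mod_CHAR)
qed

lemma zD_keys:
  assumes "keys P \<subseteq> steep CHAR('k::field)" "\<beta> \<in> keys (zD (P :: 'k zpoly))" "CHAR('k) > 0"
  shows "\<beta> \<in> steep CHAR('k) \<and> (\<exists>\<alpha>\<in>keys P. Suc (lookup \<beta> 0) = lookup \<alpha> 0 \<and>
    expo_weight CHAR('k) \<beta> < expo_weight CHAR('k) \<alpha>)"
proof -
  from assms(2) keys_sum obtain \<alpha> where \<alpha>: "\<alpha> \<in> keys P"
    "\<beta> \<in> keys (single 0 (lookup P \<alpha>) * zD (single \<alpha> 1))"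
    unfolding zD_eq_sum[of P] by fastforce
  with keys_scale have "\<beta> \<in> keys (zD (single \<alpha> (1::'k)))" by blast
  from zD_single_keys[OF _ this assms(3)] \<alpha>(1) assms(1) show ?thesis by blast
qed

lemma zD_pow_keys:
  assumes "keys P \<subseteq> steep CHAR('k::field)" "\<beta> \<in> keys ((zD ^^ m) (P :: 'k zpoly))" "CHAR('k) > 0"
  shows "\<beta> \<in> steep CHAR('k) \<and> (\<exists>\<alpha>\<in>keys P. lookup \<beta> 0 + m = lookup \<alpha> 0 \<and>
    expo_weight CHAR('k) \<beta> + m \<le> expo_weight CHAR('k) \<alpha>)"
  using assms(2)
proof (induction m arbitrary: \<beta>)
  case 0
  thus ?case using assms(1) by auto
next
  case (Suc m)
  have "keys ((zD ^^ m) P) \<subseteq> steep CHAR('k)" using Suc.IH by blast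
  from zD_keys[OF this _ assms(3), of \<beta>] Suc.prems obtain \<gamma> where
    \<gamma>: "\<beta> \<in> steep CHAR('k)" "\<gamma> \<in> keys ((zD ^^ m) P)" "Suc (lookup \<beta> 0) = lookup \<gamma> 0"
    "expo_weight CHAR('k) \<beta> < expo_weight CHAR('k) \<gamma>" by auto
  from Suc.IH[OF \<gamma>(2)] obtain \<alpha> where "\<alpha> \<in> keys P" "lookup \<gamma> 0 + m = lookup \<alpha> 0"
    "expo_weight CHAR('k) \<gamma> + m \<le> expo_weight CHAR('k) \<alpha>" by blast
  thus ?case using \<gamma> by (intro conjI bexI[of _ \<alpha>]) auto
qed

text \<open>No exponent of P exceeds the weight of \<beta> by more than one, so \<beta> can arise
  only from a term that loses exactly one, and such a term has \<open>expo_inc\<close> of \<beta> as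
  its only source.\<close>

lemma zD_lookup:
  fixes P :: "'k::field zpoly"
  assumes P: "keys P \<subseteq> steep CHAR('k)" "\<And>\<alpha>. \<alpha> \<in> keys P \<Longrightarrow> expo_weight CHAR('k) \<alpha> \<le> Suc (expo_weight CHAR('k) \<beta>)"
    and p: "CHAR('k) > 0"
  shows "lookup (zD P) \<beta> =
    lookup (zD (single (expo_inc CHAR('k) \<beta>) 1)) \<beta> * lookup P (expo_inc CHAR('k) \<beta>)"
proof -
  define \<alpha> where "\<alpha> = expo_inc CHAR('k) \<beta>"
  have *: "lookup P \<gamma> * lookup (zD (single \<gamma> 1)) \<beta> =
    (if \<alpha> = \<gamma> then lookup (zD (single \<alpha> 1)) \<beta> * lookup P \<alpha> else 0)" if "\<gamma> \<in> keys P" for \<gamma>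
  proof (cases "\<beta> \<in> keys (zD (single \<gamma> (1::'k)))")
    case True
    have "\<gamma> \<in> steep CHAR('k)" using that P by blast
    from zD_single_keys(3,4)[OF this True p] P(2)[OF that] have "\<gamma> = \<alpha>"
      by (simp add: \<alpha>_def)
    thus ?thesis by simp
  qed (auto simp: in_keys_iff)
  have "lookup (zD P) \<beta> = (\<Sum>\<gamma>\<in>keys P. lookup P \<gamma> * lookup (zD (single \<gamma> 1)) \<beta>)"
    by (subst zD_eq_sum) (simp add: lookup_sum)
  also have "\<dots> = (\<Sum>\<gamma>\<in>keys P. if \<alpha> = \<gamma> then lookup (zD (single \<alpha> 1)) \<beta> * lookup P \<alpha> else 0)"
    by (intro sum.cong refl *)
  also have "\<dots> = lookup (zD (single \<alpha> 1)) \<beta> * lookup P \<alpha>" by (simp add: in_keys_iff)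
  finally show ?thesis by (simp add: \<alpha>_def)
qed

text \<open>The scalar c is chosen before P: on the part of top weight, \<open>zD ^^ m\<close> is
  diagonal with nonzero entries once sources and targets are matched by the m-fold
  increment.\<close>

lemma zD_pow_lookup:
  assumes "\<beta> \<in> steep CHAR('k::field)" and p: "CHAR('k) > 0"
  shows "\<exists>c. c \<noteq> 0 \<and> (\<forall>P::'k zpoly. keys P \<subseteq> steep CHAR('k) \<longrightarrow>
      (\<forall>\<alpha>\<in>keys P. expo_weight CHAR('k) \<alpha> \<le> expo_weight CHAR('k) \<beta> + m) \<longrightarrow>
      lookup ((zD ^^ m) P) \<beta> = c * lookup P ((expo_inc CHAR('k) ^^ m) \<beta>))"
  using assms(1)
proof (induction m arbitrary: \<beta>)
  case 0
  show ?case by (rule exI[of _ 1]) simp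
next
  case (Suc m)
  have p1: "CHAR('k) > 1" by (rule CHAR_gt_1[OF p])
  have st: "expo_inc CHAR('k) \<beta> \<in> steep CHAR('k)" using Suc.prems p1 by (simp add: steep_inc)
  from Suc.IH[OF st] obtain c where c: "c \<noteq> 0"
    "\<And>P :: 'k zpoly. keys P \<subseteq> steep CHAR('k) \<Longrightarrow>
      (\<forall>\<alpha>\<in>keys P. expo_weight CHAR('k) \<alpha> \<le> expo_weight CHAR('k) (expo_inc CHAR('k) \<beta>) + m) \<Longrightarrow>
      lookup ((zD ^^ m) P) (expo_inc CHAR('k) \<beta>) = c * lookup P ((expo_inc CHAR('k) ^^ m) (expo_inc CHAR('k) \<beta>))"
    by blast
  define d where "d = lookup (zD (single (expo_inc CHAR('k) \<beta>) (1::'k))) \<beta>"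
  have "lookup ((zD ^^ Suc m) P) \<beta> = d * c * lookup P ((expo_inc CHAR('k) ^^ Suc m) \<beta>)"
    if P: "keys P \<subseteq> steep CHAR('k)"
      "\<forall>\<alpha>\<in>keys P. expo_weight CHAR('k) \<alpha> \<le> expo_weight CHAR('k) \<beta> + Suc m" for P :: "'k zpoly"
  proof -
    have "lookup (zD ((zD ^^ m) P)) \<beta> = d * lookup ((zD ^^ m) P) (expo_inc CHAR('k) \<beta>)"
      unfolding d_def
    proof (rule zD_lookup[OF _ _ p])
      show "keys ((zD ^^ m) P) \<subseteq> steep CHAR('k)" using zD_pow_keys[OF P(1) _ p] by blast
      fix \<alpha> assume "\<alpha> \<in> keys ((zD ^^ m) P)"
      from zD_pow_keys[OF P(1) this p] P(2)
      show "expo_weight CHAR('k) \<alpha> \<le> Suc (expo_weight CHAR('k) \<beta>)" by fastforce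
    qed
    also have "lookup ((zD ^^ m) P) (expo_inc CHAR('k) \<beta>) =
        c * lookup P ((expo_inc CHAR('k) ^^ m) (expo_inc CHAR('k) \<beta>))"
      by (rule c(2)[OF P(1)]) (use P(2) p1 in \<open>simp add: expo_weight_inc\<close>)
    finally show ?thesis by (simp add: funpow_swap1)
  qed
  moreover have "d * c \<noteq> 0" using c(1) zD_single_inc_nonzero[OF Suc.prems p] by (simp add: d_def)
  ultimately show ?case by blast
qed

section \<open>Polynomials in the derivation, acting on the steep cone\<close>

definition zact :: "'k::field poly \<Rightarrow> 'k zpoly \<Rightarrow> 'k zpoly" where
  "zact q P = (\<Sum>j\<le>degree q. single 0 (coeff q j) * (zD ^^ j) P)"

lemma zD_pow_add: "(zD ^^ j) (P + Q) = (zD ^^ j) P + (zD ^^ j) Q"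
  by (induction j) (simp_all add: zD_add)

lemma zact_add: "zact q (P + Q) = zact q P + zact q Q"
  by (simp add: zact_def zD_pow_add distrib_left sum.distrib)

lemma zD_pow_0 [simp]: "(zD ^^ j) 0 = 0"
  by (induction j) simp_all

lemma zact_0 [simp]: "zact q 0 = 0"
  by (simp add: zact_def)

lemma zact_keys:
  assumes "keys P \<subseteq> steep CHAR('k::field)" "\<beta> \<in> keys (zact q (P :: 'k zpoly))" "CHAR('k) > 0"
    and q: "\<And>i. i < m \<Longrightarrow> coeff q i = 0"
  shows "\<beta> \<in> steep CHAR('k) \<and> (\<exists>\<alpha>\<in>keys P. lookup \<beta> 0 + m \<le> lookup \<alpha> 0 \<and>
    expo_weight CHAR('k) \<beta> + m \<le> expo_weight CHAR('k) \<alpha>)"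
proof -
  from assms(2) keys_sum obtain j where j: "\<beta> \<in> keys (single 0 (coeff q j) * (zD ^^ j) P)"
    unfolding zact_def by fastforce
  hence "j \<ge> m" using q[of j] by (cases "j < m") auto
  from j keys_scale have "\<beta> \<in> keys ((zD ^^ j) P)" by blast
  from zD_pow_keys[OF assms(1) this assms(3)] obtain \<alpha> where "\<beta> \<in> steep CHAR('k)" "\<alpha> \<in> keys P"
    "lookup \<beta> 0 + j = lookup \<alpha> 0" "expo_weight CHAR('k) \<beta> + j \<le> expo_weight CHAR('k) \<alpha>"
    by blast
  with \<open>j \<ge> m\<close> show ?thesis by (intro conjI bexI[of _ \<alpha>]) auto
qed

text \<open>Powers below m have coefficient 0, and powers above m lose too much weight to reach
  \<beta>; what remains is \<open>coeff q m\<close> times the scalar belonging to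
  \<open>zD ^^ m\<close>.\<close>

lemma zact_lookup:
  assumes "\<beta> \<in> steep CHAR('k::field)" and p: "CHAR('k) > 0"
    and q: "\<And>i. i < m \<Longrightarrow> coeff q i = 0" "coeff q m \<noteq> 0"
  shows "\<exists>c. c \<noteq> 0 \<and> (\<forall>P::'k zpoly. keys P \<subseteq> steep CHAR('k) \<longrightarrow>
      (\<forall>\<alpha>\<in>keys P. expo_weight CHAR('k) \<alpha> \<le> expo_weight CHAR('k) \<beta> + m) \<longrightarrow>
      lookup (zact q P) \<beta> = c * lookup P ((expo_inc CHAR('k) ^^ m) \<beta>))"
proof -
  from zD_pow_lookup[OF assms(1) p, of m] obtain c where c: "c \<noteq> 0"
    "\<And>P::'k zpoly. keys P \<subseteq> steep CHAR('k) \<Longrightarrow>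
      (\<forall>\<alpha>\<in>keys P. expo_weight CHAR('k) \<alpha> \<le> expo_weight CHAR('k) \<beta> + m) \<Longrightarrow>
      lookup ((zD ^^ m) P) \<beta> = c * lookup P ((expo_inc CHAR('k) ^^ m) \<beta>)" by blast
  have "lookup (zact q P) \<beta> = coeff q m * c * lookup P ((expo_inc CHAR('k) ^^ m) \<beta>)"
    if P: "keys P \<subseteq> steep CHAR('k)"
      "\<forall>\<alpha>\<in>keys P. expo_weight CHAR('k) \<alpha> \<le> expo_weight CHAR('k) \<beta> + m" for P :: "'k zpoly"
  proof -
    have *: "coeff q j * lookup ((zD ^^ j) P) \<beta> = 
        (if m = j then coeff q m * (c * lookup P ((expo_inc CHAR('k) ^^ m) \<beta>)) else 0)" for j
    proof -
      consider "j < m" | "j = m" | "j > m" by linarith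
      thus ?thesis
      proof cases
        case 3
        have "\<beta> \<notin> keys ((zD ^^ j) P)"
        proof
          assume "\<beta> \<in> keys ((zD ^^ j) P)"
          from zD_pow_keys[OF P(1) this p] P(2) 3 show False by fastforce
        qed
        thus ?thesis using 3 by (simp add: in_keys_iff)
      qed (use q c(2)[OF P] in auto)
    qed
    have "m \<le> degree q" using q(2) by (rule le_degree)
    thus ?thesis unfolding zact_def lookup_sum lookup_scale * by simp
  qed
  thus ?thesis using c(1) q(2) by (intro exI[of _ "coeff q m * c"]) auto
qed

text \<open>Take \<alpha> of largest weight in P. That weight is at least m, so \<alpha> is an
  m-fold increment of some \<beta>, and by maximality the coefficient of \<beta> in the image is a
  nonzero multiple of that of \<alpha>.\<close>

lemma zact_inj:
  fixes P :: "'k::field zpoly"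
  assumes P: "keys P \<subseteq> steep CHAR('k)" "\<And>\<alpha>. \<alpha> \<in> keys P \<Longrightarrow> m \<le> expo_weight CHAR('k) \<alpha>"
    and p: "CHAR('k) > 0" and q: "\<And>i. i < m \<Longrightarrow> coeff q i = 0" "coeff q m \<noteq> 0"
    and 0: "zact q P = 0"
  shows "P = 0"
proof (rule ccontr)
  assume "P \<noteq> 0"
  hence "keys P \<noteq> {}" by simp
  then obtain \<alpha> where \<alpha>: "\<alpha> \<in> keys P"
    "\<And>\<gamma>. \<gamma> \<in> keys P \<Longrightarrow> expo_weight CHAR('k) \<gamma> \<le> expo_weight CHAR('k) \<alpha>"
    using Max_in[of "expo_weight CHAR('k) ` keys P"] Max_ge[of "expo_weight CHAR('k) ` keys P"]
    by fastforce
  from steep_eq_inc_pow[OF _ P(2)[OF \<alpha>(1)] CHAR_gt_1[OF p]] P(1) \<alpha>(1)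
  obtain \<beta> where \<beta>: "\<beta> \<in> steep CHAR('k)" "\<alpha> = (expo_inc CHAR('k) ^^ m) \<beta>" by blast
  from zact_lookup[OF \<beta>(1) p q] obtain c where "c \<noteq> 0"
    "lookup (zact q P) \<beta> = c * lookup P \<alpha>"
    using P(1) \<alpha>(2) unfolding \<beta>(2) expo_weight_inc_pow[OF CHAR_gt_1[OF p]] by blast
  with 0 \<alpha>(1) show False by (simp add: in_keys_iff)
qed

text \<open>Induction on a strict bound d for the weights in Q: the part of top weight is hit
  exactly and the error has smaller weight. Each increment raises \<alpha>_1 by one, hence the bound
  n + m.\<close>

lemma zact_surj:
  fixes Q :: "'k::field zpoly"
  assumes Q: "keys Q \<subseteq> steep CHAR('k)" "\<And>\<alpha>. \<alpha> \<in> keys Q \<Longrightarrow> lookup \<alpha> 0 < n"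
    and p: "CHAR('k) > 0" and q: "\<And>i. i < m \<Longrightarrow> coeff q i = 0" "coeff q m \<noteq> 0"
  shows "\<exists>P. keys P \<subseteq> {\<alpha>\<in>steep CHAR('k). lookup \<alpha> 0 < n + m \<and> m \<le> expo_weight CHAR('k) \<alpha>} \<and> zact q P = Q"
proof -
  have p1: "CHAR('k) > 1" by (rule CHAR_gt_1[OF p])
  have "\<exists>P. keys P \<subseteq> {\<alpha>\<in>steep CHAR('k). lookup \<alpha> 0 < n + m \<and> m \<le> expo_weight CHAR('k) \<alpha>} \<and> zact q P = Q"
    if "\<And>\<alpha>. \<alpha> \<in> keys Q \<Longrightarrow> expo_weight CHAR('k) \<alpha> < d" for d
    using that Q
  proof (induction d arbitrary: Q)
    case 0
    hence "keys Q = {}" by blast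
    hence "Q = 0" by simp
    thus ?case by (intro exI[of _ 0]) simp
  next
    case (Suc d)
    let ?inc = "expo_inc CHAR('k) ^^ m"
    have "\<forall>\<beta>\<in>steep CHAR('k). \<exists>c. c \<noteq> 0 \<and> (\<forall>P::'k zpoly. keys P \<subseteq> steep CHAR('k) \<longrightarrow>
      (\<forall>\<alpha>\<in>keys P. expo_weight CHAR('k) \<alpha> \<le> expo_weight CHAR('k) \<beta> + m) \<longrightarrow>
      lookup (zact q P) \<beta> = c * lookup P (?inc \<beta>))"
      using zact_lookup[OF _ p q] by blast
    then obtain c where c: "\<And>\<beta>. \<beta> \<in> steep CHAR('k) \<Longrightarrow> c \<beta> \<noteq> 0"
      "\<And>\<beta> P::'k zpoly. \<beta> \<in> steep CHAR('k) \<Longrightarrow> keys P \<subseteq> steep CHAR('k) \<Longrightarrow>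
      (\<forall>\<alpha>\<in>keys P. expo_weight CHAR('k) \<alpha> \<le> expo_weight CHAR('k) \<beta> + m) \<Longrightarrow>
      lookup (zact q P) \<beta> = c \<beta> * lookup P (?inc \<beta>)"
      by metis
    define A where "A = {\<beta>\<in>keys Q. expo_weight CHAR('k) \<beta> = d}"
    have finA: "finite A" by (simp add: A_def)
    \<comment> \<open>Dividing by the diagonal entries \<open>c \<beta>\<close> makes
      \<open>zact q P1\<close> agree with Q in weight d; all its other exponents have smaller
      weight.\<close>
    define P1 where "P1 = (\<Sum>\<beta>\<in>A. single (?inc \<beta>) (lookup Q \<beta> / c \<beta>))"
    have kP1: "\<exists>\<beta>\<in>A. \<alpha> = ?inc \<beta>" if "\<alpha> \<in> keys P1" for \<alpha>
      using that keys_sum[of "\<lambda>\<beta>. single (?inc \<beta>) (lookup Q \<beta> / c \<beta>)" A]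
      unfolding P1_def by (fastforce split: if_splits)
    have P1: "\<alpha> \<in> steep CHAR('k)" "lookup \<alpha> 0 < n + m" "expo_weight CHAR('k) \<alpha> = d + m"
      if "\<alpha> \<in> keys P1" for \<alpha>
      using kP1[OF that] Suc.prems
      by (auto simp: A_def steep_inc_pow[OF p1] expo_weight_inc_pow[OF p1] lookup_inc_pow_0[OF p1])
    have lP1: "lookup P1 (?inc \<beta>) = (if \<beta> \<in> A then lookup Q \<beta> / c \<beta> else 0)" for \<beta>
      unfolding P1_def using finA
      by (simp add: lookup_sum lookup_single expo_inc_pow_inject[OF p1] when_def)
    define R where "R = Q - zact q P1"
    have kP1': "keys P1 \<subseteq> steep CHAR('k)" using P1(1) by blast
    have kR: "\<beta> \<in> steep CHAR('k) \<and> lookup \<beta> 0 < n \<and> expo_weight CHAR('k) \<beta> \<le> d"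
      if "\<beta> \<in> keys R" for \<beta>
    proof (cases "\<beta> \<in> keys Q")
      case True
      thus ?thesis using Suc.prems by (auto simp: less_Suc_eq_le)
    next
      case False
      with that have "\<beta> \<in> keys (zact q P1)" by (auto simp: R_def in_keys_iff lookup_minus)
      from zact_keys[OF kP1' this p q(1)] P1 show ?thesis by fastforce
    qed
    have lt: "expo_weight CHAR('k) \<beta> < d" if "\<beta> \<in> keys R" for \<beta>
    proof (rule ccontr)
      assume "\<not> ?thesis"
      hence wt: "expo_weight CHAR('k) \<beta> = d" "\<beta> \<in> steep CHAR('k)" using kR[OF that] by auto
      have "lookup (zact q P1) \<beta> = c \<beta> * lookup P1 (?inc \<beta>)"
        by (rule c(2)[OF wt(2) kP1']) (simp add: P1 wt)
      also have "\<dots> = lookup Q \<beta>" using c(1)[OF wt(2)] wt(1) by (simp add: lP1 A_def in_keys_iff)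
      finally show False using that by (simp add: R_def in_keys_iff lookup_minus)
    qed
    have "\<exists>P. keys P \<subseteq> {\<alpha>\<in>steep CHAR('k). lookup \<alpha> 0 < n + m \<and> m \<le> expo_weight CHAR('k) \<alpha>} \<and> zact q P = R"
      by (rule Suc.IH) (use lt kR in auto)
    then obtain P2 where P2: "keys P2 \<subseteq> {\<alpha>\<in>steep CHAR('k). lookup \<alpha> 0 < n + m \<and> m \<le> expo_weight CHAR('k) \<alpha>}"
      "zact q P2 = R" by blast
    have "keys (P1 + P2) \<subseteq> {\<alpha>\<in>steep CHAR('k). lookup \<alpha> 0 < n + m \<and> m \<le> expo_weight CHAR('k) \<alpha>}"
      using keys_add[of P1 P2] P1 P2(1) by fastforce
    moreover have "zact q (P1 + P2) = Q" by (simp add: zact_add P2 R_def)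
    ultimately show ?case by blast
  qed
  from this[of "Suc (Max (expo_weight CHAR('k) ` keys Q))"] show ?thesis
    by (simp add: less_Suc_eq_le)
qed

subsection \<open>Falling factorials of the Euler operator\<close>

lemma zmonom_0 [simp]: "zmonom 0 = 1"
  by (simp add: zmonom_def One_fract_def)

lemma zmonom_add: "zmonom (\<alpha> + \<beta>) = zmonom \<alpha> * zmonom \<beta>"
  by (simp add: zmonom_def mult_single)

lemma prod_zvar: "(\<Prod>j<i. zvar j) = zmonom (ones i)"
  by (induction i) (simp_all add: ones_def zmonom_add zvar_def)

lemma zmonom_nonzero [simp]: "zmonom \<alpha> \<noteq> 0"
  by (simp add: zmonom_def Zero_fract_def eq_fract) (metis lookup_single_eq lookup_zero zero_neq_one)

lemma Fract_add_1: "Fract (a + b) 1 = Fract a 1 + Fract b 1"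
  by simp

lemma Fract_sum: "Fract (sum f A) 1 = (\<Sum>i\<in>A. Fract (f i) 1)"
proof (induction A rule: infinite_finite_induct)
  case (insert x A)
  thus ?case unfolding sum.insert[OF insert(1,2)] Fract_add_1 by simp
qed (simp_all add: Zero_fract_def)

lemma Fract_mult_1: "Fract (a * b) 1 = Fract a 1 * Fract b 1"
  by simp

text \<open>Where the coefficient is nonzero, \<alpha> = \<beta> + \<open>ones i\<close> +
  \<open>single i 1\<close> holds without truncation, so the division by the first i variables is
  exact.\<close>

lemma zpoly_deriv_single_steep:
  assumes "\<alpha> \<in> steep CHAR('k::field)" and p: "CHAR('k) > 0"
  shows "zpoly_deriv (single \<alpha> (c::'k)) = Fract (zD (single \<alpha> c)) 1"
proof -
  have *: "Fract (zpoly_pderiv i (single \<alpha> c)) 1 / (\<Prod>j<i. zvar j) =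
      Fract (single (\<alpha> - ones (Suc i)) (of_nat (lookup \<alpha> i) * c)) 1" for i
  proof (cases "of_nat (lookup \<alpha> i) = (0::'k)")
    case True
    thus ?thesis by (simp add: zpoly_pderiv_single Zero_fract_def[symmetric])
  next
    case False
    define \<beta> where "\<beta> = \<alpha> - ones (Suc i)"
    have "\<beta> + ones (Suc i) = \<alpha>"
      using steep_ones(1)[OF assms(1) _ p] False unfolding of_nat_neq_0_mod_CHAR \<beta>_def by blast
    hence "\<alpha> = (\<beta> + ones i) + single i 1" by (simp add: ones_def add_ac)
    hence "\<alpha> - single i 1 = \<beta> + ones i" by (metis add_diff_cancel_right')
    thus ?thesis
      unfolding prod_zvar zpoly_pderiv_single \<beta>_def[symmetric]
      by (simp add: nonzero_divide_eq_eq) (simp add: zmonom_def mult_single)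
  qed
  have "zpoly_deriv (single \<alpha> c) =
      (\<Sum>i\<in>keys \<alpha>. Fract (zpoly_pderiv i (single \<alpha> c)) 1 / (\<Prod>j<i. zvar j))"
    by (rule zpoly_deriv_superset) (auto simp: zpoly_vars_def)
  thus ?thesis unfolding * zD_single Fract_sum .
qed

lemma zpoly_deriv_0 [simp]: "zpoly_deriv 0 = 0"
  by (simp add: zpoly_deriv_def zpoly_vars_def)

lemma zpoly_deriv_sum: "zpoly_deriv (sum f A) = (\<Sum>i\<in>A. zpoly_deriv (f i))"
  by (induction A rule: infinite_finite_induct) (simp_all add: zpoly_deriv_add)

lemma zrat_deriv_steep:
  assumes "keys P \<subseteq> steep CHAR('k::field)" and p: "CHAR('k) > 0"
  shows "zrat_deriv (Fract (P::'k zpoly) 1) = Fract (zD P) 1"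
proof -
  have "zpoly_deriv P = (\<Sum>\<alpha>\<in>keys P. zpoly_deriv (single \<alpha> (lookup P \<alpha>)))"
    by (subst zpoly_eq_sum) (rule zpoly_deriv_sum)
  also have "\<dots> = (\<Sum>\<alpha>\<in>keys P. Fract (zD (single \<alpha> (lookup P \<alpha>))) 1)"
    by (intro sum.cong refl zpoly_deriv_single_steep p) (use assms(1) in blast)
  also have "\<dots> = Fract (zD P) 1"
    unfolding Fract_sum[symmetric] zD_sum[symmetric] by (subst (2) zpoly_eq_sum) (rule refl)
  finally show ?thesis by (simp add: zrat_deriv_poly)
qed

lemma zconst_1 [simp]: "zconst 1 = 1"
  by (simp add: zconst_def One_fract_def)

lemma zconst_uminus: "zconst (- a) = - zconst a"
  using zconst_add[of a "- a"] by (simp add: zconst_0 add_eq_0_iff)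

lemma zconst_diff: "zconst (a - b) = zconst a - zconst b"
  using zconst_add[of a "- b"] by (simp add: zconst_uminus)

lemma zconst_of_nat [simp]: "zconst (of_nat n) = of_nat n"
  by (induction n) (simp_all add: zconst_add zconst_0)

lemma zconst_of_int [simp]: "zconst (of_int n) = of_int n"
  by (cases n) (simp_all add: zconst_uminus zconst_add zconst_diff)

lemma lookup_tX_times [simp]: "lookup (tX * f) \<sigma> $$ n = lookup f \<sigma> $$ (n - 1)"
  by (simp add: tX_def fls_X_times_conv_shift)

lemma lookup_tX_power_times [simp]: "lookup (tX ^ j * f) \<sigma> $$ n = lookup f \<sigma> $$ (n - int j)"
  by (induction j arbitrary: n) (simp_all add: mult.assoc algebra_simps)

lemma lookup_tconst_times [simp]: "lookup (tconst a * f) \<sigma> $$ n = zconst a * lookup f \<sigma> $$ n"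
  by (simp add: tconst_def)

lemma lookup_euler:
  "lookup (tX * tderiv f) \<sigma> $$ n =
     zconst (\<sigma> + of_int n) * lookup f \<sigma> $$ n + zrat_deriv (lookup f \<sigma> $$ n)"
  by (simp add: tderiv_lookup Let_def fls_X_inv_times_conv_shift fls_map_nth)
    (simp add: zconst_add algebra_simps)

lemma tX_tderiv_power: "tX * tderiv (tX ^ j) = of_nat j * (tX :: 'k::field tring) ^ j"
proof (induction j)
  case (Suc j)
  have "tX * tderiv (tX ^ Suc j) = (tX :: 'k tring) * tX ^ j + tX * (tX * tderiv (tX ^ j))"
    by (simp add: tderiv_mult tderiv_X algebra_simps)
  also have "\<dots> = of_nat (Suc j) * tX ^ Suc j"
    unfolding Suc by (simp add: algebra_simps)
  finally show ?case .
qed (use tderiv_tconst[of "1::'k"] in \<open>simp add: tconst_def\<close>)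

text \<open>The \<open>j\<close>-th falling factorial of \<open>c + \<delta>\<close>, i.e. the action of \<open>x\<^sup>j \<partial>\<^sup>j\<close> on the
  coefficient of \<open>t\<^sup>\<sigma> x\<^sup>n\<close> where \<open>c = \<sigma> + n\<close>.\<close>

primrec zfall :: "nat \<Rightarrow> 'k::field \<Rightarrow> 'k zrat \<Rightarrow> 'k zrat" where
  "zfall 0 c q = q"
| "zfall (Suc j) c q = zconst (c - of_nat j) * zfall j c q + zrat_deriv (zfall j c q)"

text \<open>Rests on x^{j+1} \<partial>^{j+1} = (x \<partial> - j) x^j \<partial>^j, which follows
  from the product rule and x \<partial>(x^j) = j x^j.\<close>

lemma lookup_zfall:
  "lookup (tX ^ j * (tderiv ^^ j) f) \<sigma> $$ n = zfall j (\<sigma> + of_int n) (lookup f \<sigma> $$ n)"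
proof (induction j)
  case (Suc j)
  define g where "g = (tderiv ^^ j) f"
  have "tX * tderiv (tX ^ j * g) = tX * tderiv (tX ^ j) * g + tX ^ Suc j * tderiv g"
    by (simp add: tderiv_mult algebra_simps)
  hence "tX ^ Suc j * tderiv g = tX * tderiv (tX ^ j * g) - of_nat j * (tX ^ j * g)"
    unfolding tX_tderiv_power by (simp add: algebra_simps)
  also have "of_nat j = (tconst (of_nat j) :: 'a tring)"
    by (simp add: tconst_def single_of_nat[symmetric] fls_of_nat)
  finally have "tX ^ Suc j * (tderiv ^^ Suc j) f =
      tX * tderiv (tX ^ j * g) - tconst (of_nat j) * (tX ^ j * g)" by (simp add: g_def)
  hence "lookup (tX ^ Suc j * (tderiv ^^ Suc j) f) \<sigma> $$ n =
      zconst (\<sigma> + of_int n) * lookup (tX ^ j * g) \<sigma> $$ n + zrat_deriv (lookup (tX ^ j * g) \<sigma> $$ n)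
      - of_nat j * lookup (tX ^ j * g) \<sigma> $$ n"
    by (simp only: lookup_minus fls_minus_nth lookup_euler lookup_tconst_times zconst_of_nat)
  thus ?case unfolding Suc[folded g_def] by (simp add: zconst_diff zconst_add algebra_simps)
qed simp

text \<open>This is \<chi>(c + \<delta>) applied to q, where \<chi> is the indicial polynomial. It
  is kept as a sum of falling factorials on all of k(z), because multiplication by constants leads
  out of the polynomials; on steep polynomials it turns into \<open>zact\<close>.\<close>

definition zchi :: "'k::field fps poly \<Rightarrow> 'k \<Rightarrow> 'k zrat \<Rightarrow> 'k zrat" where
  "zchi L c q = (\<Sum>j\<le>degree L. zconst (coeff L j $ j) * zfall j c q)"

lemma coeff_initial_form:
  "coeff (initial_form L) j = fps_const (coeff L j $ j) * fps_X ^ j"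
proof -
  have "coeff (initial_form L) j = (\<Sum>i\<le>degree L. if i = j then fps_const (coeff L i $ i) * fps_X ^ i else 0)"
    by (simp add: initial_form_def coeff_sum coeff_monom)
  also have "\<dots> = (if j \<le> degree L then fps_const (coeff L j $ j) * fps_X ^ j else 0)"
    by simp
  also have "\<dots> = fps_const (coeff L j $ j) * fps_X ^ j"
    using coeff_eq_0[of L j] by (auto simp: not_le)
  finally show ?thesis .
qed

lemma tser_0 [simp]: "tser 0 = 0"
  by (simp add: tser_def zconst_0 flip: fps_zero_def)

lemma op_act_superset:
  assumes "degree L \<le> N"
  shows "op_act L f = (\<Sum>j\<le>N. tser (coeff L j) * (tderiv ^^ j) f)"
  unfolding op_act_def
  by (rule sum.mono_neutral_left) (use assms in \<open>auto simp: coeff_eq_0\<close>)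

lemma tser_monomial: "tser (fps_const c * fps_X ^ j) = tconst c * tX ^ j"
proof -
  have X: "tX ^ j = single 0 (fls_X ^ j)" for j
    by (induction j) (simp_all add: tX_def mult_single)
  have "Abs_fps (\<lambda>i. zconst ((fps_const c * fps_X ^ j) $ i)) = fps_const (zconst c) * fps_X ^ j"
    by (rule fps_ext) (simp add: zconst_0)
  thus ?thesis
    unfolding tser_def by (simp add: X tconst_def mult_single fls_times_fps_to_fls fps_to_fls_power)
qed

lemma lookup_op_act_initial_form:
  "lookup (op_act (initial_form L) f) \<sigma> $$ n = zchi L (\<sigma> + of_int n) (lookup f \<sigma> $$ n)"
proof -
  have "degree (initial_form L) \<le> degree L"
    by (rule degree_le) (simp add: coeff_initial_form coeff_eq_0)
  hence "op_act (initial_form L) f =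
      (\<Sum>j\<le>degree L. tconst (coeff L j $ j) * (tX ^ j * (tderiv ^^ j) f))"
    by (simp add: op_act_superset coeff_initial_form tser_monomial mult.assoc)
  moreover have "sum g A $$ n = (\<Sum>i\<in>A. g i $$ n)" for g :: "nat \<Rightarrow> 'a zrat fls" and A
    by (induction A rule: infinite_finite_induct) simp_all
  ultimately show ?thesis
    by (simp add: lookup_sum lookup_zfall zchi_def del: lookup_tX_power_times)
qed

lemma zfall_add: "zfall j c (q + r) = zfall j c q + zfall j c r"
  by (induction j) (simp_all add: zrat_deriv_add algebra_simps)

lemma zchi_add: "zchi L c (q + r) = zchi L c q + zchi L c r"
  by (simp add: zchi_def zfall_add distrib_left sum.distrib)

lemma zfall_mult_const:
  assumes "zrat_deriv d = 0"
  shows "zfall j c (q * d) = zfall j c q * d"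
  by (induction j) (simp_all add: zrat_deriv_mult assms algebra_simps)

lemma zchi_mult_const: "zrat_deriv d = 0 \<Longrightarrow> zchi L c (q * d) = zchi L c q * d"
  by (simp add: zchi_def zfall_mult_const sum_distrib_right mult.assoc)

lemma zchi_0 [simp]: "zchi L c 0 = 0"
  using zchi_add[of L c 0 0] unfolding add_0_left by (metis add_cancel_right_right)

lemma zact_superset:
  assumes "degree q \<le> N"
  shows "zact q P = (\<Sum>j\<le>N. single 0 (coeff q j) * (zD ^^ j) P)"
  unfolding zact_def
  by (rule sum.mono_neutral_left) (use assms in \<open>auto simp: coeff_eq_0\<close>)

lemma zact_poly_add: "zact (q + r) P = zact q P + zact r P"
proof -
  define N where "N = max (degree q) (degree r)"
  have "degree (q + r) \<le> N" "degree q \<le> N" "degree r \<le> N"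
    by (simp_all add: N_def degree_add_le_max)
  thus ?thesis by (simp add: zact_superset[of _ N] single_add distrib_right sum.distrib)
qed

lemma zact_poly_0 [simp]: "zact 0 P = 0"
  by (simp add: zact_def)

lemma zact_poly_sum: "zact (sum f A) P = (\<Sum>i\<in>A. zact (f i) P)"
  by (induction A rule: infinite_finite_induct) (simp_all add: zact_poly_add)

lemma zact_smult: "zact (smult a q) P = single 0 a * zact q P"
  by (simp add: zact_superset[of _ "degree q"] degree_smult_le sum_distrib_left
      mult.assoc[symmetric] mult_single)

lemma zact_pCons_0: "zact (pCons 0 q) P = zD (zact q P)"
proof -
  have "zact (pCons 0 q) P = (\<Sum>j\<le>Suc (degree q). single 0 (coeff (pCons 0 q) j) * (zD ^^ j) P)"
    by (rule zact_superset) (rule degree_pCons_le)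
  also have "\<dots> = (\<Sum>j\<le>degree q. single 0 (coeff q j) * (zD ^^ Suc j) P)"
    by (subst sum.atMost_Suc_shift) simp
  also have "\<dots> = zD (zact q P)" by (simp add: zact_def zD_sum zD_scale)
  finally show ?thesis .
qed

lemma Fract_scale: "Fract (single 0 c * P) 1 = zconst c * Fract P 1"
  by (simp add: zconst_def)

lemma zact_keys_steep:
  assumes "keys P \<subseteq> steep CHAR('k::field)" "CHAR('k) > 0"
  shows "keys (zact q (P :: 'k zpoly)) \<subseteq> steep CHAR('k)"
  using zact_keys[OF assms(1) _ assms(2), of _ q 0] by blast

lemma zact_1 [simp]: "zact 1 P = P"
  by (simp add: zact_def)

lemma zfall_steep:
  assumes "keys P \<subseteq> steep CHAR('k::field)" "CHAR('k) > 0"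
  shows "zfall j c (Fract (P :: 'k zpoly) 1) = Fract (zact (\<Prod>i<j. [:c - of_nat i, 1:]) P) 1"
proof (induction j)
  case (Suc j)
  define q where "q = (\<Prod>i<j. [:c - of_nat i, 1:])"
  have "zact ([:c - of_nat j, 1:] * q) P = single 0 (c - of_nat j) * zact q P + zD (zact q P)"
    by (simp add: zact_poly_add zact_smult zact_pCons_0)
  thus ?case using Suc zrat_deriv_steep[OF zact_keys_steep[OF assms, of q] assms(2)]
    unfolding prod.lessThan_Suc q_def[symmetric] zfall.simps
    by (simp only: mult.commute[of q] Fract_scale Fract_add_1)
qed simp

lemma pcompose_indicial_poly:
  "pcompose (indicial_poly L) [:c, 1:] =
     (\<Sum>i\<le>degree L. smult (coeff L i $ i) (\<Prod>j<i. [:c - of_nat j, 1:]))"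
  by (simp add: indicial_poly_def pcompose_sum pcompose_smult pcompose_prod pcompose_pCons)

lemma zchi_steep:
  assumes "keys P \<subseteq> steep CHAR('k::field)" "CHAR('k) > 0"
  shows "zchi L c (Fract (P :: 'k zpoly) 1) = Fract (zact (pcompose (indicial_poly L) [:c, 1:]) P) 1"
  by (simp add: zchi_def zfall_steep[OF assms] pcompose_indicial_poly zact_poly_sum zact_smult
      Fract_sum Fract_scale del: mult_fract)

text \<open>The falling factorials are monic of distinct degrees, so the largest n with c_nn nonzero
  gives the coefficient of s^n. Such an n exists because the shift 0 is attained on the
  diagonal.\<close>

lemma indicial_poly_nonzero:
  assumes "is_shift L 0"
  shows "indicial_poly L \<noteq> 0"
proof
  assume 0: "indicial_poly L = 0"
  define q where "q i = (\<Prod>j<i. [:- of_nat j, 1:] :: 'a poly)" for i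
  have mon: "degree (q i) = i \<and> coeff (q i) i = 1" for i
  proof (induction i)
    case (Suc i)
    have "degree (q (Suc i)) = Suc i"
      using Suc unfolding q_def by (simp add: prod_zero_iff degree_mult_eq del: mult_pCons_left mult_pCons_right)
    moreover have "lead_coeff (q (Suc i)) = lead_coeff (q i)"
      unfolding q_def prod.lessThan_Suc lead_coeff_mult by simp
    ultimately show ?case using Suc by simp
  qed (simp add: q_def)
  from assms obtain i where "coeff L i $ i \<noteq> 0" by (auto simp: is_shift_def)
  moreover have "finite {i. coeff L i $ i \<noteq> 0}"
    by (rule finite_subset[of _ "{..degree L}"]) (auto intro!: le_degree)
  ultimately obtain n where n: "coeff L n $ n \<noteq> 0" "\<And>i. coeff L i $ i \<noteq> 0 \<Longrightarrow> i \<le> n"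
    using Max_in[of "{i. coeff L i $ i \<noteq> 0}"] Max_ge[of "{i. coeff L i $ i \<noteq> 0}"] by blast
  have nL: "n \<le> degree L" using n(1) by (auto intro!: le_degree)
  have "coeff (indicial_poly L) n = (\<Sum>i\<le>degree L. coeff L i $ i * coeff (q i) n)"
    by (simp add: indicial_poly_def coeff_sum q_def)
  also have "\<dots> = (\<Sum>i\<le>degree L. if i = n then coeff L n $ n else 0)"
  proof (rule sum.cong)
    fix i
    show "coeff L i $ i * coeff (q i) n = (if i = n then coeff L n $ n else 0)"
      using n(2)[of i] mon[of i] coeff_eq_0[of "q i" n] by (cases i n rule: linorder_cases) auto
  qed simp
  also have "\<dots> = coeff L n $ n" using nL by simp
  finally show False using 0 n(1) by simp
qed

lemma pcompose_hom_power: "pcompose (q ^ n) r = pcompose q r ^ n"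
  by (induction n) (simp_all add: pcompose_mult pcompose_1)

text \<open>If q = (s - c)^m r with r(c) nonzero, the translate is s^m r(s + c). For the indicial
  polynomial and c = \<rho> + k this yields the factor \<delta>^m and the nonzero scalar that
  follows it.\<close>

lemma coeff_pcompose_order:
  fixes q :: "'k::field poly"
  assumes "q \<noteq> 0"
  shows "i < order c q \<Longrightarrow> coeff (pcompose q [:c, 1:]) i = 0"
    and "coeff (pcompose q [:c, 1:]) (order c q) \<noteq> 0"
proof -
  obtain r where r: "q = [:-c, 1:] ^ order c q * r" "\<not> [:-c, 1:] dvd r"
    using order_decomp[OF assms] by blast
  have "pcompose q [:c, 1:] = pcompose [:-c, 1:] [:c, 1:] ^ order c q * pcompose r [:c, 1:]"
    by (subst r(1)) (simp add: pcompose_mult pcompose_hom_power)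
  also have "pcompose [:-c, 1:] [:c, 1:] = [:0, 1:]" by (simp add: pcompose_pCons)
  finally have eq: "pcompose q [:c, 1:] = monom 1 (order c q) * pcompose r [:c, 1:]"
    by (simp add: monom_altdef)
  show "i < order c q \<Longrightarrow> coeff (pcompose q [:c, 1:]) i = 0"
    by (simp add: eq coeff_monom_mult)
  have "coeff (pcompose r [:c, 1:]) 0 = poly r c"
    by (simp add: poly_0_coeff_0[symmetric] poly_pcompose)
  thus "coeff (pcompose q [:c, 1:]) (order c q) \<noteq> 0"
    using r(2) by (simp add: eq coeff_monom_mult poly_eq_0_iff_dvd)
qed

subsection \<open>Multiplication by constants\<close>

definition pth_poly :: "'k::field zpoly set" where
  "pth_poly = {P. \<forall>\<alpha>\<in>keys P. \<forall>i. CHAR('k) dvd lookup \<alpha> i}"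

lemma pth_poly_mult:
  assumes "P \<in> pth_poly" "Q \<in> pth_poly"
  shows "P * Q \<in> pth_poly"
  using keys_mult[of P Q] assms by (fastforce simp: pth_poly_def lookup_add)

lemma pth_poly_1 [simp]: "1 \<in> pth_poly"
  by (simp add: pth_poly_def)

lemma zrat_pth_iff: "q \<in> zrat_pth \<longleftrightarrow> (\<exists>P\<in>pth_poly. \<exists>Q\<in>pth_poly. Q \<noteq> 0 \<and> q = Fract P Q)"
  unfolding zrat_pth_def pth_poly_def by blast

lemma zpoly_deriv_pth:
  assumes "P \<in> (pth_poly :: 'k::field zpoly set)"
  shows "zpoly_deriv P = 0"
proof -
  have "zpoly_pderiv i P = 0" for i
    unfolding zpoly_pderiv_def
  proof (rule sum.neutral, rule ballI)
    fix \<alpha> assume "\<alpha> \<in> keys P"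
    hence "of_nat (lookup \<alpha> i) = (0 :: 'k)"
      using assms by (simp add: pth_poly_def of_nat_eq_0_iff_char_dvd)
    thus "single (\<alpha> - single i 1) (of_nat (lookup \<alpha> i) * lookup P \<alpha>) = 0" by simp
  qed
  thus ?thesis by (simp add: zpoly_deriv_def Zero_fract_def[symmetric])
qed

lemma zrat_deriv_pth: "q \<in> zrat_pth \<Longrightarrow> zrat_deriv q = 0"
  by (auto simp: zrat_pth_iff zrat_deriv_Fract zpoly_deriv_pth)

lemma zrat_pth_0 [simp]: "0 \<in> zrat_pth"
  unfolding zrat_pth_iff Zero_fract_def
  by (rule bexI[of _ 0], rule bexI[of _ 1]) (simp_all add: pth_poly_def)

lemma of_int_zrat_eq_0:
  assumes "int CHAR('k::field) dvd n"
  shows "(of_int n :: 'k zrat) = 0"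
proof -
  have "of_int n = (0::'k)" using assms by (simp add: of_int_eq_0_iff_char_dvd)
  thus ?thesis using zconst_of_int[of n, where 'a='k] zconst_0 by metis
qed

lemma tderiv_pth:
  assumes "g \<in> fls_pth"
  shows "tderiv (single 0 g) = 0"
proof -
  have "fls_deriv g = 0"
    by (rule fls_eqI) (use assms of_int_zrat_eq_0 in \<open>fastforce simp: fls_pth_def\<close>)
  moreover have "fls_map zrat_deriv g = 0"
    by (rule fls_eqI) (use assms in \<open>simp add: fls_pth_def fls_map_nth zrat_deriv_pth\<close>)
  ultimately show ?thesis by (simp add: tderiv_single zconst_0)
qed

lemma op_act_mult_const:
  assumes "tderiv c = 0"
  shows "op_act L (c * f) = c * op_act L f"
proof -
  have "(tderiv ^^ j) (c * f) = c * (tderiv ^^ j) f" for j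
    by (induction j) (simp_all add: tderiv_mult assms)
  thus ?thesis by (simp add: op_act_def sum_distrib_left mult_ac)
qed

lemma lookup_times_single:
  fixes c :: "'k::field tring"
  shows "lookup (c * single \<rho> h) (\<sigma> + \<rho>) = lookup c \<sigma> * h"
  by (induction c rule: tring_induct)
    (simp_all add: mult_single lookup_single distrib_right lookup_add when_def)

text \<open>The product has component c_\<sigma> h at \<sigma> + \<rho>, and the Laurent series form
  a field, so only c_0 survives. Among the representatives s < p only s = 0 contributes to it,
  giving x^p g_0, where x^p shifts exponents by a multiple of p.\<close>

lemma tconstants_pure:
  assumes c: "c \<in> tconstants" and eq: "c * single \<rho> h = single (\<rho>::'k::field) h'" and h: "h \<noteq> 0"
    and p: "CHAR('k) > 0"
  shows "\<exists>g\<in>fls_pth. c = single 0 g"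
proof -
  from c obtain g where g: "\<And>s. s < CHAR('k) \<Longrightarrow> g s \<in> fls_pth"
    "c = (\<Sum>s<CHAR('k). single (of_nat s) (fls_X ^ (CHAR('k) - s) * g s))"
    by (auto simp: tconstants_def)
  have "lookup c \<sigma> = 0" if "\<sigma> \<noteq> 0" for \<sigma>
  proof -
    have "lookup c \<sigma> * h = lookup (c * single \<rho> h) (\<sigma> + \<rho>)" by (simp add: lookup_times_single)
    also have "\<dots> = 0" using that by (simp add: eq lookup_single)
    finally show ?thesis using h by simp
  qed
  hence "c = single 0 (lookup c 0)"
    by (intro poly_mapping_eqI) (simp add: lookup_single when_def)
  also have "lookup c 0 = fls_X ^ CHAR('k) * g 0"
  proof -
    have *: "lookup (single (of_nat s) (fls_X ^ (CHAR('k) - s) * g s)) (0::'k) =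
        (if s = 0 then fls_X ^ CHAR('k) * g 0 else 0)" if "s < CHAR('k)" for s
    proof -
      have "of_nat s = (0::'k) \<longleftrightarrow> s = 0"
        using that by (auto simp: of_nat_eq_0_iff_char_dvd dest: dvd_imp_le)
      thus ?thesis by (simp add: lookup_single when_def)
    qed
    have "lookup c 0 = (\<Sum>s<CHAR('k). if s = 0 then fls_X ^ CHAR('k) * g 0 else 0)"
      unfolding g(2) lookup_sum by (rule sum.cong) (use * in auto)
    thus ?thesis using p by simp
  qed
  finally have "c = single 0 (fls_X ^ CHAR('k) * g 0)" .
  moreover have "fls_X ^ CHAR('k) * g 0 \<in> fls_pth"
  proof -
    have "int CHAR('k) dvd n" if "int CHAR('k) dvd n + - int CHAR('k)" for n
      using dvd_add[OF that dvd_refl] by simp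
    moreover have "\<forall>n. g 0 $$ n \<in> zrat_pth \<and> (g 0 $$ n \<noteq> 0 \<longrightarrow> int CHAR('k) dvd n)"
      using g(1)[OF p] unfolding fls_pth_def by blast
    ultimately show ?thesis
      unfolding fls_pth_def fls_X_power_times_conv_shift mem_Collect_eq fls_shift_nth by blast
  qed
  ultimately show ?thesis by blast
qed

lemma expo_weight_cong:
  assumes "\<And>i. lookup \<alpha> i mod p = lookup \<beta> i mod p"
  shows "expo_weight p \<alpha> = expo_weight p \<beta>"
proof -
  have *: "expo_weight p \<gamma> = (\<Sum>i\<in>keys \<alpha> \<union> keys \<beta>. p ^ i * (lookup \<gamma> i mod p))"
    if "\<gamma> \<in> {\<alpha>, \<beta>}" for \<gamma>
    unfolding expo_weight_def by (rule sum.mono_neutral_left) (use that in \<open>auto simp: in_keys_iff\<close>)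
  show ?thesis using *[of \<alpha>] *[of \<beta>] assms by simp
qed

lemma expo_weight_add_pth:
  assumes "\<And>i. p dvd lookup \<beta> i"
  shows "expo_weight p (\<alpha> + \<beta>) = expo_weight p \<alpha>"
  by (rule expo_weight_cong) (use assms in \<open>simp add: lookup_add mod_add_cong mod_add_right_eq[symmetric] dvd_eq_mod_eq_0\<close>)

lemma expo_bound:
  assumes "finite (K :: expo set)"
  shows "\<exists>N. \<forall>\<alpha>\<in>K. \<forall>i. lookup \<alpha> i \<le> N \<and> (N \<le> i \<longrightarrow> lookup \<alpha> i = 0)"
  using assms
proof (induction K)
  case (insert \<alpha> K)
  then obtain N where N: "\<forall>\<alpha>\<in>K. \<forall>i. lookup \<alpha> i \<le> N \<and> (N \<le> i \<longrightarrow> lookup \<alpha> i = 0)" by blast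
  define M where "M = (\<Sum>i\<in>keys \<alpha>. lookup \<alpha> i + Suc i)"
  have M: "lookup \<alpha> i \<le> M \<and> (M \<le> i \<longrightarrow> lookup \<alpha> i = 0)" for i
  proof (cases "i \<in> keys \<alpha>")
    case True
    hence "lookup \<alpha> i + Suc i \<le> M" unfolding M_def by (intro member_le_sum) auto
    thus ?thesis by simp
  qed (simp add: in_keys_iff)
  show ?case
  proof (intro exI[of _ "max N M"] ballI allI)
    fix \<beta> i assume "\<beta> \<in> insert \<alpha> K"
    thus "lookup \<beta> i \<le> max N M \<and> (max N M \<le> i \<longrightarrow> lookup \<beta> i = 0)"
      using N M[of i] by (auto simp: le_max_iff_disj)
  qed
qed simp

lemma steep_shift:
  assumes "finite K"
  obtains \<beta> where "\<And>i. p dvd lookup \<beta> i" "\<And>\<alpha>. \<alpha> \<in> K \<Longrightarrow> \<alpha> + \<beta> \<in> steep p"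
proof -
  from expo_bound[OF assms] obtain N where N:
    "\<And>\<alpha> i. \<alpha> \<in> K \<Longrightarrow> lookup \<alpha> i \<le> N" "\<And>\<alpha> i. \<alpha> \<in> K \<Longrightarrow> N \<le> i \<Longrightarrow> lookup \<alpha> i = 0" by blast
  \<comment> \<open>As \<alpha>_{j+1} \<le> N, it is enough that \<beta>_j = p (N + \<beta>_{j+1}).
    With \<beta>_j = p g(N - j) this becomes g(r + 1) = N + p g(r), g(0) = 0, solved by a geometric
    sum; from index N on, \<alpha> and \<beta> both vanish.\<close>
  define g where "g r = N * (\<Sum>i<r. p ^ i)" for r :: nat
  have g0: "g 0 = 0" by (simp add: g_def)
  have gS: "g (Suc r) = N + p * g r" for r
    unfolding g_def sum.lessThan_Suc_shift by (simp add: sum_distrib_left algebra_simps)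
  define \<beta> where "\<beta> = (\<Sum>j<N. single j (p * g (N - j)))"
  have \<beta>: "lookup \<beta> j = p * g (N - j)" for j
    by (simp add: \<beta>_def lookup_sum lookup_single when_def g0)
  have "p * lookup (\<alpha> + \<beta>) (Suc j) \<le> lookup (\<alpha> + \<beta>) j" if "\<alpha> \<in> K" for \<alpha> j
  proof (cases "j < N")
    case True
    hence "p * g (N - j) = p * (N + p * g (N - Suc j))" by (simp flip: gS add: Suc_diff_Suc)
    moreover have "p * lookup \<alpha> (Suc j) \<le> p * N" using N(1)[OF that] by simp
    ultimately show ?thesis unfolding lookup_add \<beta> distrib_left by linarith
  qed (use N(2)[OF that] in \<open>simp add: lookup_add \<beta> g0\<close>)
  thus ?thesis using that[of \<beta>] by (simp add: \<beta> steep_def)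
qed

text \<open>The \<open>k(z\<^sup>p)\<close>-span of the monomials of weight at least \<open>m\<close>.\<close>

definition weight_span :: "nat \<Rightarrow> 'k::field zrat set" where
  "weight_span m = {q. \<exists>P. \<exists>Q\<in>pth_poly. Q \<noteq> 0 \<and> q * Fract Q 1 = Fract P 1 \<and>
     (\<forall>\<alpha>\<in>keys P. m \<le> expo_weight CHAR('k) \<alpha>)}"

lemma weight_spanI:
  assumes "Q \<in> pth_poly" "Q \<noteq> 0" "q * Fract Q 1 = Fract P 1"
    "\<And>\<alpha>. \<alpha> \<in> keys P \<Longrightarrow> m \<le> expo_weight CHAR('k) \<alpha>"
  shows "q \<in> (weight_span m :: 'k::field zrat set)"
  using assms unfolding weight_span_def by blast

lemma weight_span_poly:
  "(\<And>\<alpha>. \<alpha> \<in> keys P \<Longrightarrow> m \<le> expo_weight CHAR('k::field) \<alpha>) \<Longrightarrow> Fract (P :: 'k zpoly) 1 \<in> weight_span m"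
  by (auto simp: weight_span_def intro!: exI[of _ P] bexI[of _ 1])

lemma weight_span_0 [simp]: "0 \<in> weight_span m"
  using weight_span_poly[of 0 m] by (simp add: Zero_fract_def)

lemma weight_mult_pth:
  fixes P Q :: "'k::field zpoly"
  assumes "Q \<in> pth_poly" "\<And>\<alpha>. \<alpha> \<in> keys P \<Longrightarrow> m \<le> expo_weight CHAR('k) \<alpha>" "\<alpha> \<in> keys (P * Q)"
  shows "m \<le> expo_weight CHAR('k) \<alpha>"
proof -
  from assms(3) keys_mult[of P Q] obtain a b where ab: "a \<in> keys P" "b \<in> keys Q" "\<alpha> = a + b" by blast
  with assms(1,2) show ?thesis by (simp add: pth_poly_def expo_weight_add_pth)
qed

lemma weight_span_add:
  assumes "q \<in> weight_span m" "r \<in> weight_span m"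
  shows "q + r \<in> weight_span m"
proof -
  from assms obtain P Q P' Q' where
    Q: "Q \<in> pth_poly" "Q \<noteq> 0" "q * Fract Q 1 = Fract P 1" "\<forall>\<alpha>\<in>keys P. m \<le> expo_weight CHAR('a) \<alpha>"
    and Q': "Q' \<in> pth_poly" "Q' \<noteq> 0" "r * Fract Q' 1 = Fract P' 1" "\<forall>\<alpha>\<in>keys P'. m \<le> expo_weight CHAR('a) \<alpha>"
    by (auto simp: weight_span_def)
  have "(q + r) * Fract (Q * Q') 1 = (q * Fract Q 1) * Fract Q' 1 + (r * Fract Q' 1) * Fract Q 1"
    unfolding Fract_mult_1 by (simp only: algebra_simps)
  also have "\<dots> = Fract (P * Q' + P' * Q) 1"
    unfolding Q(3) Q'(3) by simp
  finally have "(q + r) * Fract (Q * Q') 1 = Fract (P * Q' + P' * Q) 1" .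
  moreover have "m \<le> expo_weight CHAR('a) \<alpha>" if "\<alpha> \<in> keys (P * Q' + P' * Q)" for \<alpha>
    using that keys_add[of "P * Q'" "P' * Q"] weight_mult_pth[OF Q'(1), of P m \<alpha>]
      weight_mult_pth[OF Q(1), of P' m \<alpha>] Q(4) Q'(4) by blast
  moreover have "Q * Q' \<noteq> 0" using Q(2) Q'(2) by simp
  ultimately show ?thesis using weight_spanI[OF pth_poly_mult[OF Q(1) Q'(1)]] by blast
qed

lemma weight_span_mult_pth:
  assumes "q \<in> weight_span m" "r \<in> zrat_pth"
  shows "r * q \<in> weight_span m"
proof -
  from assms(1) obtain P Q where
    Q: "Q \<in> pth_poly" "Q \<noteq> 0" "q * Fract Q 1 = Fract P 1" "\<forall>\<alpha>\<in>keys P. m \<le> expo_weight CHAR('a) \<alpha>"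
    by (auto simp: weight_span_def)
  from assms(2) obtain A B where AB: "A \<in> pth_poly" "B \<in> pth_poly" "B \<noteq> 0" "r = Fract A B"
    by (auto simp: zrat_pth_iff)
  have rB: "r * Fract B 1 = Fract A 1" using AB by (simp add: eq_fract)
  have "r * q * Fract (Q * B) 1 = (q * Fract Q 1) * (r * Fract B 1)"
    unfolding Fract_mult_1 by (simp only: mult_ac)
  also have "\<dots> = Fract (P * A) 1" unfolding Q(3) rB by simp
  finally have "r * q * Fract (Q * B) 1 = Fract (P * A) 1" .
  moreover have "m \<le> expo_weight CHAR('a) \<alpha>" if "\<alpha> \<in> keys (P * A)" for \<alpha>
    using weight_mult_pth[OF AB(1), of P m \<alpha>] Q(4) that by blast
  moreover have "Q * B \<noteq> 0" using Q(2) AB(3) by simp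
  ultimately show ?thesis using weight_spanI[OF pth_poly_mult[OF Q(1) AB(2)]] by blast
qed

lemma zrat_pth_minus_1: "- 1 \<in> zrat_pth"
  unfolding zrat_pth_iff
  by (rule bexI[of _ "- 1"], rule bexI[of _ 1]) (simp_all add: One_fract_def pth_poly_def)

lemma weight_span_diff: "q \<in> weight_span m \<Longrightarrow> r \<in> weight_span m \<Longrightarrow> q - r \<in> weight_span m"
  using weight_span_add[of q m "- 1 * r"] weight_span_mult_pth[OF _ zrat_pth_minus_1, where q = r and m = m] by simp

lemma weight_span_sum: "(\<And>i. i \<in> A \<Longrightarrow> f i \<in> weight_span m) \<Longrightarrow> sum f A \<in> weight_span m"
  by (induction A rule: infinite_finite_induct) (simp_all add: weight_span_add)

text \<open>A constant monomial factor moves all exponents into the steep cone, where \<open>zact_inj\<close> applies.\<close>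

lemma zchi_weight_span_inj:
  fixes q :: "'k::field zrat"
  assumes q: "q \<in> weight_span (expo_mult L c)" and 0: "zchi L c q = 0"
    and L: "is_shift L 0" and p: "CHAR('k) > 0"
  shows "q = 0"
proof -
  define m where "m = expo_mult L c"
  from q obtain P Q where
    Q: "Q \<in> pth_poly" "Q \<noteq> 0" "q * Fract Q 1 = Fract P 1" "\<forall>\<alpha>\<in>keys P. m \<le> expo_weight CHAR('k) \<alpha>"
    by (auto simp: weight_span_def m_def)
  obtain \<beta> where \<beta>: "\<And>i. CHAR('k) dvd lookup \<beta> i" "\<And>\<alpha>. \<alpha> \<in> keys P \<Longrightarrow> \<alpha> + \<beta> \<in> steep CHAR('k)"
    using steep_shift[of "keys P" "CHAR('k)"] by auto
  define M where "M = (single \<beta> 1 :: 'k zpoly)"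
  have M: "M \<in> pth_poly" using \<beta>(1) by (simp add: pth_poly_def M_def)
  have "M \<noteq> 0" by (metis M_def lookup_single_eq lookup_zero zero_neq_one)
  \<comment> \<open>One factor clears the denominator Q and shifts the exponents by \<beta>. Both Q
    and M have only exponents divisible by p, so \<delta> d = 0 and d passes through
    \<open>zchi\<close>.\<close>
  define d where "d = Fract (Q * M) 1"
  have "Q * M \<in> pth_poly" by (rule pth_poly_mult[OF Q(1) M])
  hence "zrat_deriv d = 0" by (simp add: d_def zrat_deriv_poly zpoly_deriv_pth)
  have d0: "d \<noteq> 0" using Q(2) \<open>M \<noteq> 0\<close> by (simp add: d_def Zero_fract_def eq_fract)
  have qd: "q * d = Fract (P * M) 1"
    unfolding d_def Fract_mult_1 mult.assoc[symmetric] Q(3) ..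
  have st: "keys (P * M) \<subseteq> steep CHAR('k)"
    using keys_mult[of P M] \<beta>(2) by (auto simp: M_def)
  have "0 = zchi L c (q * d)" using 0 \<open>zrat_deriv d = 0\<close> by (simp add: zchi_mult_const)
  also have "\<dots> = Fract (zact (pcompose (indicial_poly L) [:c, 1:]) (P * M)) 1"
    unfolding qd by (rule zchi_steep[OF st p])
  finally have z: "zact (pcompose (indicial_poly L) [:c, 1:]) (P * M) = 0"
    by (simp add: Zero_fract_def eq_fract)
  have "P * M = 0"
  proof (rule zact_inj[OF st _ p _ _ z])
    show "m \<le> expo_weight CHAR('k) \<alpha>" if "\<alpha> \<in> keys (P * M)" for \<alpha>
      using weight_mult_pth[OF M _ that, of m] Q(4) by blast
  qed (use coeff_pcompose_order[OF indicial_poly_nonzero[OF L]] in \<open>auto simp: m_def expo_mult_def\<close>)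
  hence "q * d = 0" unfolding qd by (simp only: Zero_fract_def)
  thus ?thesis using d0 by simp
qed

text \<open>The enlargement of H in which c (S f) can be placed. Of the conditions on H it retains
  the weight condition alone, on Laurent series with arbitrary negative powers; injectivity holds in
  each coefficient, and multiplication by k(z^p)((x^p)) does not leave it.\<close>

definition weight_space :: "'k::field fps poly \<Rightarrow> 'k \<Rightarrow> 'k zrat fls set" where
  "weight_space L \<rho> = {h. \<forall>n. h $$ n \<in> weight_span (expo_mult L (\<rho> + of_int n))}"

text \<open>A nonzero coefficient g_i has i divisible by p, so \<rho> + n and \<rho> + (n - i) are
  the same element of k and prescribe the same multiplicity.\<close>

lemma weight_space_mult_pth:
  assumes "g \<in> fls_pth" "h \<in> weight_space L (\<rho>::'k::field)"
  shows "g * h \<in> weight_space L \<rho>"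
  unfolding weight_space_def
proof (intro CollectI allI)
  fix n
  have "g $$ i * h $$ (n - i) \<in> weight_span (expo_mult L (\<rho> + of_int n))" for i
  proof (cases "g $$ i = 0")
    case False
    hence "int CHAR('k) dvd i" using assms(1) by (simp add: fls_pth_def)
    hence "of_int i = (0::'k)" by (simp add: of_int_eq_0_iff_char_dvd)
    hence "h $$ (n - i) \<in> weight_span (expo_mult L (\<rho> + of_int n))"
      using assms(2)[unfolded weight_space_def, THEN CollectD, rule_format, of "n - i"] by simp
    thus ?thesis using assms(1) by (intro weight_span_mult_pth) (simp_all add: fls_pth_def)
  qed simp
  thus "(g * h) $$ n \<in> weight_span (expo_mult L (\<rho> + of_int n))"
    unfolding fls_times_nth(2) by (intro weight_span_sum)
qed

lemma initial_form_inj_weight_space: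
  fixes \<rho> :: "'k::field"
  assumes "h \<in> weight_space L \<rho>" "h' \<in> weight_space L \<rho>"
    and eq: "op_act (initial_form L) (single \<rho> h) = op_act (initial_form L) (single \<rho> h')"
    and L: "is_shift L 0" and p: "CHAR('k) > 0"
  shows "h = h'"
proof (rule fls_eqI)
  fix n
  have "zchi L (\<rho> + of_int n) (h $$ n - h' $$ n + h' $$ n) = zchi L (\<rho> + of_int n) (h' $$ n)"
    using arg_cong[OF eq, of "\<lambda>f. lookup f \<rho> $$ n"] by (simp add: lookup_op_act_initial_form)
  hence "zchi L (\<rho> + of_int n) (h $$ n - h' $$ n) = 0"
    unfolding zchi_add by simp
  moreover have "h $$ n - h' $$ n \<in> weight_span (expo_mult L (\<rho> + of_int n))"
    using assms(1,2) by (intro weight_span_diff) (simp_all add: weight_space_def)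
  ultimately show "h $$ n = h' $$ n" using zchi_weight_span_inj[OF _ _ L p] by fastforce
qed

subsection \<open>Spaces of power series and order raising maps\<close>

definition zspan :: "expo set \<Rightarrow> 'k::field zrat set" where
  "zspan A = {Fract P 1 | P. keys P \<subseteq> A}"

text \<open>F, F x and H all have this shape and differ only in the exponents permitted at each
  power of x, so the topology and the order arguments can be developed once.\<close>

definition series_space :: "'k::field \<Rightarrow> (nat \<Rightarrow> expo set) \<Rightarrow> 'k tring set" where
  "series_space \<rho> A =
     {single \<rho> h | h. (\<forall>n<0. h $$ n = 0) \<and> (\<forall>k. h $$ int k \<in> zspan (A k))}"

lemma zspanI: "keys P \<subseteq> A \<Longrightarrow> Fract P 1 \<in> zspan A"
  by (auto simp: zspan_def)

lemma zspanE: "q \<in> zspan A \<Longrightarrow> (\<And>P. q = Fract P 1 \<Longrightarrow> keys P \<subseteq> A \<Longrightarrow> thesis) \<Longrightarrow> thesis"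
  by (auto simp: zspan_def)

lemma zspan_0 [simp]: "0 \<in> zspan A"
  using zspanI[of 0 A] by (simp add: Zero_fract_def)

lemma zspan_add:
  assumes "q \<in> zspan A" "r \<in> zspan A"
  shows "q + r \<in> zspan A"
proof -
  obtain P Q where "q = Fract P 1" "keys P \<subseteq> A" "r = Fract Q 1" "keys Q \<subseteq> A"
    using assms by (auto simp: zspan_def)
  thus ?thesis using zspanI[of "P + Q" A] keys_add[of P Q] by auto
qed

lemma zspan_scale:
  assumes "q \<in> zspan A"
  shows "zconst c * q \<in> zspan A"
proof -
  obtain P where P: "q = Fract P 1" "keys P \<subseteq> A" using assms by (rule zspanE)
  have "keys (single 0 c * P) \<subseteq> A" using keys_scale P(2) by (rule order_trans)
  thus ?thesis unfolding P(1) Fract_scale[symmetric] by (rule zspanI)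
qed

lemma zspan_sum: "(\<And>i. i \<in> I \<Longrightarrow> f i \<in> zspan A) \<Longrightarrow> sum f I \<in> zspan A"
  by (induction I rule: infinite_finite_induct) (simp_all add: zspan_add)

lemma zspan_mono: "A \<subseteq> B \<Longrightarrow> zspan A \<subseteq> zspan B"
  by (auto simp: zspan_def)

lemma series_space_iff:
  "f \<in> series_space \<rho> A \<longleftrightarrow> (\<forall>\<sigma>. \<sigma> \<noteq> \<rho> \<longrightarrow> lookup f \<sigma> = 0) \<and> (\<forall>n<0. lookup f \<rho> $$ n = 0) \<and>
     (\<forall>k. lookup f \<rho> $$ int k \<in> zspan (A k))"
proof
  assume "(\<forall>\<sigma>. \<sigma> \<noteq> \<rho> \<longrightarrow> lookup f \<sigma> = 0) \<and> (\<forall>n<0. lookup f \<rho> $$ n = 0) \<and>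
     (\<forall>k. lookup f \<rho> $$ int k \<in> zspan (A k))"
  moreover from this have "f = single \<rho> (lookup f \<rho>)"
    by (intro poly_mapping_eqI) (simp add: lookup_single when_def)
  ultimately show "f \<in> series_space \<rho> A" unfolding series_space_def by blast
qed (auto simp: series_space_def lookup_single when_def)

lemma series_spaceD:
  assumes "f \<in> series_space \<rho> A"
  shows "\<sigma> \<noteq> \<rho> \<Longrightarrow> lookup f \<sigma> = 0" "n < 0 \<Longrightarrow> lookup f \<rho> $$ n = 0"
    "lookup f \<rho> $$ int k \<in> zspan (A k)" "f = single \<rho> (lookup f \<rho>)"
  using assms by (auto simp: series_space_iff intro!: poly_mapping_eqI simp: lookup_single when_def)

lemma series_space_eqI:
  assumes "f \<in> series_space \<rho> A" "g \<in> series_space \<rho> B"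
    "\<And>k. lookup f \<rho> $$ int k = lookup g \<rho> $$ int k"
  shows "f = g"
proof -
  have "lookup f \<rho> $$ n = lookup g \<rho> $$ n" for n
    using series_spaceD(2)[OF assms(1), of n] series_spaceD(2)[OF assms(2), of n] assms(3)[of "nat n"]
    by (cases "n < 0") simp_all
  hence "lookup f \<rho> = lookup g \<rho>" by (rule fls_eqI)
  thus ?thesis using series_spaceD(4)[OF assms(1)] series_spaceD(4)[OF assms(2)] by metis
qed

lemma series_space_ex:
  assumes "\<And>k. a k \<in> zspan (A k)"
  obtains f where "f \<in> series_space \<rho> A" "\<And>k. lookup f \<rho> $$ int k = a k"
proof
  show "single \<rho> (fps_to_fls (Abs_fps a)) \<in> series_space \<rho> A"
    using assms by (auto simp: series_space_def)
qed simp

lemma series_space_0 [simp]: "0 \<in> series_space \<rho> A"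
  by (simp add: series_space_iff)

lemma series_space_add:
  "f \<in> series_space \<rho> A \<Longrightarrow> g \<in> series_space \<rho> A \<Longrightarrow> f + g \<in> series_space \<rho> A"
  by (auto simp: series_space_iff lookup_add zspan_add)

lemma series_space_scale: "f \<in> series_space \<rho> A \<Longrightarrow> tconst c * f \<in> series_space \<rho> A"
  by (auto simp: series_space_iff zspan_scale zconst_0 intro!: fls_eqI)

lemma tconst_minus_1: "tconst (- 1) * f = - f"
  by (rule poly_mapping_eqI, rule fls_eqI) (simp add: zconst_uminus)

lemma series_space_diff:
  "f \<in> series_space \<rho> A \<Longrightarrow> g \<in> series_space \<rho> A \<Longrightarrow> f - g \<in> series_space \<rho> A"
  using series_space_add[OF _ series_space_scale[of g \<rho> A "- 1"]] by (simp add: tconst_minus_1)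

lemma series_space_sum:
  "(\<And>i. i \<in> I \<Longrightarrow> f i \<in> series_space \<rho> A) \<Longrightarrow> sum f I \<in> series_space \<rho> A"
  by (induction I rule: infinite_finite_induct) (simp_all add: series_space_add)

lemma series_space_mono:
  assumes "f \<in> series_space \<rho> A" "\<And>k. A k \<subseteq> B k"
  shows "f \<in> series_space \<rho> B"
proof -
  have "lookup f \<rho> $$ int k \<in> zspan (B k)" for k
    using series_spaceD(3)[OF assms(1)] zspan_mono[OF assms(2)] by blast
  thus ?thesis using assms(1) by (simp add: series_space_iff)
qed

section \<open>The x-adic topology in terms of orders of vanishing\<close>

definition vanish :: "'k::field \<Rightarrow> nat \<Rightarrow> 'k tring \<Rightarrow> bool" where
  "vanish \<rho> N f \<longleftrightarrow> (\<forall>n<int N. lookup f \<rho> $$ n = 0)"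

lemma vanish_0 [simp]: "vanish \<rho> N 0"
  by (simp add: vanish_def)

lemma vanish_add: "vanish \<rho> N f \<Longrightarrow> vanish \<rho> N g \<Longrightarrow> vanish \<rho> N (f + g)"
  by (simp add: vanish_def lookup_add)

lemma vanish_diff: "vanish \<rho> N f \<Longrightarrow> vanish \<rho> N g \<Longrightarrow> vanish \<rho> N (f - g)"
  by (simp add: vanish_def lookup_minus)

lemma vanish_sum: "(\<And>i. i \<in> I \<Longrightarrow> vanish \<rho> N (f i)) \<Longrightarrow> vanish \<rho> N (sum f I)"
  by (induction I rule: infinite_finite_induct) (simp_all add: vanish_add)

lemma vanish_le: "vanish \<rho> N f \<Longrightarrow> M \<le> N \<Longrightarrow> vanish \<rho> M f"
  by (simp add: vanish_def)

lemma vanish_series_space: "f \<in> series_space \<rho> A \<Longrightarrow> vanish \<rho> 0 f"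
  by (simp add: vanish_def series_spaceD)

lemma series_space_eq_vanish:
  assumes "f \<in> series_space \<rho> A" "g \<in> series_space \<rho> A" "\<And>N. vanish \<rho> N (f - g)"
  shows "f = g"
proof (rule series_space_eqI[OF assms(1,2)])
  fix k
  show "lookup f \<rho> $$ int k = lookup g \<rho> $$ int k"
    using assms(3)[of "Suc k"] by (simp add: vanish_def lookup_minus)
qed

text \<open>The distance is 2^(-d) for the lowest degree d, of either sign, in which a and b differ.
  Strict inequality means agreement up to and including degree N, whereas
  \<open>vanish \<rho> N\<close> stops before N; hence the shifts by one when balls are compared
  with orders.\<close>

lemma dist_fls_less_iff:
  "dist (a :: 'a::group_add fls) b < inverse (2 ^ N) \<longleftrightarrow> (\<forall>n\<le>int N. a $$ n = b $$ n)"
proof (cases "a = b")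
  case False
  define d where "d = fls_subdegree (a - b)"
  have nz: "(a - b) $$ d \<noteq> 0" unfolding d_def by (rule nth_fls_subdegree_nonzero) (use False in simp)
  have "(\<forall>n\<le>int N. a $$ n = b $$ n) \<longleftrightarrow> int N < d"
  proof
    assume "\<forall>n\<le>int N. a $$ n = b $$ n"
    thus "int N < d" using nz by (auto simp: not_le[symmetric])
  next
    assume "int N < d"
    hence "(a - b) $$ n = 0" if "n \<le> int N" for n
      unfolding d_def by (intro fls_eq0_below_subdegree) (use that in linarith)
    thus "\<forall>n\<le>int N. a $$ n = b $$ n" by simp
  qed
  moreover have "dist a b < inverse (2 ^ N) \<longleftrightarrow> int N < d"
  proof (cases "d \<ge> 0")
    case True
    hence "dist a b = inverse (2 ^ nat d)" using False by (simp add: dist_fls_def d_def)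
    thus ?thesis using True by (simp add: zless_nat_eq_int_zless)
  next
    case neg: False
    hence "dist a b = 2 ^ nat (- d)" using False by (simp add: dist_fls_def d_def)
    moreover have "inverse (2 ^ N) \<le> (1::real)" "(1::real) \<le> 2 ^ nat (- d)"
      by (simp_all add: field_simps)
    ultimately show ?thesis using neg by linarith
  qed
  ultimately show ?thesis by simp
qed simp

abbreviation series_topology :: "'k::field \<Rightarrow> (nat \<Rightarrow> expo set) \<Rightarrow> 'k tring topology" where
  "series_topology \<rho> A \<equiv> pullback_topology (series_space \<rho> A) (\<lambda>f. lookup f \<rho>) euclidean"

lemma openin_series_topology:
  "openin (series_topology \<rho> A) U \<longleftrightarrow> U \<subseteq> series_space \<rho> A \<and>
     (\<forall>f\<in>U. \<exists>N. \<forall>g\<in>series_space \<rho> A. vanish \<rho> N (g - f) \<longrightarrow> g \<in> U)"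
proof
  assume "openin (series_topology \<rho> A) U"
  then obtain V where V: "open V" "U = (\<lambda>f. lookup f \<rho>) -` V \<inter> series_space \<rho> A"
    by (auto simp: openin_pullback_topology)
  have "\<exists>N. \<forall>g\<in>series_space \<rho> A. vanish \<rho> N (g - f) \<longrightarrow> g \<in> U" if "f \<in> U" for f
  proof -
    have "lookup f \<rho> \<in> V" using that V(2) by blast
    then obtain e where e: "e > 0" "\<And>h. dist h (lookup f \<rho>) < e \<Longrightarrow> h \<in> V"
      using V(1) by (auto simp: open_dist)
    obtain N where "inverse (2 ^ N) < e"
      using real_arch_pow_inv[of e "1/2"] e(1) by (auto simp: power_one_over inverse_eq_divide)
    moreover have "dist (lookup g \<rho>) (lookup f \<rho>) < inverse (2 ^ N)" if "vanish \<rho> (Suc N) (g - f)" for g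
      using that by (simp add: dist_fls_less_iff vanish_def lookup_minus)
    ultimately show ?thesis using V(2) e(2)
      by (intro exI[of _ "Suc N"]) (metis IntI less_trans vimageI)
  qed
  thus "U \<subseteq> series_space \<rho> A \<and>
     (\<forall>f\<in>U. \<exists>N. \<forall>g\<in>series_space \<rho> A. vanish \<rho> N (g - f) \<longrightarrow> g \<in> U)" using V(2) by blast
next
  assume U: "U \<subseteq> series_space \<rho> A \<and>
     (\<forall>f\<in>U. \<exists>N. \<forall>g\<in>series_space \<rho> A. vanish \<rho> N (g - f) \<longrightarrow> g \<in> U)"
  then obtain N where N: "\<And>f g. f \<in> U \<Longrightarrow> g \<in> series_space \<rho> A \<Longrightarrow> vanish \<rho> (N f) (g - f) \<Longrightarrow> g \<in> U"
    by metis
  \<comment> \<open>A union of balls around the points of U. The metric is non-Archimedean: a ball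
    contains the ball of the same radius around each of its points, so V is open without shrinking
    radii.\<close>
  define V where "V = {h. \<exists>f\<in>U. dist h (lookup f \<rho>) < inverse (2 ^ N f)}"
  have "\<exists>r>0. {y. dist y h < r} \<subseteq> V" if "h \<in> V" for h
  proof -
    from that obtain f where "f \<in> U" "dist h (lookup f \<rho>) < inverse (2 ^ N f)"
      by (auto simp: V_def)
    thus ?thesis
      by (intro exI[of _ "inverse (2 ^ N f)"]) (auto simp: V_def dist_fls_less_iff intro!: bexI[of _ f])
  qed
  hence "open V" unfolding open_fls_def by blast
  moreover have "U = (\<lambda>f. lookup f \<rho>) -` V \<inter> series_space \<rho> A"
  proof (intro equalityI subsetI IntI)
    fix f assume "f \<in> U"
    thus "f \<in> (\<lambda>f. lookup f \<rho>) -` V" by (auto simp: V_def intro!: bexI[of _ f])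
  next
    fix g assume "g \<in> (\<lambda>f. lookup f \<rho>) -` V \<inter> series_space \<rho> A"
    then obtain f where f: "f \<in> U" "dist (lookup g \<rho>) (lookup f \<rho>) < inverse (2 ^ N f)"
      "g \<in> series_space \<rho> A" by (auto simp: V_def dist_commute)
    hence "vanish \<rho> (N f) (g - f)" by (simp add: dist_fls_less_iff vanish_def lookup_minus)
    thus "g \<in> U" using N f by blast
  qed (use U in blast)
  ultimately show "openin (series_topology \<rho> A) U"
    by (auto simp: openin_pullback_topology)
qed

lemma topspace_series_topology [simp]: "topspace (series_topology \<rho> A) = series_space \<rho> A"
  by (simp add: topspace_pullback_topology)

lemma limitin_series_topology:
  "limitin (series_topology \<rho> A) s l F \<longleftrightarrow> l \<in> series_space \<rho> A \<and>
     (\<forall>N. eventually (\<lambda>x. s x \<in> series_space \<rho> A \<and> vanish \<rho> N (s x - l)) F)"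
proof safe
  assume lim: "limitin (series_topology \<rho> A) s l F"
  show l: "l \<in> series_space \<rho> A" using limitin_topspace[OF lim] by simp
  fix N
  define U where "U = {g \<in> series_space \<rho> A. vanish \<rho> N (g - l)}"
  have "openin (series_topology \<rho> A) U"
    unfolding openin_series_topology
  proof (intro conjI ballI exI impI)
    fix f g assume "f \<in> U" "g \<in> series_space \<rho> A" "vanish \<rho> N (g - f)"
    thus "g \<in> U" using vanish_add[of \<rho> N "g - f" "f - l"] by (simp add: U_def)
  qed (auto simp: U_def)
  moreover have "l \<in> U" using l by (simp add: U_def)
  ultimately have "eventually (\<lambda>x. s x \<in> U) F" using lim by (simp add: limitin_def)
  thus "eventually (\<lambda>x. s x \<in> series_space \<rho> A \<and> vanish \<rho> N (s x - l)) F" by (simp add: U_def)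
next
  assume l: "l \<in> series_space \<rho> A"
    and ev: "\<forall>N. eventually (\<lambda>x. s x \<in> series_space \<rho> A \<and> vanish \<rho> N (s x - l)) F"
  have "eventually (\<lambda>x. s x \<in> U) F" if "openin (series_topology \<rho> A) U" "l \<in> U" for U
  proof -
    from that obtain N where "\<And>g. g \<in> series_space \<rho> A \<Longrightarrow> vanish \<rho> N (g - l) \<Longrightarrow> g \<in> U"
      unfolding openin_series_topology by blast
    thus ?thesis using ev[rule_format, of N] by (auto elim: eventually_mono)
  qed
  thus "limitin (series_topology \<rho> A) s l F" using l by (simp add: limitin_def)
qed

text \<open>By additivity \<phi> g - \<phi> f = \<phi> (g - f), so a map that does not lower the
  order of vanishing is continuous everywhere.\<close>

lemma continuous_series_topology:
  assumes maps: "\<And>f. f \<in> series_space \<rho> A \<Longrightarrow> \<phi> f \<in> series_space \<rho> A"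
    and add: "\<And>f g. f \<in> series_space \<rho> A \<Longrightarrow> g \<in> series_space \<rho> A \<Longrightarrow> \<phi> (f + g) = \<phi> f + \<phi> g"
    and van: "\<And>f N. f \<in> series_space \<rho> A \<Longrightarrow> vanish \<rho> N f \<Longrightarrow> vanish \<rho> N (\<phi> f)"
  shows "continuous_map (series_topology \<rho> A) (series_topology \<rho> A) \<phi>"
proof -
  have "openin (series_topology \<rho> A) {f \<in> series_space \<rho> A. \<phi> f \<in> U}"
    if U: "openin (series_topology \<rho> A) U" for U
    unfolding openin_series_topology
  proof (intro conjI ballI)
    fix f assume f: "f \<in> {f \<in> series_space \<rho> A. \<phi> f \<in> U}"
    with U obtain N where N: "\<And>g. g \<in> series_space \<rho> A \<Longrightarrow> vanish \<rho> N (g - \<phi> f) \<Longrightarrow> g \<in> U"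
      unfolding openin_series_topology by blast
    show "\<exists>N. \<forall>g\<in>series_space \<rho> A. vanish \<rho> N (g - f) \<longrightarrow> g \<in> {f \<in> series_space \<rho> A. \<phi> f \<in> U}"
    proof (intro exI[of _ N] ballI impI)
      fix g assume g: "g \<in> series_space \<rho> A" "vanish \<rho> N (g - f)"
      have d: "g - f \<in> series_space \<rho> A" using f g by (simp add: series_space_diff)
      have "\<phi> g = \<phi> (g - f) + \<phi> f" using add[OF d, of f] f by simp
      hence "\<phi> g - \<phi> f = \<phi> (g - f)" by simp
      hence "vanish \<rho> N (\<phi> g - \<phi> f)" using van[OF d g(2)] by simp
      thus "g \<in> {f \<in> series_space \<rho> A. \<phi> f \<in> U}" using N maps g by simp
    qed
  qed auto
  thus ?thesis using maps by (simp add: continuous_map_def)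
qed

text \<open>This reduces linearity over all constants to elements of k(z^p)((x^p)). The zero series
  carries no information about c, so each application treats f = 0 apart.\<close>

lemma tconstants_series_space:
  assumes "c \<in> tconstants" "f \<in> series_space \<rho> A" "c * f \<in> series_space \<rho> B" "f \<noteq> 0"
    and p: "CHAR('k) > 0"
  shows "\<exists>g\<in>fls_pth. c = single (0::'k::field) g"
proof -
  have f: "f = single \<rho> (lookup f \<rho>)" and cf: "c * f = single \<rho> (lookup (c * f) \<rho>)"
    using series_spaceD(4) assms(2,3) by blast+
  have "lookup f \<rho> \<noteq> 0" using f assms(4) by (metis single_zero)
  moreover have "c * single \<rho> (lookup f \<rho>) = single \<rho> (lookup (c * f) \<rho>)"
    using f cf by simp
  ultimately show ?thesis using tconstants_pure[OF assms(1) _ _ p] by blast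
qed

section \<open>The geometric series of a linear map that raises the order in x\<close>

locale raising =
  fixes \<rho> :: "'k::field" and A :: "nat \<Rightarrow> expo set" and U :: "'k tring \<Rightarrow> 'k tring"
  assumes maps: "f \<in> series_space \<rho> A \<Longrightarrow> U f \<in> series_space \<rho> A"
    and C_lin: "C_linear_on (series_space \<rho> A) U"
    and raise: "f \<in> series_space \<rho> A \<Longrightarrow> vanish \<rho> N f \<Longrightarrow> vanish \<rho> (Suc N) (U f)"
    and p: "CHAR('k) > 0"
begin

abbreviation F where "F \<equiv> series_space \<rho> A"

definition u where "u f = f - U f"
definition v where "v f = topological_sum (series_topology \<rho> A) (\<lambda>k. (U ^^ k) f)"
definition part where "part n f = (\<Sum>k<n. (U ^^ k) f)"

lemma add: "f \<in> F \<Longrightarrow> g \<in> F \<Longrightarrow> U (f + g) = U f + U g"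
  and scale: "f \<in> F \<Longrightarrow> U (tconst a * f) = tconst a * U f"
  and C_mult: "c \<in> tconstants \<Longrightarrow> f \<in> F \<Longrightarrow> c * f \<in> F \<Longrightarrow> U (c * f) = c * U f"
  using C_lin by (auto simp: C_linear_on_def)

lemma diff: "f \<in> F \<Longrightarrow> g \<in> F \<Longrightarrow> U (f - g) = U f - U g"
  using add[of "f - g" g] by (simp add: series_space_diff)

lemma U_0 [simp]: "U 0 = 0"
  using diff[of 0 0] by simp

lemma pow_maps: "f \<in> F \<Longrightarrow> (U ^^ k) f \<in> F"
  by (induction k) (simp_all add: maps)

lemma pow_vanish: "f \<in> F \<Longrightarrow> vanish \<rho> N f \<Longrightarrow> vanish \<rho> (N + k) ((U ^^ k) f)"
  by (induction k) (simp_all add: raise pow_maps)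

lemma part_maps: "f \<in> F \<Longrightarrow> part n f \<in> F"
  unfolding part_def by (intro series_space_sum pow_maps)

lemma vanish_part_diff:
  assumes "f \<in> F" "n \<le> m"
  shows "vanish \<rho> n (part m f - part n f)"
proof -
  have "part m f = part n f + (\<Sum>k=n..<m. (U ^^ k) f)"
    unfolding part_def lessThan_atLeast0 by (rule sum.atLeastLessThan_concat[symmetric]) (use assms in auto)
  moreover have "vanish \<rho> n (\<Sum>k=n..<m. (U ^^ k) f)"
  proof (rule vanish_sum)
    fix k assume "k \<in> {n..<m}"
    thus "vanish \<rho> n ((U ^^ k) f)"
      by (intro vanish_le[OF pow_vanish[OF assms(1) vanish_series_space[OF assms(1)], of k]]) simp
  qed
  ultimately show ?thesis by simp
qed

lemma u_maps: "f \<in> F \<Longrightarrow> u f \<in> F"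
  unfolding u_def by (intro series_space_diff maps)

lemma u_add: "f \<in> F \<Longrightarrow> g \<in> F \<Longrightarrow> u (f + g) = u f + u g"
  by (simp add: u_def add)

lemma u_part: "f \<in> F \<Longrightarrow> u (part n f) = f - (U ^^ n) f"
proof (induction n)
  case (Suc n)
  have "u (part (Suc n) f) = u (part n f) + u ((U ^^ n) f)"
    using Suc.prems by (simp add: part_def pow_maps u_add series_space_sum)
  thus ?case using Suc by (simp add: u_def)
qed (simp add: part_def u_def)

text \<open>The k-th power of U has order at least k on F, so the coefficient of x^k no longer
  changes from the partial sum with index k + 1 on and can be read off there.\<close>

lemma limit_ex:
  assumes f: "f \<in> F"
  shows "\<exists>w\<in>F. \<forall>n. vanish \<rho> n (part n f - w)"
proof -
  have "lookup (part (Suc k) f) \<rho> $$ int k \<in> zspan (A k)" for k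
    by (rule series_spaceD(3)[OF part_maps[OF f]])
  from series_space_ex[where a = "\<lambda>k. lookup (part (Suc k) f) \<rho> $$ int k", OF this, of \<rho>]
  obtain w where w: "w \<in> F" "\<And>k. lookup w \<rho> $$ int k = lookup (part (Suc k) f) \<rho> $$ int k" by blast
  have "lookup (part n f - w) \<rho> $$ i = 0" if i: "i < int n" for n i
  proof (cases "i < 0")
    case False
    define k where "k = nat i"
    have k: "i = int k" using False by (simp add: k_def)
    have "vanish \<rho> (Suc k) (part n f - part (Suc k) f)"
      by (rule vanish_part_diff[OF f]) (use i k in simp)
    thus ?thesis by (simp add: k w lookup_minus vanish_def)
  qed (use series_spaceD(2)[OF w(1)] series_spaceD(2)[OF part_maps[OF f]] in \<open>simp add: lookup_minus\<close>)
  thus ?thesis using w(1) by (intro bexI[of _ w]) (auto simp: vanish_def)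
qed

text \<open>The topology is pulled back along the t^\<rho> component, and this component separates
  the elements of F. Uniqueness is what gives the \<open>THE\<close> in
  \<open>topological_sum\<close> its value.\<close>

lemma limit_unique:
  assumes "limitin (series_topology \<rho> A) s w sequentially" "limitin (series_topology \<rho> A) s w' sequentially"
  shows "w = w'"
proof (rule series_space_eq_vanish)
  show "w \<in> F" "w' \<in> F" using assms by (simp_all add: limitin_series_topology)
  fix N
  have "eventually (\<lambda>n. vanish \<rho> N (s n - w) \<and> vanish \<rho> N (s n - w')) sequentially"
    using assms[unfolded limitin_series_topology, THEN conjunct2, rule_format, of N]
    by eventually_elim simp
  then obtain n where "vanish \<rho> N (s n - w)" "vanish \<rho> N (s n - w')"
    by (auto simp: eventually_sequentially)
  from vanish_diff[OF this(2,1)] show "vanish \<rho> N (w - w')" by simp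
qed

lemma
  assumes f: "f \<in> F"
  shows v_maps: "v f \<in> F" and vanish_v: "vanish \<rho> n (part n f - v f)"
    and limit_v: "limitin (series_topology \<rho> A) (\<lambda>n. \<Sum>k<n. (U ^^ k) f) (v f) sequentially"
proof -
  obtain w where w: "w \<in> F" "\<And>n. vanish \<rho> n (part n f - w)" using limit_ex[OF f] by blast
  have lim: "limitin (series_topology \<rho> A) (\<lambda>n. part n f) w sequentially"
    unfolding limitin_series_topology eventually_sequentially
    using w part_maps[OF f] vanish_le by blast
  have "v f = w" unfolding v_def topological_sum_def part_def[symmetric]
    by (rule the_equality, rule lim) (rule limit_unique[OF _ lim])
  thus "v f \<in> F" "vanish \<rho> n (part n f - v f)"
    "limitin (series_topology \<rho> A) (\<lambda>n. \<Sum>k<n. (U ^^ k) f) (v f) sequentially"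
    using w lim by (simp_all add: part_def)
qed

lemma u_vanish: "f \<in> F \<Longrightarrow> vanish \<rho> N f \<Longrightarrow> vanish \<rho> N (u f)"
  unfolding u_def using vanish_le[OF raise, of f N N] by (simp add: vanish_diff)

lemma u_diff: "f \<in> F \<Longrightarrow> g \<in> F \<Longrightarrow> u (f - g) = u f - u g"
  by (simp add: u_def diff)

lemma pow_vanish': "f \<in> F \<Longrightarrow> vanish \<rho> n ((U ^^ n) f)"
  using pow_vanish[of f 0 n] vanish_series_space[of f \<rho> A] by simp

lemma u_v:
  assumes f: "f \<in> F"
  shows "u (v f) = f"
proof (rule series_space_eq_vanish[OF u_maps[OF v_maps[OF f]] f])
  fix n
  have "vanish \<rho> n (u (part n f - v f))"
    using f by (intro u_vanish series_space_diff part_maps v_maps vanish_v)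
  hence "vanish \<rho> n (f - (U ^^ n) f - u (v f))"
    using f by (simp add: u_diff part_maps v_maps u_part)
  from vanish_add[OF this pow_vanish'[OF f]] have "vanish \<rho> n (f - u (v f))" by simp
  from vanish_diff[OF vanish_0 this] show "vanish \<rho> n (u (v f) - f)" by simp
qed

text \<open>A fixed point of U is fixed by all its powers and therefore has infinite order in
  x.\<close>

lemma u_inj:
  assumes f: "f \<in> F" and 0: "u f = 0"
  shows "f = 0"
proof (rule series_space_eq_vanish[OF f series_space_0])
  fix N
  have "f = U f" using 0 by (simp add: u_def)
  hence "(U ^^ N) f = f" by (induction N) simp_all
  thus "vanish \<rho> N (f - 0)" using pow_vanish'[OF f, of N] by simp
qed

lemma v_u:
  assumes f: "f \<in> F"
  shows "v (u f) = f"
proof -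
  have "u (v (u f) - f) = 0" using u_v[OF u_maps[OF f]] f by (simp add: u_diff v_maps u_maps)
  with u_inj[of "v (u f) - f"] f show ?thesis by (simp add: series_space_diff v_maps u_maps)
qed

text \<open>Transfers identities from u to v: a candidate for a value of v is confirmed by applying
  u, which avoids limits.\<close>

lemma v_eqI: "g \<in> F \<Longrightarrow> u g = f \<Longrightarrow> v f = g"
  using v_u by blast

lemma u_C_linear: "C_linear_on F u"
  unfolding C_linear_on_def u_def
  by (intro conjI ballI allI impI) (simp_all add: add scale C_mult right_diff_distrib)

lemma v_add: "f \<in> F \<Longrightarrow> g \<in> F \<Longrightarrow> v (f + g) = v f + v g"
  by (rule v_eqI) (simp_all add: series_space_add v_maps u_add u_v)

lemma v_scale: "f \<in> F \<Longrightarrow> v (tconst a * f) = tconst a * v f"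
  using u_C_linear by (intro v_eqI) (simp_all add: series_space_scale v_maps u_v C_linear_on_def)

lemma v_0 [simp]: "v 0 = 0"
  by (rule v_eqI) (simp_all add: u_def)

text \<open>Both claims need one induction: linearity of U applies to the k-th iterate only if its
  product with c lies in F, and that membership comes from the equality with the k-th iterate of c
  f.\<close>

lemma pow_C_mult:
  assumes "c \<in> tconstants" "f \<in> F" "c * f \<in> F"
  shows "(U ^^ k) (c * f) = c * (U ^^ k) f" "c * (U ^^ k) f \<in> F"
proof (induction k)
  case (Suc k)
  have "U (c * (U ^^ k) f) = c * U ((U ^^ k) f)"
    by (rule C_mult[OF assms(1) pow_maps[OF assms(2)] Suc(2)])
  thus "(U ^^ Suc k) (c * f) = c * (U ^^ Suc k) f" using Suc(1) by simp
  thus "c * (U ^^ Suc k) f \<in> F" using pow_maps[OF assms(3), of "Suc k"] by simp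
qed (use assms in simp_all)

text \<open>Here \<open>c * v f\<close> is not known to lie in \<open>F\<close> beforehand, so the series is compared term by term.\<close>

lemma v_C_mult:
  assumes c: "c \<in> tconstants" and f: "f \<in> F" and cf: "c * f \<in> F"
  shows "v (c * f) = c * v f"
proof (cases "f = 0")
  case False
  from tconstants_series_space[OF c f cf False p] obtain g where g: "c = single 0 g" by blast
  have eq: "part n (c * f) = c * part n f" for n
    unfolding part_def sum_distrib_left by (intro sum.cong refl pow_C_mult(1) c f cf)
  have cl: "lookup (c * h) \<sigma> = g * lookup h \<sigma>" for h \<sigma> by (simp add: g)
  have "lookup (v (c * f)) \<rho> $$ m = lookup (c * v f) \<rho> $$ m" for m
  proof -
    define d where "d = fls_subdegree g"
    \<comment> \<open>Since g may have a pole, d can be negative. Coefficient m of g times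
      (\<open>part n f - v f\<close>) involves only coefficients of degree at most m - d of the
      second factor, which vanish once n > m - d. The bound n > m serves the tail of
      \<open>v (c * f)\<close>.\<close>
    define n where "n = nat (max (m - d + 1) (m + 1))"
    have mn: "m < int n" "m - int n < d" unfolding n_def by linarith+
    have 1: "lookup (part n f - v f) \<rho> $$ i = 0" if "i < int n" for i
      using vanish_v[OF f, of n] that by (simp add: vanish_def)
    have "lookup (c * (part n f - v f)) \<rho> $$ m =
      (\<Sum>i=d..m - int n. g $$ i * lookup (part n f - v f) \<rho> $$ (m - i))"
      unfolding cl by (rule fls_times_nth_bounds) (auto simp: d_def 1)
    also have "\<dots> = 0" using mn(2) by simp
    finally have "lookup (part n (c * f)) \<rho> $$ m = lookup (c * v f) \<rho> $$ m"
      by (simp add: eq right_diff_distrib lookup_minus)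
    moreover have "lookup (part n (c * f) - v (c * f)) \<rho> $$ m = 0"
      using vanish_v[OF cf, of n] mn by (simp add: vanish_def)
    ultimately show ?thesis by (simp add: lookup_minus)
  qed
  moreover have "lookup (v (c * f)) \<sigma> = lookup (c * v f) \<sigma>" if "\<sigma> \<noteq> \<rho>" for \<sigma>
    using that series_spaceD(1)[OF v_maps[OF f]] series_spaceD(1)[OF v_maps[OF cf]] by (simp add: cl)
  ultimately have "lookup (v (c * f)) \<sigma> = lookup (c * v f) \<sigma>" for \<sigma>
    by (cases "\<sigma> = \<rho>") (auto intro!: fls_eqI)
  thus ?thesis by (rule poly_mapping_eqI)
qed simp

lemma v_vanish:
  assumes "f \<in> F" "vanish \<rho> N f"
  shows "vanish \<rho> N (v f)"
proof -
  have "vanish \<rho> N (part N f)" unfolding part_def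
    by (rule vanish_sum, rule vanish_le[OF pow_vanish[OF assms]]) simp
  from vanish_diff[OF this vanish_v[OF assms(1)]] show ?thesis by simp
qed

lemma u_automorphism: "cont_C_automorphism (series_topology \<rho> A) u"
  unfolding cont_C_automorphism_def topspace_series_topology
proof (intro conjI)
  show "bij_betw u F F"
    by (rule bij_betw_byWitness[of _ v]) (auto simp: v_u u_v u_maps v_maps)
  show "continuous_map (series_topology \<rho> A) (series_topology \<rho> A) u"
    by (rule continuous_series_topology) (auto intro: u_maps u_vanish simp: u_add)
qed (rule u_C_linear)

lemma v_automorphism: "cont_C_automorphism (series_topology \<rho> A) v"
  unfolding cont_C_automorphism_def topspace_series_topology
proof (intro conjI)
  show "bij_betw v F F"
    by (rule bij_betw_byWitness[of _ u]) (auto simp: v_u u_v u_maps v_maps)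
  show "C_linear_on F v"
    by (simp add: C_linear_on_def v_add v_scale v_C_mult)
  show "continuous_map (series_topology \<rho> A) (series_topology \<rho> A) v"
    by (rule continuous_series_topology) (auto intro: v_maps v_vanish simp: v_add)
qed

end

subsection \<open>The function space of an exponent\<close>

text \<open>The exponents permitted at x^k in F x: those of A_{k-1} if k > 0, and none if k = 0.
  Summing over i < k covers both cases.\<close>

definition lower_index :: "'k::field fps poly \<Rightarrow> 'k \<Rightarrow> nat \<Rightarrow> expo set" where
  "lower_index L \<rho> k =
     {\<alpha>\<in>steep CHAR('k). lookup \<alpha> 0 < (\<Sum>i<k. expo_mult L (\<rho> + of_nat i))}"

lemma admissible_eq: "admissible L \<rho> k = lower_index L \<rho> (Suc k)"
  by (auto simp: admissible_def lower_index_def mult_sum_def steep_def lessThan_Suc_atMost)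

lemma lower_index_mono: "j \<le> k \<Longrightarrow> lower_index L \<rho> j \<subseteq> lower_index L \<rho> k"
  unfolding lower_index_def
  by (auto intro: less_le_trans sum_mono2)

lemma lower_index_steep: "lower_index L \<rho> k \<subseteq> steep CHAR('k)" for \<rho> :: "'k::field"
  by (auto simp: lower_index_def)

lemma fun_space_eq: "fun_space L \<rho> = series_space \<rho> (admissible L \<rho>)"
proof (intro equalityI subsetI)
  fix f assume f: "f \<in> series_space \<rho> (admissible L \<rho>)"
  have "\<exists>P. lookup f \<rho> $$ int k = Fract P 1 \<and> keys P \<subseteq> admissible L \<rho> k" for k
    using series_spaceD(3)[OF f, of k] by (auto simp: zspan_def)
  then obtain P where P: "\<And>k. lookup f \<rho> $$ int k = Fract (P k) 1" "\<And>k. keys (P k) \<subseteq> admissible L \<rho> k"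
    by metis
  have "single \<rho> (fps_to_fls (Abs_fps (\<lambda>k. Fract (P k) 1))) \<in> series_space \<rho> (admissible L \<rho>)"
    using zspanI[OF P(2)] by (simp add: series_space_iff lookup_single)
  from series_space_eqI[OF f this] P(1)
  have "f = single \<rho> (fps_to_fls (Abs_fps (\<lambda>k. Fract (P k) 1)))" by simp
  thus "f \<in> fun_space L \<rho>" using P(2) unfolding fun_space_def by blast
next
  fix f assume "f \<in> fun_space L \<rho>"
  then obtain P where "f = single \<rho> (fps_to_fls (Abs_fps (\<lambda>k. Fract (P k) 1)))"
    "\<And>k. keys (P k) \<subseteq> admissible L \<rho> k"
    unfolding fun_space_def by blast
  thus "f \<in> series_space \<rho> (admissible L \<rho>)"
    by (simp add: series_space_iff lookup_single zspanI)
qed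

lemma xadic_topology_eq: "xadic_topology L \<rho> = series_topology \<rho> (admissible L \<rho>)"
  by (simp add: xadic_topology_def fun_space_eq)

lemma series_space_tX:
  assumes "f \<in> series_space \<rho> A" "\<And>k. A k \<subseteq> B (Suc k)"
  shows "tX * f \<in> series_space \<rho> B"
  unfolding series_space_iff
proof (intro conjI allI impI)
  fix \<sigma> assume "\<sigma> \<noteq> \<rho>"
  thus "lookup (tX * f) \<sigma> = 0" using series_spaceD(1)[OF assms(1)] by (intro fls_eqI) simp
next
  fix n :: int assume "n < 0"
  thus "lookup (tX * f) \<rho> $$ n = 0" using series_spaceD(2)[OF assms(1)] by simp
next
  fix k
  show "lookup (tX * f) \<rho> $$ int k \<in> zspan (B k)"
    using series_spaceD(2)[OF assms(1), of "-1"] series_spaceD(3)[OF assms(1), of "k - 1"]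
      zspan_mono[OF assms(2)[of "k - 1"]]
    by (cases k) auto
qed

lemma fun_space_tX_eq: "(\<lambda>f. f * tX) ` fun_space L \<rho> = series_space \<rho> (lower_index L \<rho>)"
  unfolding fun_space_eq
proof (intro equalityI subsetI)
  fix g assume "g \<in> (\<lambda>f. f * tX) ` series_space \<rho> (admissible L \<rho>)"
  thus "g \<in> series_space \<rho> (lower_index L \<rho>)"
    by (auto simp: mult.commute[of _ tX] admissible_eq intro!: series_space_tX)
next
  fix g assume g: "g \<in> series_space \<rho> (lower_index L \<rho>)"
  have "lookup g \<rho> $$ int (Suc k) \<in> zspan (admissible L \<rho> k)" for k
    unfolding admissible_eq by (rule series_spaceD(3)[OF g])
  from series_space_ex[where a = "\<lambda>k. lookup g \<rho> $$ int (Suc k)", OF this, of \<rho>]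
  obtain f where f: "f \<in> series_space \<rho> (admissible L \<rho>)"
    "\<And>k. lookup f \<rho> $$ int k = lookup g \<rho> $$ int (Suc k)" by blast
  have "tX * f \<in> series_space \<rho> (lower_index L \<rho>)"
    using f(1) by (rule series_space_tX) (simp add: admissible_eq)
  moreover have "lookup (tX * f) \<rho> $$ int k = lookup g \<rho> $$ int k" for k
  proof (cases k)
    case 0
    \<comment> \<open>The bound on the first entry is an empty sum, so no exponent is permitted: g
      has no constant term and can be divided by x.\<close>
    have "lookup g \<rho> $$ int 0 \<in> zspan {}"
      using series_spaceD(3)[OF g, of 0] by (simp add: lower_index_def)
    hence "lookup g \<rho> $$ 0 = 0" by (auto simp: zspan_def Zero_fract_def)
    thus ?thesis using 0 series_spaceD(2)[OF f(1), of "-1"] by simp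
  qed (use f(2) in simp)
  ultimately have "tX * f = g" by (rule series_space_eqI[OF _ g])
  thus "g \<in> (\<lambda>f. f * tX) ` series_space \<rho> (admissible L \<rho>)"
    using f(1) by (auto simp: mult.commute)
qed

abbreviation H_exponents :: "'k::field fps poly \<Rightarrow> 'k \<Rightarrow> nat \<Rightarrow> expo set" where
  "H_exponents L \<rho> k \<equiv> {\<alpha>. (k, \<alpha>) \<in> H_index L \<rho>}"

lemma fls_sum_nth: "sum f I $$ n = (\<Sum>i\<in>I. f i $$ n)"
  by (induction I rule: infinite_finite_induct) simp_all

lemma lookup_monomial:
  "lookup (tconst c * tmonom \<rho> k \<alpha>) \<sigma> $$ n =
     (if \<sigma> = \<rho> \<and> n = int k then Fract (single \<alpha> c) 1 else 0)"
  by (auto simp: tmonom_def lookup_single when_def zconst_def zmonom_def mult_single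
      fls_X_power_times_conv_shift)

lemma lookup_monomial_sum:
  "lookup (\<Sum>(k, \<alpha>)\<in>I. tconst (c k \<alpha>) * tmonom \<rho> k \<alpha>) \<sigma> $$ n =
     (\<Sum>(k, \<alpha>)\<in>I. if \<sigma> = \<rho> \<and> n = int k then Fract (single \<alpha> (c k \<alpha>)) 1 else 0)"
  by (simp add: lookup_sum fls_sum_nth case_prod_unfold lookup_monomial del: lookup_tconst_times)

lemma monomial_sum_series_space:
  assumes "I \<subseteq> H_index L \<rho>"
  shows "(\<Sum>(k, \<alpha>)\<in>I. tconst (c k \<alpha>) * tmonom \<rho> k \<alpha>) \<in> series_space \<rho> (H_exponents L \<rho>)"
proof (rule series_space_sum, clarify)
  fix k \<alpha> assume "(k, \<alpha>) \<in> I"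
  hence "keys (single \<alpha> (c k \<alpha>)) \<subseteq> H_exponents L \<rho> k" using assms by auto
  hence "Fract (single \<alpha> (c k \<alpha>)) 1 \<in> zspan (H_exponents L \<rho> k)" by (rule zspanI)
  thus "tconst (c k \<alpha>) * tmonom \<rho> k \<alpha> \<in> series_space \<rho> (H_exponents L \<rho>)"
    by (auto simp: series_space_iff lookup_monomial simp del: lookup_tconst_times intro!: fls_eqI)
qed

lemma H_exponents_admissible: "H_exponents L \<rho> k \<subseteq> admissible L \<rho> k"
  by (auto simp: H_index_def)

lemma H_series_admissible:
  assumes "f \<in> series_space \<rho> (H_exponents L \<rho>)"
  shows "f \<in> series_space \<rho> (admissible L \<rho>)"
  using assms by (rule series_space_mono) (rule H_exponents_admissible)

text \<open>Convergence means that each coefficient in x is eventually constant. A limit therefore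
  has in each degree the exponents of some finite sum; conversely the coefficients of the
  polynomials P k are the coordinates of a convergent sum.\<close>

lemma H_space_eq: "H_space L \<rho> = series_space \<rho> (H_exponents L \<rho>)"
proof (intro equalityI subsetI)
  fix f assume "f \<in> H_space L \<rho>"
  then obtain c where lim: "limitin (series_topology \<rho> (admissible L \<rho>))
     (\<lambda>I. \<Sum>(k, \<alpha>)\<in>I. tconst (c k \<alpha>) * tmonom \<rho> k \<alpha>) f (finite_subsets_at_top (H_index L \<rho>))"
    by (auto simp: H_space_def xadic_topology_eq)
  hence f: "f \<in> series_space \<rho> (admissible L \<rho>)" by (simp add: limitin_series_topology)
  have "lookup f \<rho> $$ int k \<in> zspan (H_exponents L \<rho> k)" for k
  proof -
    have "eventually (\<lambda>I. vanish \<rho> (Suc k) ((\<Sum>(k, \<alpha>)\<in>I. tconst (c k \<alpha>) * tmonom \<rho> k \<alpha>) - f))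
        (finite_subsets_at_top (H_index L \<rho>))"
      using lim unfolding limitin_series_topology by (blast intro: eventually_mono)
    then obtain I where I: "I \<subseteq> H_index L \<rho>"
      "vanish \<rho> (Suc k) ((\<Sum>(k, \<alpha>)\<in>I. tconst (c k \<alpha>) * tmonom \<rho> k \<alpha>) - f)"
      unfolding eventually_finite_subsets_at_top by blast
    have eq: "lookup f \<rho> $$ int k = lookup (\<Sum>(k, \<alpha>)\<in>I. tconst (c k \<alpha>) * tmonom \<rho> k \<alpha>) \<rho> $$ int k"
      using I(2) by (simp add: vanish_def lookup_minus)
    show ?thesis unfolding eq by (rule series_spaceD(3)[OF monomial_sum_series_space[OF I(1)]])
  qed
  thus "f \<in> series_space \<rho> (H_exponents L \<rho>)" using f by (simp add: series_space_iff)
next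
  fix f assume f: "f \<in> series_space \<rho> (H_exponents L \<rho>)"
  have "\<exists>P. lookup f \<rho> $$ int k = Fract P 1 \<and> keys P \<subseteq> H_exponents L \<rho> k" for k
    using series_spaceD(3)[OF f, of k] by (auto simp: zspan_def)
  then obtain P where P: "\<And>k. lookup f \<rho> $$ int k = Fract (P k) 1" "\<And>k. keys (P k) \<subseteq> H_exponents L \<rho> k"
    by metis
  define s where "s I = (\<Sum>(k, \<alpha>)\<in>I. tconst (lookup (P k) \<alpha>) * tmonom \<rho> k \<alpha>)" for I
  have sub: "series_space \<rho> (H_exponents L \<rho>) \<subseteq> series_space \<rho> (admissible L \<rho>)"
    using H_series_admissible by blast
  have "limitin (series_topology \<rho> (admissible L \<rho>)) s f (finite_subsets_at_top (H_index L \<rho>))"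
    unfolding limitin_series_topology eventually_finite_subsets_at_top
  proof (intro conjI allI)
    fix N
    \<comment> \<open>The monomials below x^N with nonzero coefficient, finitely many. Index sets
      that contain J differ below x^N only by zero terms.\<close>
    define J where "J = (SIGMA k:{..<N}. keys (P k))"
    have "s I \<in> series_space \<rho> (admissible L \<rho>) \<and> vanish \<rho> N (s I - f)"
      if I: "finite I" "J \<subseteq> I" "I \<subseteq> H_index L \<rho>" for I
    proof
      have sI: "s I \<in> series_space \<rho> (H_exponents L \<rho>)"
        unfolding s_def by (rule monomial_sum_series_space[OF I(3)])
      thus "s I \<in> series_space \<rho> (admissible L \<rho>)" using sub by blast
      have "lookup (s I) \<rho> $$ n = lookup f \<rho> $$ n" if n: "n < int N" for n
      proof (cases "n < 0")
        case True
        thus ?thesis using series_spaceD(2)[OF f] series_spaceD(2)[OF sI] by simp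
      next
        case False
        define k where "k = nat n"
        have k: "n = int k" "k < N" using False n by (simp_all add: k_def)
        have "lookup (s I) \<rho> $$ n = (\<Sum>(j, \<alpha>)\<in>I. if k = j then Fract (single \<alpha> (lookup (P j) \<alpha>)) 1 else 0)"
          by (simp add: s_def lookup_monomial_sum k(1))
        also have "\<dots> = (\<Sum>(j, \<alpha>)\<in>{k} \<times> keys (P k). if k = j then Fract (single \<alpha> (lookup (P j) \<alpha>)) 1 else 0)"
          using I k(2) by (intro sum.mono_neutral_right)
            (auto simp: J_def in_keys_iff Zero_fract_def[symmetric] split: if_splits)
        also have "\<dots> = (\<Sum>\<alpha>\<in>keys (P k). Fract (single \<alpha> (lookup (P k) \<alpha>)) 1)"
          by (simp add: sum.cartesian_product[symmetric])
        also have "\<dots> = Fract (P k) 1"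
          unfolding Fract_sum[symmetric] by (subst (4) zpoly_eq_sum) (rule refl)
        finally show ?thesis by (simp add: P(1) k(1))
      qed
      thus "vanish \<rho> N (s I - f)" by (simp add: vanish_def lookup_minus)
    qed
    moreover have "finite J" "J \<subseteq> H_index L \<rho>" using P(2) by (auto simp: J_def)
    ultimately show "\<exists>X. finite X \<and> X \<subseteq> H_index L \<rho> \<and> (\<forall>Y. finite Y \<and> X \<subseteq> Y \<and> Y \<subseteq> H_index L \<rho> \<longrightarrow>
        s Y \<in> series_space \<rho> (admissible L \<rho>) \<and> vanish \<rho> N (s Y - f))" by blast
  qed (use f sub in blast)
  thus "f \<in> H_space L \<rho>" unfolding H_space_def xadic_topology_eq s_def
    by (intro CollectI exI[of _ "\<lambda>k. lookup (P k)"])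
qed

section \<open>The initial form and the remainder on the function spaces\<close>

lemma op_act_add: "op_act L (f + g) = op_act L f + op_act L g"
proof -
  have "(tderiv ^^ j) (f + g) = (tderiv ^^ j) f + (tderiv ^^ j) g" for j
    by (induction j) (simp_all add: tderiv_add)
  thus ?thesis by (simp add: op_act_def distrib_left sum.distrib)
qed

lemma op_act_0 [simp]: "op_act L 0 = 0"
  using op_act_add[of L 0 0] by simp

text \<open>At x^k the translated indicial polynomial begins with s^m for m = m_{\<rho>+k}, so
  \<alpha>_1 drops by at least m; this removes the last summand from the admissible bound.\<close>

lemma initial_form_maps:
  fixes \<rho> :: "'k::field"
  assumes f: "f \<in> series_space \<rho> (admissible L \<rho>)" and L: "is_shift L 0" and p: "CHAR('k) > 0"
  shows "op_act (initial_form L) f \<in> series_space \<rho> (lower_index L \<rho>)"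
  unfolding series_space_iff
proof (intro conjI allI impI)
  fix \<sigma> assume "\<sigma> \<noteq> \<rho>"
  thus "lookup (op_act (initial_form L) f) \<sigma> = 0"
    using series_spaceD(1)[OF f] by (intro fls_eqI) (simp add: lookup_op_act_initial_form)
next
  fix n :: int assume "n < 0"
  thus "lookup (op_act (initial_form L) f) \<rho> $$ n = 0"
    using series_spaceD(2)[OF f] by (simp add: lookup_op_act_initial_form)
next
  fix k
  let ?q = "pcompose (indicial_poly L) [:\<rho> + of_nat k, 1:]"
  obtain P where P: "lookup f \<rho> $$ int k = Fract P 1" "keys P \<subseteq> admissible L \<rho> k"
    using series_spaceD(3)[OF f, of k] by (rule zspanE)
  have st: "keys P \<subseteq> steep CHAR('k)" using P(2) lower_index_steep unfolding admissible_eq by blast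
  have "keys (zact ?q P) \<subseteq> lower_index L \<rho> k"
  proof
    fix \<beta> assume "\<beta> \<in> keys (zact ?q P)"
    from zact_keys[OF st this p coeff_pcompose_order(1)[OF indicial_poly_nonzero[OF L]]]
    obtain \<alpha> where "\<beta> \<in> steep CHAR('k)" "\<alpha> \<in> keys P"
      "lookup \<beta> 0 + expo_mult L (\<rho> + of_nat k) \<le> lookup \<alpha> 0"
      by (auto simp: expo_mult_def)
    moreover from this P(2) have "lookup \<alpha> 0 < (\<Sum>i<Suc k. expo_mult L (\<rho> + of_nat i))"
      by (auto simp: admissible_eq lower_index_def)
    ultimately show "\<beta> \<in> lower_index L \<rho> k" by (simp add: lower_index_def)
  qed
  thus "lookup (op_act (initial_form L) f) \<rho> $$ int k \<in> zspan (lower_index L \<rho> k)"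
    by (simp add: lookup_op_act_initial_form P(1) zchi_steep[OF st p] zspanI)
qed

text \<open>Coefficient by coefficient, a preimage is found with \<alpha>_1 below the bound for F x
  plus m_{\<rho>+k}, which is the admissible bound at k, and with weight at least m_{\<rho>+k}; it
  thus meets both conditions defining H.\<close>

lemma initial_form_surj:
  fixes \<rho> :: "'k::field"
  assumes g: "g \<in> series_space \<rho> (lower_index L \<rho>)" and L: "is_shift L 0" and p: "CHAR('k) > 0"
  shows "\<exists>f\<in>series_space \<rho> (H_exponents L \<rho>). op_act (initial_form L) f = g"
proof -
  have "\<exists>q\<in>zspan (H_exponents L \<rho> k). zchi L (\<rho> + of_nat k) q = lookup g \<rho> $$ int k" for k
  proof -
    let ?m = "expo_mult L (\<rho> + of_nat k)" and ?q = "pcompose (indicial_poly L) [:\<rho> + of_nat k, 1:]"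
    obtain Q where Q: "lookup g \<rho> $$ int k = Fract Q 1" "keys Q \<subseteq> lower_index L \<rho> k"
      using series_spaceD(3)[OF g, of k] by (rule zspanE)
    have "\<exists>P. keys P \<subseteq> {\<alpha>\<in>steep CHAR('k). lookup \<alpha> 0 < (\<Sum>i<k. expo_mult L (\<rho> + of_nat i)) + ?m \<and>
        ?m \<le> expo_weight CHAR('k) \<alpha>} \<and> zact ?q P = Q"
      by (rule zact_surj[OF _ _ p])
        (use Q(2) coeff_pcompose_order[OF indicial_poly_nonzero[OF L]] in \<open>auto simp: lower_index_def expo_mult_def\<close>)
    then obtain P where P: "keys P \<subseteq> {\<alpha>\<in>steep CHAR('k). lookup \<alpha> 0 < (\<Sum>i<k. expo_mult L (\<rho> + of_nat i)) + ?m \<and>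
        ?m \<le> expo_weight CHAR('k) \<alpha>}" "zact ?q P = Q" by blast
    have "keys P \<subseteq> steep CHAR('k)" using P(1) by blast
    from zchi_steep[OF this p] have "zchi L (\<rho> + of_nat k) (Fract P 1) = Fract Q 1"
      using P(2) by simp
    moreover have "keys P \<subseteq> H_exponents L \<rho> k"
      using P(1) by (auto simp: H_index_def admissible_eq lower_index_def)
    ultimately show ?thesis using zspanI Q(1) by metis
  qed
  then obtain a where a: "\<And>k. a k \<in> zspan (H_exponents L \<rho> k)"
    "\<And>k. zchi L (\<rho> + of_nat k) (a k) = lookup g \<rho> $$ int k" by metis
  from series_space_ex[where a = a and A = "H_exponents L \<rho>", OF a(1), of \<rho>]
  obtain f where f: "f \<in> series_space \<rho> (H_exponents L \<rho>)" "\<And>k. lookup f \<rho> $$ int k = a k"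
    by blast
  have "op_act (initial_form L) f \<in> series_space \<rho> (lower_index L \<rho>)"
    using H_series_admissible[OF f(1)] L p by (rule initial_form_maps)
  from series_space_eqI[OF this g] have "op_act (initial_form L) f = g"
    by (simp add: lookup_op_act_initial_form f(2) a(2))
  thus ?thesis using f(1) by blast
qed

lemma H_weight_space:
  assumes f: "f \<in> series_space \<rho> (H_exponents L (\<rho>::'k::field))"
  shows "lookup f \<rho> \<in> weight_space L \<rho>"
  unfolding weight_space_def
proof (intro CollectI allI)
  fix n
  show "lookup f \<rho> $$ n \<in> weight_span (expo_mult L (\<rho> + of_int n))"
  proof (cases "n < 0")
    case False
    then obtain k where k: "n = int k" using nonneg_int_cases[of n] by auto
    obtain P where "lookup f \<rho> $$ int k = Fract P 1" "keys P \<subseteq> H_exponents L \<rho> k"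
      using series_spaceD(3)[OF f, of k] by (rule zspanE)
    thus ?thesis by (auto simp: k H_index_def intro!: weight_span_poly)
  qed (use series_spaceD(2)[OF f] in simp)
qed

lemma tser_shift:
  assumes "\<And>i. i < j \<Longrightarrow> a $ i = 0"
  shows "tser a = tconst (a $ j) * tX ^ j + tser (fps_shift (Suc j) a) * tX ^ Suc j"
proof -
  have X: "tX ^ n = single 0 (fps_to_fls (fps_X ^ n))" for n
    by (induction n) (simp_all add: tX_def mult_single fls_times_fps_to_fls)
  have "Abs_fps (\<lambda>i. zconst (a $ i)) = fps_const (zconst (a $ j)) * fps_X ^ j +
      Abs_fps (\<lambda>i. zconst (fps_shift (Suc j) a $ i)) * fps_X ^ Suc j"
  proof (rule fps_ext)
    fix n
    show "Abs_fps (\<lambda>i. zconst (a $ i)) $ n = (fps_const (zconst (a $ j)) * fps_X ^ j +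
      Abs_fps (\<lambda>i. zconst (fps_shift (Suc j) a $ i)) * fps_X ^ Suc j) $ n"
      using assms by (cases n j rule: linorder_cases)
        (simp_all add: fps_X_power_mult_right_nth zconst_0 del: power_Suc)
  qed
  thus ?thesis
    unfolding tser_def X tconst_def fps_const_to_fls[symmetric]
    by (simp add: mult_single single_add[symmetric] fls_times_fps_to_fls del: power_Suc fps_const_to_fls)
qed

text \<open>Shift 0 makes the coefficient of \<partial>^j divisible by x^j. Its lowest term goes to
  the initial form; in the rest one more factor x is split off next to x^j \<partial>^j, which acts
  on F, so that the remainder visibly lands in F x.\<close>

lemma op_act_split:
  assumes "is_shift L 0"
  shows "op_act L f = op_act (initial_form L) f +
    (\<Sum>j\<le>degree L. tser (fps_shift (Suc j) (coeff L j)) * (tX * (tX ^ j * (tderiv ^^ j) f)))"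
proof -
  have "degree (initial_form L) \<le> degree L"
    by (rule degree_le) (simp add: coeff_initial_form coeff_eq_0)
  hence i: "op_act (initial_form L) f = (\<Sum>j\<le>degree L. tconst (coeff L j $ j) * tX ^ j * (tderiv ^^ j) f)"
    by (simp add: op_act_superset coeff_initial_form tser_monomial)
  have "tser (coeff L j) = tconst (coeff L j $ j) * tX ^ j + tser (fps_shift (Suc j) (coeff L j)) * tX ^ Suc j" for j
    by (rule tser_shift) (use assms in \<open>force simp: is_shift_def\<close>)
  hence "tser (coeff L j) * (tderiv ^^ j) f = tconst (coeff L j $ j) * tX ^ j * (tderiv ^^ j) f +
      tser (fps_shift (Suc j) (coeff L j)) * (tX * (tX ^ j * (tderiv ^^ j) f))" for j
    by (simp add: distrib_right mult.assoc)
  thus ?thesis by (simp add: op_act_def[of L] i sum.distrib)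
qed

lemma lookup_tser_times:
  assumes "\<And>n. n < 0 \<Longrightarrow> lookup f \<rho> $$ n = 0"
  shows "lookup (tser b * f) \<rho> $$ n = (\<Sum>i=0..n. zconst (b $ nat i) * lookup f \<rho> $$ (n - i))"
proof -
  have "lookup (tser b * f) \<rho> $$ n = (fps_to_fls (Abs_fps (\<lambda>i. zconst (b $ i))) * lookup f \<rho>) $$ n"
    by (simp add: tser_def)
  also have "\<dots> = (\<Sum>i=0..n - 0. fps_to_fls (Abs_fps (\<lambda>i. zconst (b $ i))) $$ i * lookup f \<rho> $$ (n - i))"
    by (rule fls_times_nth_bounds) (use assms in auto)
  also have "\<dots> = (\<Sum>i=0..n. zconst (b $ nat i) * lookup f \<rho> $$ (n - i))"
    by (rule sum.cong) auto
  finally show ?thesis .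
qed

lemma vanish_tser:
  assumes "vanish \<rho> N f"
  shows "vanish \<rho> N (tser b * f)"
proof -
  have "lookup f \<rho> $$ n = 0" if "n < int N" for n using assms that by (simp add: vanish_def)
  thus ?thesis
    unfolding vanish_def by (auto simp: lookup_tser_times intro!: sum.neutral)
qed

text \<open>Power series only move coefficients to higher powers of x, so exponent sets that grow
  with k are respected.\<close>

lemma series_space_tser:
  assumes f: "f \<in> series_space \<rho> A" and mono: "\<And>j k. j \<le> k \<Longrightarrow> A j \<subseteq> A k"
  shows "tser b * f \<in> series_space \<rho> A"
  unfolding series_space_iff
proof (intro conjI allI impI)
  fix \<sigma> assume "\<sigma> \<noteq> \<rho>"
  thus "lookup (tser b * f) \<sigma> = 0" using series_spaceD(1)[OF f] by (simp add: tser_def)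
next
  fix n :: int assume "n < 0"
  thus "lookup (tser b * f) \<rho> $$ n = 0"
    using series_spaceD(2)[OF f] by (simp add: lookup_tser_times)
next
  fix k
  have "zconst (b $ nat i) * lookup f \<rho> $$ (int k - i) \<in> zspan (A k)" if "i \<in> {0..int k}" for i
  proof -
    have "int k - i = int (nat (int k - i))" using that by simp
    hence "lookup f \<rho> $$ (int k - i) \<in> zspan (A (nat (int k - i)))"
      using series_spaceD(3)[OF f] by metis
    moreover have "A (nat (int k - i)) \<subseteq> A k" using that by (intro mono) (simp, linarith)
    ultimately show ?thesis using zspan_mono zspan_scale by blast
  qed
  thus "lookup (tser b * f) \<rho> $$ int k \<in> zspan (A k)"
    using series_spaceD(2)[OF f] by (subst lookup_tser_times) (simp, rule zspan_sum)
qed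

lemma zfall_0 [simp]: "zfall j c 0 = 0"
  by (induction j) simp_all

lemma series_space_falling:
  fixes \<rho> :: "'k::field"
  assumes f: "f \<in> series_space \<rho> (admissible L \<rho>)" and p: "CHAR('k) > 0"
  shows "tX ^ j * (tderiv ^^ j) f \<in> series_space \<rho> (admissible L \<rho>)"
  unfolding series_space_iff
proof (intro conjI allI impI)
  note lookup_tX_power_times [simp del]
  fix \<sigma> assume "\<sigma> \<noteq> \<rho>"
  thus "lookup (tX ^ j * (tderiv ^^ j) f) \<sigma> = 0"
    using series_spaceD(1)[OF f] by (intro fls_eqI) (simp add: lookup_zfall)
next
  fix n :: int assume "n < 0"
  thus "lookup (tX ^ j * (tderiv ^^ j) f) \<rho> $$ n = 0"
    unfolding lookup_zfall using series_spaceD(2)[OF f] by simp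
next
  fix k
  let ?q = "\<Prod>i<j. [:\<rho> + of_nat k - of_nat i, 1:]"
  obtain P where P: "lookup f \<rho> $$ int k = Fract P 1" "keys P \<subseteq> admissible L \<rho> k"
    using series_spaceD(3)[OF f, of k] by (rule zspanE)
  have st: "keys P \<subseteq> steep CHAR('k)" using P(2) lower_index_steep unfolding admissible_eq by blast
  have "keys (zact ?q P) \<subseteq> admissible L \<rho> k"
  proof
    fix \<beta> assume "\<beta> \<in> keys (zact ?q P)"
    \<comment> \<open>With m = 0 the condition on low coefficients is vacuous: every polynomial in
      the derivation keeps the cone and does not raise \<alpha>_1.\<close>
    from zact_keys[OF st this p, of 0] P(2) show "\<beta> \<in> admissible L \<rho> k"
      by (fastforce simp: admissible_eq lower_index_def)
  qed
  thus "lookup (tX ^ j * (tderiv ^^ j) f) \<rho> $$ int k \<in> zspan (admissible L \<rho> k)"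
    unfolding lookup_zfall P(1) of_int_of_nat_eq zfall_steep[OF st p] by (rule zspanI)
qed

lemma vanish_falling: "vanish \<rho> N f \<Longrightarrow> vanish \<rho> N (tX ^ j * (tderiv ^^ j) f)"
  unfolding vanish_def lookup_zfall by simp

lemma vanish_tX: "vanish \<rho> N f \<Longrightarrow> vanish \<rho> (Suc N) (tX * f)"
  by (simp add: vanish_def)

lemma C_linear_onI:
  assumes "\<And>f g. f \<in> A \<Longrightarrow> g \<in> A \<Longrightarrow> \<phi> (f + g) = \<phi> f + \<phi> g"
    and "\<And>a f. f \<in> A \<Longrightarrow> \<phi> (tconst a * f) = tconst a * \<phi> f"
    and "\<And>c f. c \<in> tconstants \<Longrightarrow> f \<in> A \<Longrightarrow> c * f \<in> A \<Longrightarrow> \<phi> (c * f) = c * \<phi> f"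
  shows "C_linear_on A \<phi>"
  using assms by (auto simp: C_linear_on_def)

section \<open>The right inverse S, the perturbation T, and their composition\<close>

locale shift_zero_operator =
  fixes L :: "'k::field fps poly" and \<rho> :: 'k
  assumes char: "CHAR('k) > 0" and shift: "is_shift L 0"
begin

abbreviation F where "F \<equiv> series_space \<rho> (admissible L \<rho>)"
abbreviation G where "G \<equiv> series_space \<rho> (lower_index L \<rho>)"
abbreviation H where "H \<equiv> series_space \<rho> (H_exponents L \<rho>)"
abbreviation L0 where "L0 \<equiv> op_act (initial_form L)"
abbreviation T where "T \<equiv> \<lambda>f. L0 f - op_act L f"
abbreviation S where "S \<equiv> inv_into H L0"

text \<open>Meant for h coming from a constant times \<open>S f\<close>: elements of H also have
  their component in the weight space, and \<open>L0\<close> is injective there.\<close>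

lemma L0_eqI:
  assumes "h \<in> weight_space L \<rho>" "f \<in> H" "L0 (single \<rho> h) = L0 f"
  shows "single \<rho> h = f"
proof -
  have f: "f = single \<rho> (lookup f \<rho>)" by (rule series_spaceD(4)[OF assms(2)])
  hence "h = lookup f \<rho>"
    using initial_form_inj_weight_space[OF assms(1) H_weight_space[OF assms(2)] _ shift char] assms(3)
    by simp
  thus ?thesis using f by simp
qed

lemma bij_L0: "bij_betw L0 H G"
  unfolding bij_betw_def
proof
  show "inj_on L0 H"
  proof (rule inj_onI)
    fix f g assume fg: "f \<in> H" "g \<in> H" "L0 f = L0 g"
    have f: "f = single \<rho> (lookup f \<rho>)" by (rule series_spaceD(4)[OF fg(1)])
    show "f = g" using L0_eqI[OF H_weight_space[OF fg(1)] fg(2)] fg(3) f by simp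
  qed
  show "L0 ` H = G"
    using initial_form_maps[OF H_series_admissible shift char] initial_form_surj[OF _ shift char]
    by blast
qed

lemma S_maps: "g \<in> G \<Longrightarrow> S g \<in> H"
  using bij_L0 by (metis bij_betw_def inv_into_into)

lemma S_maps_F: "g \<in> G \<Longrightarrow> S g \<in> F"
  by (rule H_series_admissible[OF S_maps])

lemma L0_S: "g \<in> G \<Longrightarrow> L0 (S g) = g"
  using bij_L0 by (metis bij_betw_inv_into_right)

lemma S_eqI: "f \<in> H \<Longrightarrow> L0 f = g \<Longrightarrow> S g = f"
  using bij_L0 by (metis bij_betw_inv_into_left)

lemma op_act_scale: "op_act M (tconst a * f) = tconst a * op_act M f"
  by (rule op_act_mult_const[OF tderiv_tconst])

lemma op_act_C_mult:
  assumes "c \<in> tconstants" "f \<in> series_space \<rho> A" "c * f \<in> series_space \<rho> B"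
  shows "op_act M (c * f) = c * op_act M f"
proof (cases "f = 0")
  case False
  from tconstants_series_space[OF assms False char] obtain g where "g \<in> fls_pth" "c = single 0 g"
    by blast
  thus ?thesis by (simp add: op_act_mult_const[OF tderiv_pth])
qed simp

lemma S_0 [simp]: "S 0 = 0"
  by (rule S_eqI) simp_all

text \<open>Both c (S f) and S (c f) are sent to c f by \<open>L0\<close>. Membership in H is known
  only for the second, whereas the first is placed in the weight space, and \<open>L0_eqI\<close>
  identifies them.\<close>

lemma S_C_linear: "C_linear_on G S"
proof (rule C_linear_onI)
  fix f g assume "f \<in> G" "g \<in> G"
  thus "S (f + g) = S f + S g"
    by (intro S_eqI) (simp_all add: series_space_add S_maps op_act_add L0_S)
next
  fix a f assume "f \<in> G"
  thus "S (tconst a * f) = tconst a * S f"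
    by (intro S_eqI) (simp_all add: series_space_scale S_maps op_act_scale L0_S)
next
  fix c f assume c: "c \<in> tconstants" and f: "f \<in> G" and cf: "c * f \<in> G"
  show "S (c * f) = c * S f"
  proof (cases "f = 0")
    case False
    from tconstants_series_space[OF c f cf False char] obtain g where
      g: "g \<in> fls_pth" "c = single 0 g" by blast
    define h where "h = lookup (S f) \<rho>"
    have Sf: "S f = single \<rho> h" unfolding h_def by (rule series_spaceD(4)[OF S_maps[OF f]])
    have eq: "c * S f = single \<rho> (g * h)" by (simp add: Sf g(2) mult_single)
    have "L0 (c * S f) = L0 (S (c * f))"
      using op_act_mult_const[OF tderiv_pth[OF g(1)]] by (simp add: g(2)[symmetric] L0_S f cf)
    moreover have "g * h \<in> weight_space L \<rho>"
      unfolding h_def by (intro weight_space_mult_pth g(1) H_weight_space S_maps f)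
    ultimately have "single \<rho> (g * h) = S (c * f)"
      unfolding eq by (intro L0_eqI S_maps cf)
    thus ?thesis unfolding eq by (rule sym)
  qed simp
qed

lemma T_eq: "T f = - (\<Sum>j\<le>degree L. tser (fps_shift (Suc j) (coeff L j)) * (tX * (tX ^ j * (tderiv ^^ j) f)))"
  using op_act_split[OF shift, of f] by (simp add: algebra_simps)

lemma T_maps: "f \<in> F \<Longrightarrow> T f \<in> G"
  unfolding T_eq tconst_minus_1[symmetric]
  by (intro series_space_scale series_space_sum series_space_tser lower_index_mono
      series_space_tX[OF series_space_falling[OF _ char]]) (auto simp: admissible_eq)

lemma T_vanish: "vanish \<rho> N f \<Longrightarrow> vanish \<rho> (Suc N) (T f)"
  unfolding T_eq
  by (subst diff_0[symmetric], rule vanish_diff[OF vanish_0],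
      intro vanish_sum vanish_tser vanish_tX vanish_falling)

text \<open>The initial form preserves powers of x and is injective on each coefficient satisfying
  the weight condition, so a zero coefficient of g forces a zero coefficient of S g.\<close>

lemma S_vanish:
  assumes g: "g \<in> G" and N: "vanish \<rho> N g"
  shows "vanish \<rho> N (S g)"
  unfolding vanish_def
proof (intro allI impI)
  fix n assume "n < int N"
  hence zero: "zchi L (\<rho> + of_int n) (lookup (S g) \<rho> $$ n) = 0"
    using N L0_S[OF g] lookup_op_act_initial_form[of L "S g" \<rho> n] by (simp add: vanish_def)
  have "lookup (S g) \<rho> $$ n \<in> weight_span (expo_mult L (\<rho> + of_int n))"
    using H_weight_space[OF S_maps[OF g]] by (simp add: weight_space_def)
  from zchi_weight_span_inj[OF this zero shift char] show "lookup (S g) \<rho> $$ n = 0" .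
qed

lemma T_C_linear: "C_linear_on F T"
  by (rule C_linear_onI)
    (simp_all add: op_act_add op_act_scale op_act_C_mult right_diff_distrib)

lemma ST_C_linear: "C_linear_on F (S \<circ> T)"
proof (rule C_linear_onI)
  fix f g assume fg: "f \<in> F" "g \<in> F"
  have "T (f + g) = T f + T g" using T_C_linear fg unfolding C_linear_on_def by blast
  thus "(S \<circ> T) (f + g) = (S \<circ> T) f + (S \<circ> T) g"
    using S_C_linear T_maps[OF fg(1)] T_maps[OF fg(2)] by (simp add: C_linear_on_def)
next
  fix a f assume f: "f \<in> F"
  have "T (tconst a * f) = tconst a * T f" using T_C_linear f unfolding C_linear_on_def by blast
  thus "(S \<circ> T) (tconst a * f) = tconst a * (S \<circ> T) f"
    using S_C_linear T_maps[OF f] by (simp add: C_linear_on_def)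
next
  fix c f assume f: "c \<in> tconstants" "f \<in> F" "c * f \<in> F"
  have "T (c * f) = c * T f" using T_C_linear f unfolding C_linear_on_def by blast
  thus "(S \<circ> T) (c * f) = c * (S \<circ> T) f"
    using S_C_linear f(1) T_maps[OF f(2)] T_maps[OF f(3)] by (simp add: C_linear_on_def)
qed

sublocale ser: raising \<rho> "admissible L \<rho>" "S \<circ> T"
proof
  show "(S \<circ> T) f \<in> F" if "f \<in> F" for f
    using that by (simp add: S_maps_F T_maps)
  show "vanish \<rho> (Suc N) ((S \<circ> T) f)" if "f \<in> F" "vanish \<rho> N f" for f N
    using that by (simp add: S_vanish T_maps T_vanish)
qed (rule ST_C_linear char)+

text \<open>On F one has L = L0 - T = L0 - L0 S T = L0 u, because S is a right inverse on the image
  of T; composing with v gives the claim.\<close>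

lemma op_act_v:
  assumes f: "f \<in> F"
  shows "op_act L (ser.v f) = L0 f"
proof -
  have "L0 f = L0 (ser.u (ser.v f))" by (simp add: ser.u_v f)
  also have "\<dots> = L0 (ser.v f + tconst (- 1) * S (T (ser.v f)))" by (simp add: ser.u_def tconst_minus_1)
  also have "\<dots> = L0 (ser.v f) - L0 (S (T (ser.v f)))"
    by (simp only: op_act_add op_act_scale) (simp add: tconst_minus_1)
  also have "L0 (S (T (ser.v f))) = T (ser.v f)" by (rule L0_S[OF T_maps[OF ser.v_maps[OF f]]])
  finally have "L0 f = L0 (ser.v f) - (L0 (ser.v f) - op_act L (ser.v f))" .
  moreover have "a = b - (b - c) \<Longrightarrow> c = a" for a b c :: "'k tring" by simp
  ultimately show ?thesis by blast
qed

end

unbundle no fps_syntax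

theorem theorem3p16:
  fixes L :: "'k::alg_closed_field fps poly" and \<rho> :: 'k
    and F Fx H :: "'k tring set"
    and X :: "'k tring topology"
    and L0 S T u v :: "'k tring \<Rightarrow> 'k tring"
  assumes "CHAR('k) > 0"
    and "is_shift L 0"
    and "poly (indicial_poly L) \<rho> = 0"
    and "F = fun_space L \<rho>"
    and "Fx = (\<lambda>f. f * tX) ` F"
    and "X = xadic_topology L \<rho>"
    and "H = H_space L \<rho>"
    and "L0 = op_act (initial_form L)"
    and "S = inv_into H L0"
    and "T = (\<lambda>f. L0 f - op_act L f)"
    and "u = (\<lambda>f. f - S (T f))"
    and "v = (\<lambda>f. topological_sum X (\<lambda>k. ((S \<circ> T) ^^ k) f))"
  shows
    "\<comment> \<open>(i)\<close>
     (H \<subseteq> F \<and> bij_betw L0 H Fx \<and> S ` Fx \<subseteq> F \<and> C_linear_on Fx S \<and> (\<forall>g\<in>Fx. L0 (S g) = g)) \<and>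
     \<comment> \<open>(ii)\<close>
     (T ` F \<subseteq> Fx \<and> cont_C_automorphism X u \<and>
      (\<forall>f\<in>F. limitin X (\<lambda>n. \<Sum>k<n. ((S \<circ> T) ^^ k) f) (v f) sequentially) \<and>
      (\<forall>f\<in>F. v (u f) = f \<and> u (v f) = f)) \<and>
     \<comment> \<open>(iii)\<close>
     (cont_C_automorphism X v \<and> (\<forall>f\<in>F. op_act L (v f) = L0 f))"
proof -
  interpret O: shift_zero_operator L \<rho> by standard fact+
  have F: "F = O.F" using assms(4) by (simp add: fun_space_eq)
  have Fx: "Fx = O.G" using assms(4,5) by (simp add: fun_space_tX_eq)
  have X: "X = series_topology \<rho> (admissible L \<rho>)" using assms(6) by (simp add: xadic_topology_eq)
  have H: "H = O.H" using assms(7) by (simp add: H_space_eq)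
  have S: "S = O.S" using assms(8,9) H by simp
  have T: "T = O.T" using assms(8,10) by simp
  have u: "u = O.ser.u" using assms(11) S T by (simp add: O.ser.u_def fun_eq_iff)
  have v: "v = O.ser.v" using assms(12) S T X by (simp add: O.ser.v_def fun_eq_iff)
  show ?thesis
    unfolding F Fx X H S T u v assms(8)
    using O.bij_L0 O.S_maps_F O.S_C_linear O.L0_S O.T_maps O.ser.u_automorphism O.ser.limit_v O.ser.v_u O.ser.u_v
      O.ser.v_automorphism O.op_act_v H_series_admissible
    by (intro conjI ballI image_subsetI subsetI) auto
qed

end
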